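(* For all (external) natural numbers $h,k$, the theory $\mathsf{RCA}^*_0+\mathrm{Tot}(F_h)$ proves that the following are equivalent: $\mathrm{WPH}^{h,2}_k$, $k\text{-}\mathrm{HCT}^h$, and $k\text{-}\mathrm{TT}^h$.
   Context: $\mathsf{RCA}^*_0$ is second-order arithmetic with exponentiation, $\Delta^0_0$-induction and $\Delta^0_1$-comprehension. The fast growing functions are $F_0(x)=x+1$, $F_{n+1}(x)=F_n^{(x+1)}(x)$ ($(x+1)$-fold iterate); $\mathrm{Tot}(F_h)$ states that $F_h$ is total. A finite set $X$ is $1$-large if $\min X<|X|$. For a colouring $P:[X]^2\to k$, $Y=\{y_0<y_1<\cdots\}\subseteq X$ is weakly homogeneous if $P(\{y_n,y_{n+1}\})$ is the same for all $n$. A weight function for $R$ is $g$ with $xRy\Rightarrow g(x)<g(y)$; $R$ has height $\omega$ if it has a weight function. $\mathrm{WPH}^{h,2}_k$: for every $f:\mathbb{N}\to\mathbb{N}$ with $f(n+1)<F_h(f(n))$ for all $n$, and every $P:[\mathrm{rng}(f)]^2\to k$, there is a $1$-large weakly homogeneous set for $P$. $k\text{-}\mathrm{HCT}^h$: if $R_0,\dots,R_{k-1}$ are binary relations of height $\omega$ with weight functions $f_i$ satisfying $f_i(n)<F_h(n)$ for all $n$, then every transitive $(R_0\cup\dots\cup R_{k-1})$-decreasing sequence $f:\mathbb{N}\to\mathbb{N}$ (i.e. $f(m)\,(R_0\cup\dots\cup R_{k-1})\,f(n)$ whenever $n<m$) with $f(n+1)<F_h(f(n))$ for all $n$ is finite.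 $k\text{-}\mathrm{TT}^h$: let $R$ be a deterministic binary relation whose transition function $f:\mathbb{N}\to\mathbb{N}$ satisfies $f(n+1)<F_h(f(n))$ for all $n$; if there exist relations $R_0,\dots,R_{k-1}$ of height $\omega$ with weight functions $f_i$ satisfying $f_i(n)<F_h(n)$ for all $n$, and $R_0\cup\dots\cup R_{k-1}\supseteq R^+$ (transitive closure), then $R$ is well-founded.
   Formalization: In WPH, f is required to be strictly increasing (a constant f=3 refutes the literal principle, while HCT holds); in TT, the transition function f is read as a run: every transition of R goes from some f(n) to f(n+1), with inclusion rather than equality. *)

theory Defs
  imports Main
begin

section \<open>The language of second-order arithmetic with exponentiation\<close>

text \<open>
  De Bruijn syntax with two independent index spaces, one for number variables (bound by
  \<open>All\<close>) and one for set variables (bound by \<open>AllS\<close>). Set variables are the only set terms, and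
  there is no primitive equality between sets.
\<close>

datatype tm = Var nat | Zero | One | Add tm tm | Mul tm tm | Pow tm tm

datatype fm = Fls | Eq tm tm | Lt tm tm | Mem tm nat | Imp fm fm | All fm | AllS fm

definition Neg :: "fm \<Rightarrow> fm" where "Neg p = Imp p Fls"
definition Con :: "fm \<Rightarrow> fm \<Rightarrow> fm" where "Con p q = Neg (Imp p (Neg q))"
definition Dis :: "fm \<Rightarrow> fm \<Rightarrow> fm" where "Dis p q = Imp (Neg p) q"
definition Iff :: "fm \<Rightarrow> fm \<Rightarrow> fm" where "Iff p q = Con (Imp p q) (Imp q p)"
definition Ex :: "fm \<Rightarrow> fm" where "Ex p = Neg (All (Neg p))"
definition ExS :: "fm \<Rightarrow> fm" where "ExS p = Neg (AllS (Neg p))"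

primrec subst_tm :: "(nat \<Rightarrow> tm) \<Rightarrow> tm \<Rightarrow> tm" where
  "subst_tm s (Var i) = s i"
| "subst_tm s Zero = Zero"
| "subst_tm s One = One"
| "subst_tm s (Add t u) = Add (subst_tm s t) (subst_tm s u)"
| "subst_tm s (Mul t u) = Mul (subst_tm s t) (subst_tm s u)"
| "subst_tm s (Pow t u) = Pow (subst_tm s t) (subst_tm s u)"

abbreviation lift_tm :: "tm \<Rightarrow> tm" where
  "lift_tm \<equiv> subst_tm (\<lambda>i. Var (Suc i))"

text \<open>
  Simultaneous capture-avoiding substitution: \<open>s\<close> replaces number variables by terms, \<open>r\<close>
  replaces set variables by set variables.
\<close>

primrec subst :: "(nat \<Rightarrow> tm) \<Rightarrow> (nat \<Rightarrow> nat) \<Rightarrow> fm \<Rightarrow> fm" where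
  "subst s r Fls = Fls"
| "subst s r (Eq t u) = Eq (subst_tm s t) (subst_tm s u)"
| "subst s r (Lt t u) = Lt (subst_tm s t) (subst_tm s u)"
| "subst s r (Mem t X) = Mem (subst_tm s t) (r X)"
| "subst s r (Imp p q) = Imp (subst s r p) (subst s r q)"
| "subst s r (All p) = All (subst (case_nat (Var 0) (\<lambda>i. lift_tm (s i))) r p)"
| "subst s r (AllS p) = AllS (subst s (case_nat 0 (\<lambda>i. Suc (r i))) p)"

definition lift :: "fm \<Rightarrow> fm" where "lift = subst (\<lambda>i. Var (Suc i)) id"
definition liftS :: "fm \<Rightarrow> fm" where "liftS = subst Var Suc"
definition inst :: "tm \<Rightarrow> fm \<Rightarrow> fm" where "inst t = subst (case_nat t Var) id"
definition instS :: "nat \<Rightarrow> fm \<Rightarrow> fm" where "instS X = subst Var (case_nat X id)"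

primrec bounded_tm :: "nat \<Rightarrow> tm \<Rightarrow> bool" where
  "bounded_tm n (Var i) \<longleftrightarrow> i < n"
| "bounded_tm n Zero \<longleftrightarrow> True"
| "bounded_tm n One \<longleftrightarrow> True"
| "bounded_tm n (Add t u) \<longleftrightarrow> bounded_tm n t \<and> bounded_tm n u"
| "bounded_tm n (Mul t u) \<longleftrightarrow> bounded_tm n t \<and> bounded_tm n u"
| "bounded_tm n (Pow t u) \<longleftrightarrow> bounded_tm n t \<and> bounded_tm n u"

text \<open>The free number and set variables of \<open>p\<close> have indices below \<open>n\<close> and \<open>m\<close> respectively.\<close>

primrec bounded_fm :: "nat \<Rightarrow> nat \<Rightarrow> fm \<Rightarrow> bool" where
  "bounded_fm n m Fls \<longleftrightarrow> True"
| "bounded_fm n m (Eq t u) \<longleftrightarrow> bounded_tm n t \<and> bounded_tm n u"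
| "bounded_fm n m (Lt t u) \<longleftrightarrow> bounded_tm n t \<and> bounded_tm n u"
| "bounded_fm n m (Mem t X) \<longleftrightarrow> bounded_tm n t \<and> X < m"
| "bounded_fm n m (Imp p q) \<longleftrightarrow> bounded_fm n m p \<and> bounded_fm n m q"
| "bounded_fm n m (All p) \<longleftrightarrow> bounded_fm (Suc n) m p"
| "bounded_fm n m (AllS p) \<longleftrightarrow> bounded_fm n (Suc m) p"


section \<open>Provability\<close>

text \<open>
  Natural deduction for classical two-sorted first-order logic with equality on numbers.
  Lifting the hypotheses in the introduction rules for quantifiers is the eigenvariable
  condition.
\<close>

inductive proves :: "fm set \<Rightarrow> fm \<Rightarrow> bool" (infix "\<turnstile>" 50) where
  Assm: "p \<in> \<Gamma> \<Longrightarrow> \<Gamma> \<turnstile> p"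
| ImpI: "insert p \<Gamma> \<turnstile> q \<Longrightarrow> \<Gamma> \<turnstile> Imp p q"
| ImpE: "\<Gamma> \<turnstile> Imp p q \<Longrightarrow> \<Gamma> \<turnstile> p \<Longrightarrow> \<Gamma> \<turnstile> q"
| Class: "insert (Neg p) \<Gamma> \<turnstile> Fls \<Longrightarrow> \<Gamma> \<turnstile> p"
| AllI: "lift ` \<Gamma> \<turnstile> p \<Longrightarrow> \<Gamma> \<turnstile> All p"
| AllE: "\<Gamma> \<turnstile> All p \<Longrightarrow> \<Gamma> \<turnstile> inst t p"
| AllSI: "liftS ` \<Gamma> \<turnstile> p \<Longrightarrow> \<Gamma> \<turnstile> AllS p"
| AllSE: "\<Gamma> \<turnstile> AllS p \<Longrightarrow> \<Gamma> \<turnstile> instS X p"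
| EqI: "\<Gamma> \<turnstile> Eq t t"
| EqE: "\<Gamma> \<turnstile> Eq t u \<Longrightarrow> \<Gamma> \<turnstile> inst t p \<Longrightarrow> \<Gamma> \<turnstile> inst u p"


section \<open>Notation with bound variables\<close>

text \<open>
  To write concrete formulas with named bound variables, terms, set variables and formulas are
  represented as functions of the numbers \<open>d\<close> and \<open>e\<close> of number and set quantifiers in whose
  scope they occur. A variable bound at depth \<open>d\<close> has index \<open>d' - Suc d\<close> when it is used at
  depth \<open>d'\<close>. A closed formula is obtained by starting at depth \<open>0\<close>.
\<close>

type_synonym trm = "nat \<Rightarrow> tm"
type_synonym sv = "nat \<Rightarrow> nat"
type_synonym form = "nat \<Rightarrow> nat \<Rightarrow> fm"

definition sentence :: "form \<Rightarrow> fm" where "sentence p = p 0 0"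

definition zero :: trm ("\<^bold>0") where "\<^bold>0 = (\<lambda>d. Zero)"
definition one :: trm ("\<^bold>1") where "\<^bold>1 = (\<lambda>d. One)"
definition add :: "trm \<Rightarrow> trm \<Rightarrow> trm" (infixl "\<^bold>+" 65) where "t \<^bold>+ u = (\<lambda>d. Add (t d) (u d))"
definition mul :: "trm \<Rightarrow> trm \<Rightarrow> trm" (infixl "\<^bold>\<cdot>" 70) where "t \<^bold>\<cdot> u = (\<lambda>d. Mul (t d) (u d))"
definition pow :: "trm \<Rightarrow> trm \<Rightarrow> trm" (infixr "\<^bold>^" 80) where "t \<^bold>^ u = (\<lambda>d. Pow (t d) (u d))"

definition fls :: form ("\<^bold>\<bottom>") where "\<^bold>\<bottom> = (\<lambda>d e. Fls)"
definition eq :: "trm \<Rightarrow> trm \<Rightarrow> form" (infix "\<^bold>=" 50) where "(t \<^bold>= u) = (\<lambda>d e. Eq (t d) (u d))"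
definition lt :: "trm \<Rightarrow> trm \<Rightarrow> form" (infix "\<^bold><" 50) where "(t \<^bold>< u) = (\<lambda>d e. Lt (t d) (u d))"
definition mem :: "trm \<Rightarrow> sv \<Rightarrow> form" (infix "\<^bold>\<in>" 50) where "(t \<^bold>\<in> X) = (\<lambda>d e. Mem (t d) (X e))"
definition neg :: "form \<Rightarrow> form" ("\<^bold>\<not> _" [40] 40) where "(\<^bold>\<not> p) = (\<lambda>d e. Neg (p d e))"
definition con :: "form \<Rightarrow> form \<Rightarrow> form" (infixr "\<^bold>\<and>" 35) where
  "(p \<^bold>\<and> q) = (\<lambda>d e. Con (p d e) (q d e))"
definition dis :: "form \<Rightarrow> form \<Rightarrow> form" (infixr "\<^bold>\<or>" 30) where
  "(p \<^bold>\<or> q) = (\<lambda>d e. Dis (p d e) (q d e))"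
definition imp :: "form \<Rightarrow> form \<Rightarrow> form" (infixr "\<^bold>\<longrightarrow>" 25) where
  "(p \<^bold>\<longrightarrow> q) = (\<lambda>d e. Imp (p d e) (q d e))"
definition iff :: "form \<Rightarrow> form \<Rightarrow> form" (infixr "\<^bold>\<longleftrightarrow>" 25) where
  "(p \<^bold>\<longleftrightarrow> q) = (\<lambda>d e. Iff (p d e) (q d e))"
definition all :: "(trm \<Rightarrow> form) \<Rightarrow> form" (binder "\<^bold>\<forall>" 10) where
  "all B = (\<lambda>d e. All (B (\<lambda>d'. Var (d' - Suc d)) (Suc d) e))"
definition ex :: "(trm \<Rightarrow> form) \<Rightarrow> form" (binder "\<^bold>\<exists>" 10) where
  "ex B = (\<lambda>d e. Ex (B (\<lambda>d'. Var (d' - Suc d)) (Suc d) e))"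
definition allS :: "(sv \<Rightarrow> form) \<Rightarrow> form" (binder "\<^bold>\<forall>\<^sub>S" 10) where
  "allS B = (\<lambda>d e. AllS (B (\<lambda>e'. e' - Suc e) d (Suc e)))"
definition exS :: "(sv \<Rightarrow> form) \<Rightarrow> form" (binder "\<^bold>\<exists>\<^sub>S" 10) where
  "exS B = (\<lambda>d e. ExS (B (\<lambda>e'. e' - Suc e) d (Suc e)))"

text \<open>
  Metatheoretic natural numbers enter formulas through numerals, finite conjunctions and
  disjunctions, and blocks of set quantifiers.
\<close>

primrec num :: "nat \<Rightarrow> trm" where
  "num 0 = \<^bold>0"
| "num (Suc n) = num n \<^bold>+ \<^bold>1"

primrec Conj_lt :: "nat \<Rightarrow> (nat \<Rightarrow> form) \<Rightarrow> form" where
  "Conj_lt 0 p = (\<^bold>\<not> \<^bold>\<bottom>)"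
| "Conj_lt (Suc k) p = (Conj_lt k p \<^bold>\<and> p k)"

primrec Disj_lt :: "nat \<Rightarrow> (nat \<Rightarrow> form) \<Rightarrow> form" where
  "Disj_lt 0 p = \<^bold>\<bottom>"
| "Disj_lt (Suc k) p = (Disj_lt k p \<^bold>\<or> p k)"

primrec all_sets :: "nat \<Rightarrow> (sv list \<Rightarrow> form) \<Rightarrow> form" where
  "all_sets 0 B = B []"
| "all_sets (Suc k) B = (\<^bold>\<forall>\<^sub>S X. all_sets k (\<lambda>Xs. B (X # Xs)))"

primrec ex_sets :: "nat \<Rightarrow> (sv list \<Rightarrow> form) \<Rightarrow> form" where
  "ex_sets 0 B = B []"
| "ex_sets (Suc k) B = (\<^bold>\<exists>\<^sub>S X. ex_sets k (\<lambda>Xs. B (X # Xs)))"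


section \<open>The theory \<open>RCA\<^sup>*\<^sub>0\<close>\<close>

definition basic_axioms :: "fm set" where
  "basic_axioms = sentence `
    {\<^bold>\<forall>x. \<^bold>\<not> x \<^bold>+ \<^bold>1 \<^bold>= \<^bold>0,
     \<^bold>\<forall>x. \<^bold>\<forall>y. x \<^bold>+ \<^bold>1 \<^bold>= y \<^bold>+ \<^bold>1 \<^bold>\<longrightarrow> x \<^bold>= y,
     \<^bold>\<forall>x. x \<^bold>+ \<^bold>0 \<^bold>= x,
     \<^bold>\<forall>x. \<^bold>\<forall>y. x \<^bold>+ (y \<^bold>+ \<^bold>1) \<^bold>= (x \<^bold>+ y) \<^bold>+ \<^bold>1,
     \<^bold>\<forall>x. x \<^bold>\<cdot> \<^bold>0 \<^bold>= \<^bold>0,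
     \<^bold>\<forall>x. \<^bold>\<forall>y. x \<^bold>\<cdot> (y \<^bold>+ \<^bold>1) \<^bold>= x \<^bold>\<cdot> y \<^bold>+ x,
     \<^bold>\<forall>x. \<^bold>\<not> x \<^bold>< \<^bold>0,
     \<^bold>\<forall>x. \<^bold>\<forall>y. x \<^bold>< y \<^bold>+ \<^bold>1 \<^bold>\<longleftrightarrow> x \<^bold>< y \<^bold>\<or> x \<^bold>= y,
     \<^bold>\<forall>x. x \<^bold>^ \<^bold>0 \<^bold>= \<^bold>1,
     \<^bold>\<forall>x. \<^bold>\<forall>y. x \<^bold>^ (y \<^bold>+ \<^bold>1) \<^bold>= x \<^bold>^ y \<^bold>\<cdot> x}"

text \<open>
  \<open>\<Sigma>\<^sup>0\<^sub>0\<close> formulas: number quantifiers are bounded by a term not containing the quantified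
  variable, set parameters are allowed, set quantifiers are not.
\<close>

inductive Sigma00 :: "fm \<Rightarrow> bool" where
  "Sigma00 Fls"
| "Sigma00 (Eq t u)"
| "Sigma00 (Lt t u)"
| "Sigma00 (Mem t X)"
| "Sigma00 p \<Longrightarrow> Sigma00 q \<Longrightarrow> Sigma00 (Imp p q)"
| "Sigma00 p \<Longrightarrow> Sigma00 (All (Imp (Lt (Var 0) (lift_tm t)) p))"
| "Sigma00 p \<Longrightarrow> Sigma00 (Ex (Con (Lt (Var 0) (lift_tm t)) p))"

inductive Sigma01 :: "fm \<Rightarrow> bool" where
  "Sigma00 p \<Longrightarrow> Sigma01 (Ex p)"

inductive Pi01 :: "fm \<Rightarrow> bool" where
  "Sigma00 p \<Longrightarrow> Pi01 (All p)"

text \<open>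
  In both schemes the distinguished number variable has index \<open>0\<close>; every other free variable is
  a parameter. The lifting in \<open>comp_inst\<close> says that the new set is not free in the
  defining formula.
\<close>

definition ind_inst :: "fm \<Rightarrow> fm" where
  "ind_inst p =
    Imp (Con (inst Zero p)
             (All (Imp p (subst (case_nat (Add (Var 0) One) (\<lambda>i. Var (Suc i))) id p))))
        (All p)"

definition comp_inst :: "fm \<Rightarrow> fm \<Rightarrow> fm" where
  "comp_inst p q = Imp (All (Iff p q)) (ExS (All (Iff (Mem (Var 0) 0) (liftS p))))"

definition closures :: "fm \<Rightarrow> fm set" where
  "closures p = {(All ^^ n) ((AllS ^^ m) p) | n m. bounded_fm n m p}"

definition RCA0_star :: "fm set" where
  "RCA0_star = basic_axioms
    \<union> (\<Union>p \<in> {p. Sigma00 p}. closures (ind_inst p))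
    \<union> (\<Union>(p, q) \<in> {(p, q). Sigma01 p \<and> Pi01 q}. closures (comp_inst p q))"


section \<open>Pairs, functions, relations and finite sequences\<close>

definition pair :: "trm \<Rightarrow> trm \<Rightarrow> trm" where
  "pair x y = (x \<^bold>+ y) \<^bold>\<cdot> (x \<^bold>+ y) \<^bold>+ x"

definition Rel :: "sv \<Rightarrow> form" where
  "Rel R = (\<^bold>\<forall>z. z \<^bold>\<in> R \<^bold>\<longrightarrow> (\<^bold>\<exists>x. \<^bold>\<exists>y. z \<^bold>= pair x y))"

definition rel :: "trm \<Rightarrow> sv \<Rightarrow> trm \<Rightarrow> form" where
  "rel x R y = (pair x y \<^bold>\<in> R)"

text \<open>\<open>app f x y\<close> says \<open>f(x) = y\<close>.\<close>

definition app :: "sv \<Rightarrow> trm \<Rightarrow> trm \<Rightarrow> form" where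
  "app f x y = (pair x y \<^bold>\<in> f)"

definition Fun :: "sv \<Rightarrow> form" where
  "Fun f = (Rel f \<^bold>\<and> (\<^bold>\<forall>x. \<^bold>\<exists>y. app f x y) \<^bold>\<and>
            (\<^bold>\<forall>x. \<^bold>\<forall>y. \<^bold>\<forall>z. app f x y \<^bold>\<and> app f x z \<^bold>\<longrightarrow> y \<^bold>= z))"

definition in_rng :: "trm \<Rightarrow> sv \<Rightarrow> form" where
  "in_rng y f = (\<^bold>\<exists>x. app f x y)"

text \<open>
  A finite sequence of numbers below \<open>b\<close> is coded by the pair \<open>c, b\<close>, its entries being base \<open>b\<close>
  digits of \<open>c\<close>: \<open>entry c b i x\<close> says that \<open>x\<close> is the coefficient of \<open>b\<^sup>i\<close>. The length of
  a sequence is always given separately.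
\<close>

definition entry :: "trm \<Rightarrow> trm \<Rightarrow> trm \<Rightarrow> trm \<Rightarrow> form" where
  "entry c b i x =
    (x \<^bold>< b \<^bold>\<and> (\<^bold>\<exists>q. \<^bold>\<exists>r. r \<^bold>< b \<^bold>^ i \<^bold>\<and> c \<^bold>= (q \<^bold>\<cdot> b \<^bold>+ x) \<^bold>\<cdot> b \<^bold>^ i \<^bold>+ r))"


section \<open>The fast growing functions\<close>

text \<open>
  \<open>Fgraph h x y\<close> says \<open>F\<^sub>h(x) = y\<close>. In the recursive clause \<open>c, b\<close> codes the sequence
  \<open>x, F\<^sub>h(x), F\<^sub>h(F\<^sub>h(x)), \<dots>\<close> up to the \<open>(x+1)\<close>-st iterate.
\<close>

primrec Fgraph :: "nat \<Rightarrow> trm \<Rightarrow> trm \<Rightarrow> form" where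
  "Fgraph 0 x y = (y \<^bold>= x \<^bold>+ \<^bold>1)"
| "Fgraph (Suc h) x y =
    (\<^bold>\<exists>c. \<^bold>\<exists>b. entry c b \<^bold>0 x \<^bold>\<and> entry c b (x \<^bold>+ \<^bold>1) y \<^bold>\<and>
      (\<^bold>\<forall>i. i \<^bold>< x \<^bold>+ \<^bold>1 \<^bold>\<longrightarrow>
        (\<^bold>\<exists>u. \<^bold>\<exists>v. entry c b i u \<^bold>\<and> entry c b (i \<^bold>+ \<^bold>1) v \<^bold>\<and> Fgraph h u v)))"

definition Tot :: "nat \<Rightarrow> form" where
  "Tot h = (\<^bold>\<forall>x. \<^bold>\<exists>y. Fgraph h x y)"

text \<open>\<open>less_F h x y\<close> says \<open>x < F\<^sub>h(y)\<close>.\<close>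

definition less_F :: "nat \<Rightarrow> trm \<Rightarrow> trm \<Rightarrow> form" where
  "less_F h x y = (\<^bold>\<exists>z. Fgraph h y z \<^bold>\<and> x \<^bold>< z)"

definition F_controlled :: "nat \<Rightarrow> sv \<Rightarrow> form" where
  "F_controlled h f =
    (\<^bold>\<forall>n. \<^bold>\<forall>x. \<^bold>\<forall>y. app f n x \<^bold>\<and> app f (n \<^bold>+ \<^bold>1) y \<^bold>\<longrightarrow> less_F h y x)"

definition F_bounded :: "nat \<Rightarrow> sv \<Rightarrow> form" where
  "F_bounded h f = (\<^bold>\<forall>n. \<^bold>\<forall>x. app f n x \<^bold>\<longrightarrow> less_F h x n)"


section \<open>The weak Paris--Harrington principle\<close>

definition Increasing :: "sv \<Rightarrow> form" where
  "Increasing f = (\<^bold>\<forall>m. \<^bold>\<forall>n. \<^bold>\<forall>x. \<^bold>\<forall>y. m \<^bold>< n \<^bold>\<and> app f m x \<^bold>\<and> app f n y \<^bold>\<longrightarrow> x \<^bold>< y)"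

text \<open>
  \<open>P : [rng(f)]\<^sup>2 \<rightarrow> k\<close> is a set of triples \<open>((x, y), i)\<close>; an unordered pair is represented by the
  ordered pair \<open>(x, y)\<close> with \<open>x < y\<close>.
\<close>

definition colour :: "sv \<Rightarrow> trm \<Rightarrow> trm \<Rightarrow> trm \<Rightarrow> form" where
  "colour P x y i = (pair (pair x y) i \<^bold>\<in> P)"

definition Colouring :: "nat \<Rightarrow> sv \<Rightarrow> sv \<Rightarrow> form" where
  "Colouring k f P =
    ((\<^bold>\<forall>z. z \<^bold>\<in> P \<^bold>\<longrightarrow> (\<^bold>\<exists>x. \<^bold>\<exists>y. \<^bold>\<exists>i. z \<^bold>= pair (pair x y) i \<^bold>\<and>
        in_rng x f \<^bold>\<and> in_rng y f \<^bold>\<and> x \<^bold>< y \<^bold>\<and> i \<^bold>< num k)) \<^bold>\<and>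
     (\<^bold>\<forall>x. \<^bold>\<forall>y. in_rng x f \<^bold>\<and> in_rng y f \<^bold>\<and> x \<^bold>< y \<^bold>\<longrightarrow> (\<^bold>\<exists>i. i \<^bold>< num k \<^bold>\<and> colour P x y i)) \<^bold>\<and>
     (\<^bold>\<forall>x. \<^bold>\<forall>y. \<^bold>\<forall>i. \<^bold>\<forall>j. colour P x y i \<^bold>\<and> colour P x y j \<^bold>\<longrightarrow> i \<^bold>= j))"

text \<open>\<open>c, b\<close> codes the increasing enumeration \<open>y\<^sub>0 < \<dots> < y\<^bsub>l-1\<^esub>\<close> of the finite set \<open>Y\<close>.\<close>

definition Enumerates :: "trm \<Rightarrow> trm \<Rightarrow> trm \<Rightarrow> sv \<Rightarrow> form" where
  "Enumerates c b l Y =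
    ((\<^bold>\<forall>z. z \<^bold>\<in> Y \<^bold>\<longleftrightarrow> (\<^bold>\<exists>i. i \<^bold>< l \<^bold>\<and> entry c b i z)) \<^bold>\<and>
     (\<^bold>\<forall>i. i \<^bold>+ \<^bold>1 \<^bold>< l \<^bold>\<longrightarrow>
       (\<^bold>\<exists>u. \<^bold>\<exists>v. entry c b i u \<^bold>\<and> entry c b (i \<^bold>+ \<^bold>1) v \<^bold>\<and> u \<^bold>< v)))"

definition One_large :: "trm \<Rightarrow> trm \<Rightarrow> trm \<Rightarrow> form" where
  "One_large c b l = (\<^bold>\<exists>m. entry c b \<^bold>0 m \<^bold>\<and> m \<^bold>< l)"

definition Weakly_homogeneous :: "sv \<Rightarrow> trm \<Rightarrow> trm \<Rightarrow> trm \<Rightarrow> form" where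
  "Weakly_homogeneous P c b l =
    (\<^bold>\<exists>j. \<^bold>\<forall>i. i \<^bold>+ \<^bold>1 \<^bold>< l \<^bold>\<longrightarrow>
      (\<^bold>\<exists>u. \<^bold>\<exists>v. entry c b i u \<^bold>\<and> entry c b (i \<^bold>+ \<^bold>1) v \<^bold>\<and> colour P u v j))"

text \<open>
  \<open>f\<close> is required to be increasing, i.e. to enumerate the set \<open>rng(f)\<close> whose pairs are coloured:
  a constant \<open>f\<close> would refute the principle as soon as \<open>h\<close> is positive.
\<close>

definition WPH :: "nat \<Rightarrow> nat \<Rightarrow> form" where
  "WPH h k =
    (\<^bold>\<forall>\<^sub>S f. \<^bold>\<forall>\<^sub>S P. Fun f \<^bold>\<and> Increasing f \<^bold>\<and> F_controlled h f \<^bold>\<and> Colouring k f P \<^bold>\<longrightarrow>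
      (\<^bold>\<exists>\<^sub>S Y. (\<^bold>\<forall>y. y \<^bold>\<in> Y \<^bold>\<longrightarrow> in_rng y f) \<^bold>\<and>
        (\<^bold>\<exists>c. \<^bold>\<exists>b. \<^bold>\<exists>l. Enumerates c b l Y \<^bold>\<and> One_large c b l \<^bold>\<and> Weakly_homogeneous P c b l)))"


section \<open>Height \<open>\<omega>\<close>, the H-closure theorem and the termination theorem\<close>

definition Weight :: "sv \<Rightarrow> sv \<Rightarrow> form" where
  "Weight g R =
    (Fun g \<^bold>\<and> (\<^bold>\<forall>x. \<^bold>\<forall>y. \<^bold>\<forall>u. \<^bold>\<forall>v. rel x R y \<^bold>\<and> app g x u \<^bold>\<and> app g y v \<^bold>\<longrightarrow> u \<^bold>< v))"

text \<open>The relations in \<open>Rs\<close> have height \<open>\<omega>\<close>, witnessed by the weight functions in \<open>gs\<close>.\<close>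

definition Weighted :: "nat \<Rightarrow> nat \<Rightarrow> sv list \<Rightarrow> sv list \<Rightarrow> form" where
  "Weighted h k Rs gs =
    Conj_lt k (\<lambda>i. Rel (Rs ! i) \<^bold>\<and> Weight (gs ! i) (Rs ! i) \<^bold>\<and> F_bounded h (gs ! i))"

definition rel_Union :: "nat \<Rightarrow> trm \<Rightarrow> sv list \<Rightarrow> trm \<Rightarrow> form" where
  "rel_Union k x Rs y = Disj_lt k (\<lambda>i. rel x (Rs ! i) y)"

definition Trans_decreasing :: "nat \<Rightarrow> sv list \<Rightarrow> sv \<Rightarrow> form" where
  "Trans_decreasing k Rs f =
    (\<^bold>\<forall>n. \<^bold>\<forall>m. \<^bold>\<forall>x. \<^bold>\<forall>y. n \<^bold>< m \<^bold>\<and> app f n x \<^bold>\<and> app f m y \<^bold>\<longrightarrow> rel_Union k y Rs x)"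

text \<open>Finiteness of all such sequences means that none is defined on all numbers.\<close>

definition HCT :: "nat \<Rightarrow> nat \<Rightarrow> form" where
  "HCT k h =
    all_sets k (\<lambda>Rs. all_sets k (\<lambda>gs. Weighted h k Rs gs \<^bold>\<longrightarrow>
      (\<^bold>\<not> (\<^bold>\<exists>\<^sub>S f. Fun f \<^bold>\<and> Trans_decreasing k Rs f \<^bold>\<and> F_controlled h f))))"

text \<open>As with decreasing sequences, \<open>rel y R x\<close> is read as a transition from \<open>x\<close> to \<open>y\<close>.\<close>

definition Deterministic :: "sv \<Rightarrow> form" where
  "Deterministic R = (\<^bold>\<forall>x. \<^bold>\<forall>y. \<^bold>\<forall>z. rel y R x \<^bold>\<and> rel z R x \<^bold>\<longrightarrow> y \<^bold>= z)"

text \<open>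
  The argument of the transition function \<open>f\<close> is time: \<open>f(n)\<close> is the state at step \<open>n\<close>, and the
  transitions of \<open>R\<close> lead from \<open>f(n)\<close> to \<open>f(n+1)\<close>. As \<open>f\<close> is total and \<open>R\<close> may have no
  transition out of a given state, an inclusion and not an equality is required here.
  (If the argument were a state, i.e. \<open>rel y R x\<close> iff \<open>y = f(x)\<close>, the weight bounds would be
  contradictory at state \<open>0\<close>, because \<open>F\<^sub>h(0) = 1\<close>.)
\<close>

definition Transition_function :: "sv \<Rightarrow> sv \<Rightarrow> form" where
  "Transition_function f R =
    (Fun f \<^bold>\<and> (\<^bold>\<forall>x. \<^bold>\<forall>y. rel y R x \<^bold>\<longrightarrow> (\<^bold>\<exists>n. app f n x \<^bold>\<and> app f (n \<^bold>+ \<^bold>1) y)))"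

text \<open>Transitive closure, through coded paths \<open>x = \<sigma>\<^sub>0 R \<sigma>\<^sub>1 R \<dots> R \<sigma>\<^bsub>l+1\<^esub> = y\<close>.\<close>

definition trans_cl :: "trm \<Rightarrow> sv \<Rightarrow> trm \<Rightarrow> form" where
  "trans_cl x R y =
    (\<^bold>\<exists>l. \<^bold>\<exists>c. \<^bold>\<exists>b. entry c b \<^bold>0 x \<^bold>\<and> entry c b (l \<^bold>+ \<^bold>1) y \<^bold>\<and>
      (\<^bold>\<forall>i. i \<^bold>< l \<^bold>+ \<^bold>1 \<^bold>\<longrightarrow>
        (\<^bold>\<exists>u. \<^bold>\<exists>v. entry c b i u \<^bold>\<and> entry c b (i \<^bold>+ \<^bold>1) v \<^bold>\<and> rel u R v)))"

definition Well_founded :: "sv \<Rightarrow> form" where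
  "Well_founded R =
    (\<^bold>\<not> (\<^bold>\<exists>\<^sub>S s. Fun s \<^bold>\<and> (\<^bold>\<forall>n. \<^bold>\<forall>x. \<^bold>\<forall>y. app s n x \<^bold>\<and> app s (n \<^bold>+ \<^bold>1) y \<^bold>\<longrightarrow> rel y R x)))"

definition TT :: "nat \<Rightarrow> nat \<Rightarrow> form" where
  "TT k h =
    (\<^bold>\<forall>\<^sub>S R. \<^bold>\<forall>\<^sub>S f. Rel R \<^bold>\<and> Deterministic R \<^bold>\<and> Transition_function f R \<^bold>\<and> F_controlled h f \<^bold>\<and>
        ex_sets k (\<lambda>Rs. ex_sets k (\<lambda>gs. Weighted h k Rs gs \<^bold>\<and>
          (\<^bold>\<forall>x. \<^bold>\<forall>y. trans_cl x R y \<^bold>\<longrightarrow> rel_Union k x Rs y))) \<^bold>\<longrightarrow>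
      Well_founded R)"

end

(* A sentence is derivable as soon as it holds in all models, by Henkin's completeness theorem, so one
   can argue inside a possibly nonstandard model of RCA*_0 + Tot(F_h).

   From HCT to WPH: if no weakly homogeneous set is 1-large, a pair of colour i is an R_i-transition,
   and the weight of x is the minimum of y - l over the chains y = y_0 < ... < y_(l-1) = x of colour i.
   From HCT to TT: a descending sequence is transitively decreasing.
   Back to HCT: for h = 0 a counterexample f satisfies f(n) + n <= f(0). For h > 0 replace it by
   n |-> F_h (max_(m<=n) f(m)) + n, which is increasing, still controlled by F_h, bounds the weights
   of f(n) and determines n. Its value set carries a deterministic relation for TT, and colouring pairs
   by the index of their relation yields for WPH a chain longer than its first weight permits. *)
theory Submission
  imports Defs "HOL-Library.Countable"
begin

section \<open>Substitution\<close>

text \<open>The obstacle is the weakness of the theory: induction is available for bounded formulas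
  only, and collection is not among the axioms. Each induction inside a model therefore carries
  explicit bounds on its quantifiers. Three devices supply them. A sequence of l numbers below b has
  a code below b^l, which exists by exponentiation. The graph of F_h is a bounded relation, since
  all iterates lie below the last one. By comprehension a Delta_1 relation becomes a set, which may
  then be a parameter of a bounded formula. A model is a type of class \<open>rca_model\<close>, so
  that it becomes an ordered semiring in the sense of HOL. Its bounded formulas are treated
  semantically, as predicates on environments (\<open>S0\<close>), so that definability is checked
  by introduction rules. The summand n of the padded sequence costs one unit at each step. For h > 0
  it is paid by F_h(x+1) >= F_h(x) + 2; for h = 0 the gap is only 1, which is why that case stands
  apart.\<close>

abbreviation up :: "(nat \<Rightarrow> tm) \<Rightarrow> nat \<Rightarrow> tm" where
  "up s \<equiv> case_nat (Var 0) (\<lambda>i. lift_tm (s i))"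

abbreviation upS :: "(nat \<Rightarrow> nat) \<Rightarrow> nat \<Rightarrow> nat" where
  "upS r \<equiv> case_nat 0 (\<lambda>i. Suc (r i))"

lemma subst_tm_subst_tm: "subst_tm s (subst_tm s' t) = subst_tm (\<lambda>i. subst_tm s (s' i)) t"
  by (induction t) auto

lemma subst_tm_Var [simp]: "subst_tm Var t = t"
  by (induction t) auto

lemma up_comp: "(\<lambda>i. subst_tm (up s) (up s' i)) = up (\<lambda>i. subst_tm s (s' i))"
  by (auto simp: subst_tm_subst_tm fun_eq_iff split: nat.split)

lemma upS_comp: "(\<lambda>i. upS r (upS r' i)) = upS (\<lambda>i. r (r' i))"
  by (auto simp: fun_eq_iff split: nat.split)

lemma subst_subst:
  "subst s r (subst s' r' p) = subst (\<lambda>i. subst_tm s (s' i)) (\<lambda>i. r (r' i)) p"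
  by (induction p arbitrary: s r s' r') (simp_all add: subst_tm_subst_tm up_comp upS_comp)

lemma case_nat_Suc: "case_nat (f 0) (\<lambda>i. f (Suc i)) = f"
  by (auto simp: fun_eq_iff split: nat.split)

lemma subst_Var_id [simp]: "subst Var id p = p"
  unfolding id_def
  by (induction p) (simp_all add: case_nat_Suc[of Var] case_nat_Suc[of "\<lambda>i. i"])

text \<open>This is the quantifier step of \<open>truth_lemma\<close>, where a term instantiated for
  the bound variable becomes an entry of the simultaneous substitution.\<close>

lemma inst_subst: "inst t (subst (up s) r p) = subst (case_nat t s) r p"
proof -
  have "(\<lambda>i. subst_tm (case_nat t Var) (up s i)) = case_nat t s"
    by (auto simp: fun_eq_iff subst_tm_subst_tm split: nat.split)
  then show ?thesis
    by (simp only: inst_def subst_subst id_apply)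
qed

lemma instS_subst: "instS X (subst s (upS r) p) = subst s (case_nat X r) p"
proof -
  have "(\<lambda>i. case_nat X id (upS r i)) = case_nat X r"
    by (auto simp: fun_eq_iff split: nat.split)
  then show ?thesis
    by (simp only: instS_def subst_subst subst_tm_Var)
qed

lemma subst_inst: "subst s r (inst t p) = inst (subst_tm s t) (subst (up s) r p)"
proof -
  have "(\<lambda>i. subst_tm s (case_nat t Var i)) = case_nat (subst_tm s t) s"
    by (auto simp: fun_eq_iff split: nat.split)
  then show ?thesis
    by (simp only: inst_subst) (simp only: inst_def subst_subst id_apply)
qed

lemma subst_instS: "subst s r (instS X p) = instS (r X) (subst s (upS r) p)"
proof -
  have "(\<lambda>i. r (case_nat X id i)) = case_nat (r X) r"
    by (auto simp: fun_eq_iff split: nat.split)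
  then show ?thesis
    by (simp only: instS_subst) (simp only: instS_def subst_subst subst_tm_Var subst_tm.simps)
qed

lemma subst_lift: "subst (up s) r (lift p) = lift (subst s r p)"
  by (simp add: lift_def subst_subst)

lemma subst_liftS: "subst s (upS r) (liftS p) = liftS (subst s r p)"
  by (simp add: liftS_def subst_subst)

lemma subst_tm_cong: "bounded_tm n t \<Longrightarrow> (\<And>i. i < n \<Longrightarrow> s i = s' i) \<Longrightarrow> subst_tm s t = subst_tm s' t"
  by (induction t) auto

text \<open>Serves to trade a substitution for \<open>lift\<close>, \<open>liftS\<close> or the
  identity when the two agree on the variables that can occur.\<close>

lemma subst_cong:
  "bounded_fm n m p \<Longrightarrow> (\<And>i. i < n \<Longrightarrow> s i = s' i) \<Longrightarrow> (\<And>i. i < m \<Longrightarrow> r i = r' i) \<Longrightarrow>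
    subst s r p = subst s' r' p"
proof (induction p arbitrary: n m s s' r r')
  case (Eq t u)
  then have "subst_tm s t = subst_tm s' t" "subst_tm s u = subst_tm s' u"
    by (auto intro!: subst_tm_cong)
  then show ?case by simp
next
  case (Lt t u)
  then have "subst_tm s t = subst_tm s' t" "subst_tm s u = subst_tm s' u"
    by (auto intro!: subst_tm_cong)
  then show ?case by simp
next
  case (Mem t X)
  then have "subst_tm s t = subst_tm s' t" "r X = r' X"
    by (auto intro!: subst_tm_cong)
  then show ?case by simp
next
  case (Imp p q)
  have "subst s r p = subst s' r' p" "subst s r q = subst s' r' q"
    using Imp.prems by (intro Imp.IH[of n m]; simp)+
  then show ?case by simp
next
  case (All p)
  have "up s i = up s' i" if "i < Suc n" for i
    using All.prems(2) that by (cases i) simp_all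
  then have "subst (up s) r p = subst (up s') r' p"
    using All.prems by (intro All.IH[of "Suc n" m]) simp_all
  then show ?case by simp
next
  case (AllS p)
  have "upS r i = upS r' i" if "i < Suc m" for i
    using AllS.prems(3) that by (cases i) simp_all
  then have "subst s (upS r) p = subst s' (upS r') p"
    using AllS.prems by (intro AllS.IH[of n "Suc m"]) simp_all
  then show ?case by simp
qed simp

lemma subst_closed: "bounded_fm 0 0 p \<Longrightarrow> subst s r p = p"
  using subst_cong[of 0 0 p s Var r id] by simp

lemma bounded_tm_mono: "bounded_tm n t \<Longrightarrow> n \<le> n' \<Longrightarrow> bounded_tm n' t"
  by (induction t) auto

lemma bounded_fm_mono: "bounded_fm n m p \<Longrightarrow> n \<le> n' \<Longrightarrow> m \<le> m' \<Longrightarrow> bounded_fm n' m' p"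
proof (induction p arbitrary: n m n' m')
  case (Imp p q)
  then show ?case using Imp.IH(1)[of n m n' m'] Imp.IH(2)[of n m n' m'] by simp
next
  case (All p)
  then show ?case using All.IH[of "Suc n" m "Suc n'" m'] by simp
next
  case (AllS p)
  then show ?case using AllS.IH[of n "Suc m" n' "Suc m'"] by simp
qed (auto dest: bounded_tm_mono)

lemma bounded_tm_common:
  assumes "\<exists>n. bounded_tm n t" and "\<exists>n. bounded_tm n u"
  shows "\<exists>n. bounded_tm n t \<and> bounded_tm n u"
proof -
  obtain n n' where "bounded_tm n t" "bounded_tm n' u" using assms by blast
  then have "bounded_tm (max n n') t" "bounded_tm (max n n') u"
    using bounded_tm_mono[of n t "max n n'"] bounded_tm_mono[of n' u "max n n'"] by simp_all
  then show ?thesis by blast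
qed

lemma bounded_tm_exists: "\<exists>n. bounded_tm n t"
  by (induction t) (auto intro: bounded_tm_common simp: lessI)

lemma bounded_fm_common:
  assumes "\<exists>n m. bounded_fm n m p" and "\<exists>n m. bounded_fm n m q"
  shows "\<exists>n m. bounded_fm n m p \<and> bounded_fm n m q"
proof -
  obtain n n' m m' where "bounded_fm n m p" "bounded_fm n' m' q" using assms by blast
  then have "bounded_fm (max n n') (max m m') p" "bounded_fm (max n n') (max m m') q"
    using bounded_fm_mono[of n m p "max n n'" "max m m'"] bounded_fm_mono[of n' m' q "max n n'" "max m m'"]
    by simp_all
  then show ?thesis by blast
qed

text \<open>Fresh variables for witnesses and universal closures of axioms both depend on
  this.\<close>

lemma bounded_fm_exists: "\<exists>n m. bounded_fm n m p"
proof (induction p)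
  case (Eq t u)
  then show ?case using bounded_tm_common[OF bounded_tm_exists bounded_tm_exists] by simp
next
  case (Lt t u)
  then show ?case using bounded_tm_common[OF bounded_tm_exists bounded_tm_exists] by simp
next
  case (Mem t X)
  then show ?case using bounded_tm_exists[of t] by auto
next
  case (Imp p q)
  then show ?case using bounded_fm_common by simp
next
  case (All p)
  then obtain n m where "bounded_fm n m p" by blast
  then have "bounded_fm (Suc n) m p" by (rule bounded_fm_mono) auto
  then show ?case by auto
next
  case (AllS p)
  then obtain n m where "bounded_fm n m p" by blast
  then have "bounded_fm n (Suc m) p" by (rule bounded_fm_mono) auto
  then show ?case by auto
qed auto


section \<open>Derivations\<close>

text \<open>Needed to rename a fresh variable into the bound one in \<open>generalize_fresh\<close>.
  The substitution varies in the induction because \<open>AllI\<close> lifts its hypotheses, which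
  replaces \<open>s\<close> by \<open>up s\<close>.\<close>

lemma proves_subst: "\<Gamma> \<turnstile> p \<Longrightarrow> subst s r ` \<Gamma> \<turnstile> subst s r p"
proof (induction arbitrary: s r rule: proves.induct)
  case (Assm p \<Gamma>)
  then show ?case by (auto intro: proves.Assm)
next
  case (ImpI p \<Gamma> q)
  then show ?case by (simp add: proves.ImpI)
next
  case (ImpE \<Gamma> p q)
  then show ?case by (metis proves.ImpE subst.simps(5))
next
  case (Class p \<Gamma>)
  then show ?case by (simp add: Neg_def proves.Class)
next
  case (AllI \<Gamma> p)
  have "lift ` subst s r ` \<Gamma> = subst (up s) r ` lift ` \<Gamma>"
    by (auto simp: image_image subst_lift)
  then show ?case
    using AllI.IH[of "up s" r] by (auto intro: proves.AllI)
next
  case (AllE \<Gamma> p t)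
  then show ?case by (metis proves.AllE subst_inst subst.simps(6))
next
  case (AllSI \<Gamma> p)
  have "liftS ` subst s r ` \<Gamma> = subst s (upS r) ` liftS ` \<Gamma>"
    by (auto simp: image_image subst_liftS)
  then show ?case
    using AllSI.IH[of s "upS r"] by (auto intro: proves.AllSI)
next
  case (AllSE \<Gamma> p X)
  then show ?case by (metis proves.AllSE subst_instS subst.simps(7))
next
  case (EqI \<Gamma> t)
  then show ?case by (auto intro: proves.EqI)
next
  case (EqE \<Gamma> t u p)
  then show ?case
    using proves.EqE[of "subst s r ` \<Gamma>" "subst_tm s t" "subst_tm s u" "subst (up s) r p"]
    by (simp add: subst_inst)
qed

lemma proves_mono: "\<Gamma> \<turnstile> p \<Longrightarrow> \<Gamma> \<subseteq> \<Delta> \<Longrightarrow> \<Delta> \<turnstile> p"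
proof (induction arbitrary: \<Delta> rule: proves.induct)
  case (ImpI p \<Gamma> q)
  then show ?case by (metis insert_mono proves.ImpI)
next
  case (Class p \<Gamma>)
  then show ?case by (metis insert_mono proves.Class)
next
  case (AllI \<Gamma> p)
  then show ?case by (metis image_mono proves.AllI)
next
  case (AllSI \<Gamma> p)
  then show ?case by (metis image_mono proves.AllSI)
qed (blast intro: proves.intros)+

text \<open>With this, an inconsistency of the union of a chain of theories already occurs at some
  stage.\<close>

lemma proves_compact: "\<Gamma> \<turnstile> p \<Longrightarrow> \<exists>\<Delta>. finite \<Delta> \<and> \<Delta> \<subseteq> \<Gamma> \<and> \<Delta> \<turnstile> p"
proof (induction rule: proves.induct)
  case (Assm p \<Gamma>)
  then have "finite {p}" "{p} \<subseteq> \<Gamma>" "{p} \<turnstile> p" by (simp_all add: proves.Assm)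
  then show ?case by blast
next
  case (ImpI p \<Gamma> q)
  then obtain \<Delta> where \<Delta>: "finite \<Delta>" "\<Delta> \<subseteq> insert p \<Gamma>" "\<Delta> \<turnstile> q" by blast
  have "insert p (\<Delta> - {p}) \<turnstile> q" by (rule proves_mono[OF \<Delta>(3)]) blast
  then have "\<Delta> - {p} \<turnstile> Imp p q" by (rule proves.ImpI)
  moreover have "finite (\<Delta> - {p})" "\<Delta> - {p} \<subseteq> \<Gamma>" using \<Delta> by auto
  ultimately show ?case by blast
next
  case (ImpE \<Gamma> p q)
  then obtain \<Delta> \<Delta>' where \<Delta>: "finite \<Delta>" "\<Delta> \<subseteq> \<Gamma>" "\<Delta> \<turnstile> Imp p q" "finite \<Delta>'" "\<Delta>' \<subseteq> \<Gamma>" "\<Delta>' \<turnstile> p"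
    by blast
  have "\<Delta> \<union> \<Delta>' \<turnstile> q"
    using proves_mono[OF \<Delta>(3), of "\<Delta> \<union> \<Delta>'"] proves_mono[OF \<Delta>(6), of "\<Delta> \<union> \<Delta>'"]
    by (auto intro: proves.ImpE[of _ p q])
  moreover have "finite (\<Delta> \<union> \<Delta>')" "\<Delta> \<union> \<Delta>' \<subseteq> \<Gamma>" using \<Delta> by auto
  ultimately show ?case by blast
next
  case (Class p \<Gamma>)
  then obtain \<Delta> where \<Delta>: "finite \<Delta>" "\<Delta> \<subseteq> insert (Neg p) \<Gamma>" "\<Delta> \<turnstile> Fls" by blast
  have "insert (Neg p) (\<Delta> - {Neg p}) \<turnstile> Fls" by (rule proves_mono[OF \<Delta>(3)]) blast
  then have "\<Delta> - {Neg p} \<turnstile> p" by (rule proves.Class)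
  moreover have "finite (\<Delta> - {Neg p})" "\<Delta> - {Neg p} \<subseteq> \<Gamma>" using \<Delta> by auto
  ultimately show ?case by blast
next
  case (AllI \<Gamma> p)
  then obtain \<Delta> where \<Delta>: "finite \<Delta>" "\<Delta> \<subseteq> lift ` \<Gamma>" "\<Delta> \<turnstile> p" by blast
  then obtain \<Delta>' where "finite \<Delta>'" "\<Delta>' \<subseteq> \<Gamma>" "\<Delta> = lift ` \<Delta>'"
    using finite_subset_image by metis
  then show ?case using \<Delta>(3) proves.AllI by blast
next
  case (AllE \<Gamma> p t)
  then show ?case using proves.AllE by blast
next
  case (AllSI \<Gamma> p)
  then obtain \<Delta> where \<Delta>: "finite \<Delta>" "\<Delta> \<subseteq> liftS ` \<Gamma>" "\<Delta> \<turnstile> p" by blast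
  then obtain \<Delta>' where "finite \<Delta>'" "\<Delta>' \<subseteq> \<Gamma>" "\<Delta> = liftS ` \<Delta>'"
    using finite_subset_image by metis
  then show ?case using \<Delta>(3) proves.AllSI by blast
next
  case (AllSE \<Gamma> p X)
  then show ?case using proves.AllSE by blast
next
  case (EqI \<Gamma> t)
  have "finite {}" "{} \<subseteq> \<Gamma>" "{} \<turnstile> Eq t t" by (simp_all add: proves.EqI)
  then show ?case by blast
next
  case (EqE \<Gamma> t u p)
  then obtain \<Delta> \<Delta>' where \<Delta>: "finite \<Delta>" "\<Delta> \<subseteq> \<Gamma>" "\<Delta> \<turnstile> Eq t u" "finite \<Delta>'" "\<Delta>' \<subseteq> \<Gamma>" "\<Delta>' \<turnstile> inst t p"
    by blast
  have "\<Delta> \<union> \<Delta>' \<turnstile> Eq t u" by (rule proves_mono[OF \<Delta>(3)]) simp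
  moreover have "\<Delta> \<union> \<Delta>' \<turnstile> inst t p" by (rule proves_mono[OF \<Delta>(6)]) simp
  ultimately have "\<Delta> \<union> \<Delta>' \<turnstile> inst u p" by (rule proves.EqE)
  moreover have "finite (\<Delta> \<union> \<Delta>')" "\<Delta> \<union> \<Delta>' \<subseteq> \<Gamma>" using \<Delta> by auto
  ultimately show ?case by blast
qed

definition consistent :: "fm set \<Rightarrow> bool" where
  "consistent \<Gamma> \<longleftrightarrow> \<not> \<Gamma> \<turnstile> Fls"

lemma proves_iff_inconsistent: "\<Gamma> \<turnstile> p \<longleftrightarrow> \<not> consistent (insert (Neg p) \<Gamma>)"
proof
  assume "\<Gamma> \<turnstile> p"
  then have "insert (Neg p) \<Gamma> \<turnstile> p" by (rule proves_mono) auto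
  moreover have "insert (Neg p) \<Gamma> \<turnstile> Imp p Fls" by (rule proves.Assm) (simp add: Neg_def)
  ultimately show "\<not> consistent (insert (Neg p) \<Gamma>)"
    by (auto simp: consistent_def intro: proves.ImpE)
qed (auto simp: consistent_def intro: proves.Class)

lemma proves_cut: "insert p \<Gamma> \<turnstile> q \<Longrightarrow> \<Gamma> \<turnstile> p \<Longrightarrow> \<Gamma> \<turnstile> q"
  by (meson proves.ImpI proves.ImpE)

lemma inconsistent_insert: "\<not> consistent (insert p \<Gamma>) \<longleftrightarrow> \<Gamma> \<turnstile> Neg p"
proof
  assume "\<not> consistent (insert p \<Gamma>)"
  then show "\<Gamma> \<turnstile> Neg p" by (auto simp: consistent_def Neg_def intro: proves.ImpI)
next
  assume "\<Gamma> \<turnstile> Neg p"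
  then have "insert p \<Gamma> \<turnstile> Imp p Fls" unfolding Neg_def by (rule proves_mono) auto
  then show "\<not> consistent (insert p \<Gamma>)"
    by (auto simp: consistent_def intro: proves.ImpE proves.Assm)
qed

text \<open>\<open>AllI\<close> knows no named eigenvariable. The substitution that sends
  \<open>c\<close> to 0 and shifts all other variables turns the instance into \<open>p\<close>, and
  it acts as \<open>lift\<close> on the hypotheses because \<open>c\<close> does not occur
  there.\<close>

lemma generalize_fresh:
  assumes "\<Gamma> \<turnstile> inst (Var c) p" and "\<forall>q \<in> \<Gamma>. bounded_fm c m q" and "bounded_fm c m p"
  shows "\<Gamma> \<turnstile> All p"
proof (rule proves.AllI)
  let ?s = "\<lambda>i. if i = c then Var 0 else Var (Suc i)"
  have "subst ?s id q = lift q" if "q \<in> \<Gamma>" for q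
    unfolding lift_def using assms(2) that by (intro subst_cong[of c m]) auto
  then have "subst ?s id ` \<Gamma> = lift ` \<Gamma>" by auto
  moreover have "subst ?s id (inst (Var c) p) = p"
  proof -
    have "subst ?s id (inst (Var c) p) = subst (\<lambda>i. subst_tm ?s (case_nat (Var c) Var i)) id p"
      by (simp add: inst_def subst_subst id_def)
    also have "\<dots> = subst Var id p"
      using assms(3) by (intro subst_cong[of c m]) (auto split: nat.split)
    finally show ?thesis by simp
  qed
  ultimately show "lift ` \<Gamma> \<turnstile> p"
    using proves_subst[OF assms(1), of ?s id] by simp
qed

lemma generalize_freshS:
  assumes "\<Gamma> \<turnstile> instS c p" and "\<forall>q \<in> \<Gamma>. bounded_fm n c q" and "bounded_fm n c p"
  shows "\<Gamma> \<turnstile> AllS p"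
proof (rule proves.AllSI)
  let ?r = "\<lambda>i. if i = c then 0 else Suc i"
  have "subst Var ?r q = liftS q" if "q \<in> \<Gamma>" for q
    unfolding liftS_def using assms(2) that by (intro subst_cong[of n c]) auto
  then have "subst Var ?r ` \<Gamma> = liftS ` \<Gamma>" by auto
  moreover have "subst Var ?r (instS c p) = p"
  proof -
    have "subst Var ?r (instS c p) = subst Var (\<lambda>i. ?r (case_nat c id i)) p"
      by (simp add: instS_def subst_subst)
    also have "\<dots> = subst Var id p"
      using assms(3) by (intro subst_cong[of n c]) (auto split: nat.split)
    finally show ?thesis by simp
  qed
  ultimately show "liftS ` \<Gamma> \<turnstile> p"
    using proves_subst[OF assms(1), of Var ?r] by simp
qed


section \<open>Henkin theories\<close>

instance tm :: countable by countable_datatype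
instance fm :: countable by countable_datatype

text \<open>The clauses of a truth definition in which terms and set variables name all
  objects.\<close>

definition Henkin :: "fm set \<Rightarrow> bool" where
  "Henkin G \<longleftrightarrow> (\<forall>p. G \<turnstile> p \<longleftrightarrow> p \<in> G) \<and> Fls \<notin> G \<and>
    (\<forall>p q. Imp p q \<in> G \<longleftrightarrow> (p \<in> G \<longrightarrow> q \<in> G)) \<and>
    (\<forall>p. All p \<in> G \<longleftrightarrow> (\<forall>t. inst t p \<in> G)) \<and>
    (\<forall>p. AllS p \<in> G \<longleftrightarrow> (\<forall>X. instS X p \<in> G))"

text \<open>The variables beyond a common bound serve as Henkin constants, so the language is not
  expanded.\<close>

definition extendable :: "fm set \<Rightarrow> bool" where
  "extendable \<Gamma> \<longleftrightarrow> consistent \<Gamma> \<and> (\<exists>n m. \<forall>p \<in> \<Gamma>. bounded_fm n m p)"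

text \<open>A rejected universal formula comes with a counterexample named by a variable, which
  yields the quantifier clauses of \<open>Henkin\<close>.\<close>

definition decides :: "fm set \<Rightarrow> fm \<Rightarrow> bool" where
  "decides \<Gamma> p \<longleftrightarrow> p \<in> \<Gamma> \<or> (Neg p \<in> \<Gamma> \<and>
    (\<forall>q. p = All q \<longrightarrow> (\<exists>c. Neg (inst (Var c) q) \<in> \<Gamma>)) \<and>
    (\<forall>q. p = AllS q \<longrightarrow> (\<exists>c. Neg (instS c q) \<in> \<Gamma>)))"

lemma extendable_insert:
  assumes "extendable \<Gamma>" and "consistent (insert p \<Gamma>)"
  shows "extendable (insert p \<Gamma>)"
proof -
  obtain n m n' m' where "\<forall>q \<in> \<Gamma>. bounded_fm n m q" "bounded_fm n' m' p"
    using assms(1) bounded_fm_exists unfolding extendable_def by blast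
  then have "\<forall>q \<in> insert p \<Gamma>. bounded_fm (max n n') (max m m') q"
    by (metis bounded_fm_mono insert_iff max.cobounded1 max.cobounded2)
  then show ?thesis using assms(2) unfolding extendable_def by blast
qed

lemma extendable_bound:
  assumes "extendable \<Gamma>"
  obtains n m where "\<forall>q \<in> \<Gamma>. bounded_fm n m q" "bounded_fm n m p"
proof -
  obtain n m n' m' where "\<forall>q \<in> \<Gamma>. bounded_fm n m q" "bounded_fm n' m' p"
    using assms(1) bounded_fm_exists unfolding extendable_def by blast
  then have "\<forall>q \<in> \<Gamma>. bounded_fm (max n n') (max m m') q" "bounded_fm (max n n') (max m m') p"
    by (metis bounded_fm_mono max.cobounded1 max.cobounded2)+
  then show thesis by (rule that)
qed

lemma extend_decides:
  assumes "extendable \<Gamma>"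
  shows "\<exists>\<Delta>. extendable \<Delta> \<and> \<Gamma> \<subseteq> \<Delta> \<and> decides \<Delta> p"
proof (cases "consistent (insert p \<Gamma>)")
  case True
  then show ?thesis using assms extendable_insert by (intro exI[of _ "insert p \<Gamma>"]) (auto simp: decides_def)
next
  case False
  then have neg: "\<Gamma> \<turnstile> Neg p" by (simp add: inconsistent_insert)
  let ?\<Gamma> = "insert (Neg p) \<Gamma>"
  have con: "consistent ?\<Gamma>"
    using neg assms by (auto simp: consistent_def extendable_def dest: proves_cut)
  then have ext: "extendable ?\<Gamma>" by (rule extendable_insert[OF assms])
  have notp: "\<not> ?\<Gamma> \<turnstile> p"
  proof
    assume "?\<Gamma> \<turnstile> p"
    then show False
      using con by (metis consistent_def insertI1 proves.Assm proves.ImpE Neg_def)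
  qed
  show ?thesis
  proof (cases "(\<exists>q. p = All q) \<or> (\<exists>q. p = AllS q)")
    case False
    then show ?thesis using ext by (intro exI[of _ ?\<Gamma>]) (auto simp: decides_def)
  next
    case True
    then consider q where "p = All q" | q where "p = AllS q" by blast
    then show ?thesis
    proof cases
      case 1
      obtain n m where nm: "\<forall>q \<in> ?\<Gamma>. bounded_fm n m q" "bounded_fm n m q"
        using extendable_bound[OF ext] by blast
      \<comment> \<open>\<open>n\<close> is not free in any formula so far, so a proof of this
        instance would generalize to a proof of \<open>p\<close>.\<close>
      then have "\<not> ?\<Gamma> \<turnstile> inst (Var n) q"
        using generalize_fresh notp 1 by blast
      then have "extendable (insert (Neg (inst (Var n) q)) ?\<Gamma>)"
        using ext extendable_insert proves_iff_inconsistent by blast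
      then show ?thesis using 1 by (intro exI[of _ "insert (Neg (inst (Var n) q)) ?\<Gamma>"]) (auto simp: decides_def)
    next
      case 2
      obtain n m where nm: "\<forall>q \<in> ?\<Gamma>. bounded_fm n m q" "bounded_fm n m q"
        using extendable_bound[OF ext] by blast
      then have "\<not> ?\<Gamma> \<turnstile> instS m q"
        using generalize_freshS notp 2 by blast
      then have "extendable (insert (Neg (instS m q)) ?\<Gamma>)"
        using ext extendable_insert proves_iff_inconsistent by blast
      then show ?thesis using 2 by (intro exI[of _ "insert (Neg (instS m q)) ?\<Gamma>"]) (auto simp: decides_def)
    qed
  qed
qed

text \<open>Stage n + 1 settles formula number n of an enumeration. Every stage is
  \<open>extendable\<close>, although the limit has no bound on its free variables.\<close>

lemma Henkin_extension:
  assumes "extendable \<Gamma>"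
  shows "\<exists>G. Henkin G \<and> \<Gamma> \<subseteq> G"
proof -
  have "\<exists>T. \<forall>n. (extendable (T n) \<and> (n = 0 \<longrightarrow> T n = \<Gamma>)) \<and>
      (T n \<subseteq> T (Suc n) \<and> decides (T (Suc n)) (from_nat n))"
  proof (rule dependent_nat_choice)
    show "\<exists>\<Delta>. extendable \<Delta> \<and> ((0::nat) = 0 \<longrightarrow> \<Delta> = \<Gamma>)" using assms by blast
    show "\<exists>\<Delta>'. (extendable \<Delta>' \<and> (Suc n = 0 \<longrightarrow> \<Delta>' = \<Gamma>)) \<and> \<Delta> \<subseteq> \<Delta>' \<and> decides \<Delta>' (from_nat n)"
      if "extendable \<Delta> \<and> (n = 0 \<longrightarrow> \<Delta> = \<Gamma>)" for \<Delta> n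
      using that extend_decides[of \<Delta> "from_nat n"] by auto
  qed
  then obtain T where T: "\<And>n. extendable (T n)" "T 0 = \<Gamma>" "\<And>n. T n \<subseteq> T (Suc n)"
      "\<And>n. decides (T (Suc n)) (from_nat n)"
    by metis
  define G where "G = (\<Union>n. T n)"
  have mono: "T n \<subseteq> T m" if "n \<le> m" for n m
    using T(3) that by (rule lift_Suc_mono_le)
  have "consistent G"
  proof (unfold consistent_def, rule notI)
    assume "G \<turnstile> Fls"
    then obtain \<Delta> where \<Delta>: "finite \<Delta>" "\<Delta> \<subseteq> G" "\<Delta> \<turnstile> Fls" using proves_compact by blast
    have "\<exists>n. \<Delta> \<subseteq> T n"
      using \<Delta>(1,2)
    proof (induction rule: finite_induct)
      case (insert x F)
      then obtain n m where "F \<subseteq> T n" "x \<in> T m" by (auto simp: G_def)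
      then have "insert x F \<subseteq> T (max n m)"
        using mono[of n "max n m"] mono[of m "max n m"] by auto
      then show ?case by blast
    qed simp
    then show False using \<Delta>(3) T(1) proves_mono unfolding extendable_def consistent_def by blast
  qed
  have dec: "decides G p" for p
  proof -
    have "decides (T (Suc (to_nat p))) p" using T(4)[of "to_nat p"] by simp
    moreover have "T (Suc (to_nat p)) \<subseteq> G" by (auto simp: G_def)
    ultimately show ?thesis unfolding decides_def by blast
  qed
  have clash: "False" if "p \<in> G" "Neg p \<in> G" for p
    using that \<open>consistent G\<close> by (metis Neg_def consistent_def proves.Assm proves.ImpE)
  have closed: "G \<turnstile> p \<longleftrightarrow> p \<in> G" for p
  proof
    assume p: "G \<turnstile> p"
    show "p \<in> G"
    proof (rule ccontr)
      assume "p \<notin> G"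
      then have "G \<turnstile> Imp p Fls" using dec[of p] by (auto simp: decides_def Neg_def intro: proves.Assm)
      then show False using p \<open>consistent G\<close> by (auto simp: consistent_def intro: proves.ImpE)
    qed
  qed (rule proves.Assm)
  have "Imp p q \<in> G \<longleftrightarrow> (p \<in> G \<longrightarrow> q \<in> G)" for p q
  proof (intro iffI impI)
    assume "Imp p q \<in> G" "p \<in> G"
    then show "q \<in> G" using closed by (metis proves.ImpE)
  next
    assume pq: "p \<in> G \<longrightarrow> q \<in> G"
    show "Imp p q \<in> G"
    proof (cases "q \<in> G")
      case True
      then show ?thesis using closed by (metis proves.Assm proves.ImpI insertI2)
    next
      case False
      then have "insert p G \<turnstile> Imp p Fls" "insert p G \<turnstile> p"
        using dec[of p] pq by (auto simp: decides_def Neg_def intro: proves.Assm)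
      then have "insert p G \<turnstile> Fls" by (rule proves.ImpE)
      then have "insert (Neg q) (insert p G) \<turnstile> Fls" by (rule proves_mono) auto
      then show ?thesis using closed by (metis proves.Class proves.ImpI)
    qed
  qed
  moreover have "All p \<in> G \<longleftrightarrow> (\<forall>t. inst t p \<in> G)" for p
  proof
    show "All p \<in> G \<Longrightarrow> \<forall>t. inst t p \<in> G" using closed proves.AllE by blast
    \<comment> \<open>If \<open>All p\<close> were rejected, a refuted instance would have been put
      into \<open>G\<close> with it.\<close>
    show "\<forall>t. inst t p \<in> G \<Longrightarrow> All p \<in> G"
      using dec[of "All p"] clash unfolding decides_def by blast
  qed
  moreover have "AllS p \<in> G \<longleftrightarrow> (\<forall>X. instS X p \<in> G)" for p
  proof
    show "AllS p \<in> G \<Longrightarrow> \<forall>X. instS X p \<in> G" using closed proves.AllSE by blast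
    show "\<forall>X. instS X p \<in> G \<Longrightarrow> AllS p \<in> G"
      using dec[of "AllS p"] clash unfolding decides_def by blast
  qed
  moreover have "Fls \<notin> G" using closed \<open>consistent G\<close> by (auto simp: consistent_def)
  moreover have "\<Gamma> \<subseteq> G" using T(2) by (auto simp: G_def)
  ultimately show ?thesis unfolding Henkin_def using closed by blast
qed


section \<open>Semantics\<close>

text \<open>Structures are types, not records, so that the algebraic classes of HOL apply to models;
  \<open>minus\<close> and \<open>ord\<close> are present for that purpose. Set variables must have
  a value, hence \<open>sets\<close> is nonempty.\<close>

class so_structure = zero + one + plus + times + minus + ord +
  fixes expo :: "'a \<Rightarrow> 'a \<Rightarrow> 'a" and sets :: "'a set set"
  assumes sets_nonempty: "sets \<noteq> {}"

primrec eval :: "(nat \<Rightarrow> 'a::so_structure) \<Rightarrow> tm \<Rightarrow> 'a" where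
  "eval e (Var i) = e i"
| "eval e Zero = 0"
| "eval e One = 1"
| "eval e (Add t u) = eval e t + eval e u"
| "eval e (Mul t u) = eval e t * eval e u"
| "eval e (Pow t u) = expo (eval e t) (eval e u)"

primrec sat :: "(nat \<Rightarrow> 'a::so_structure) \<Rightarrow> (nat \<Rightarrow> 'a set) \<Rightarrow> fm \<Rightarrow> bool" where
  "sat e S Fls \<longleftrightarrow> False"
| "sat e S (Eq t u) \<longleftrightarrow> eval e t = eval e u"
| "sat e S (Lt t u) \<longleftrightarrow> eval e t < eval e u"
| "sat e S (Mem t X) \<longleftrightarrow> eval e t \<in> S X"
| "sat e S (Imp p q) \<longleftrightarrow> (sat e S p \<longrightarrow> sat e S q)"
| "sat e S (All p) \<longleftrightarrow> (\<forall>x. sat (case_nat x e) S p)"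
| "sat e S (AllS p) \<longleftrightarrow> (\<forall>X \<in> sets. sat e (case_nat X S) p)"

lemma sat_connectives [simp]:
  "sat e S (Neg p) \<longleftrightarrow> \<not> sat e S p"
  "sat e S (Con p q) \<longleftrightarrow> sat e S p \<and> sat e S q"
  "sat e S (Dis p q) \<longleftrightarrow> sat e S p \<or> sat e S q"
  "sat e S (Iff p q) \<longleftrightarrow> (sat e S p \<longleftrightarrow> sat e S q)"
  "sat e S (Ex p) \<longleftrightarrow> (\<exists>x. sat (case_nat x e) S p)"
  "sat e S (ExS p) \<longleftrightarrow> (\<exists>X \<in> sets. sat e (case_nat X S) p)"
  by (auto simp: Neg_def Con_def Dis_def Iff_def Ex_def ExS_def)

lemma eval_subst_tm: "eval e (subst_tm s t) = eval (\<lambda>i. eval e (s i)) t"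
  by (induction t) auto

lemma eval_up: "(\<lambda>i. eval (case_nat x e) (up s i)) = case_nat x (\<lambda>i. eval e (s i))"
  by (auto simp: eval_subst_tm fun_eq_iff split: nat.split)

lemma upS_env: "(\<lambda>i. case_nat X S (upS r i)) = case_nat X (\<lambda>i. S (r i))"
  by (auto simp: fun_eq_iff split: nat.split)

lemma sat_subst: "sat e S (subst s r p) \<longleftrightarrow> sat (\<lambda>i. eval e (s i)) (\<lambda>X. S (r X)) p"
  by (induction p arbitrary: e S s r) (simp_all only: sat.simps subst.simps eval_subst_tm eval_up upS_env)

lemma sat_inst: "sat e S (inst t p) \<longleftrightarrow> sat (case_nat (eval e t) e) S p"
proof -
  have "(\<lambda>i. eval e (case_nat t Var i)) = case_nat (eval e t) e"
    by (auto simp: fun_eq_iff split: nat.split)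
  then show ?thesis by (simp add: inst_def sat_subst)
qed

lemma sat_instS: "sat e S (instS X p) \<longleftrightarrow> sat e (case_nat (S X) S) p"
proof -
  have "(\<lambda>i. S (case_nat X id i)) = case_nat (S X) S"
    by (auto simp: fun_eq_iff split: nat.split)
  then show ?thesis unfolding instS_def sat_subst by simp
qed

lemma sat_lift: "sat (case_nat x e) S (lift p) \<longleftrightarrow> sat e S p"
  by (simp add: lift_def sat_subst)

lemma sat_liftS: "sat e (case_nat X S) (liftS p) \<longleftrightarrow> sat e S p"
  by (simp add: liftS_def sat_subst)

text \<open>Applied to the standard model, this gives the consistency of \<open>RCA0_star\<close>,
  which guarantees that \<open>generic_theory\<close> can be chosen. Set variables take values in
  \<open>sets\<close>, the range of the set quantifiers.\<close>

lemma soundness: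
  fixes e :: "nat \<Rightarrow> 'a::so_structure"
  shows "\<Gamma> \<turnstile> p \<Longrightarrow> range S \<subseteq> sets \<Longrightarrow> (\<And>q. q \<in> \<Gamma> \<Longrightarrow> sat e S q) \<Longrightarrow> sat e S p"
proof (induction arbitrary: e S rule: proves.induct)
  case (ImpI p \<Gamma> q)
  have "sat e S q" if "sat e S p"
    using ImpI.prems that by (intro ImpI.IH) auto
  then show ?case by simp
next
  case (ImpE \<Gamma> p q)
  then show ?case using ImpE.IH[of S e] by simp
next
  case (Class p \<Gamma>)
  have "sat e S Fls" if "\<not> sat e S p"
    using Class.prems that by (intro Class.IH) auto
  then show ?case by auto
next
  case (AllI \<Gamma> p)
  then show ?case by (auto intro!: AllI.IH simp: sat_lift)
next
  case (AllE \<Gamma> p t)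
  then show ?case using AllE.IH[of S e] by (simp add: sat_inst)
next
  case (AllSI \<Gamma> p)
  have "sat e (case_nat X S) p" if "X \<in> sets" for X
    using AllSI.prems that by (intro AllSI.IH) (auto simp: sat_liftS image_subset_iff split: nat.splits)
  then show ?case by simp
next
  case (AllSE \<Gamma> p X)
  have "\<forall>X \<in> sets. sat e (case_nat X S) p"
    using AllSE.IH[of S e] AllSE.prems by simp
  then show ?case using AllSE.prems(1) by (auto simp: sat_instS)
next
  case (EqE \<Gamma> t u p)
  then show ?case using EqE.IH[of S e] by (simp add: sat_inst)
qed auto

section \<open>The standard model and the consistency of the axioms\<close>

instantiation nat :: so_structure
begin

definition expo_nat :: "nat \<Rightarrow> nat \<Rightarrow> nat" where "expo_nat = (^)"
definition sets_nat :: "nat set set" where "sets_nat = UNIV"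

instance by standard (simp add: sets_nat_def)

end

lemma sat_ind_inst_iff:
  "sat e S (ind_inst p) \<longleftrightarrow> (sat (case_nat 0 e) S p \<and>
    (\<forall>x. sat (case_nat x e) S p \<longrightarrow> sat (case_nat (x + 1) e) S p) \<longrightarrow> (\<forall>x. sat (case_nat x e) S p))"
proof -
  have "(\<lambda>i. eval (case_nat x e) (case_nat (Add (Var 0) One) (\<lambda>i. Var (Suc i)) i)) = case_nat (x + 1) e" for x
    by (auto simp: fun_eq_iff split: nat.split)
  then show ?thesis by (simp add: ind_inst_def sat_inst sat_subst)
qed

lemma sat_comp_inst_iff:
  "sat e S (comp_inst p q) \<longleftrightarrow> ((\<forall>x. sat (case_nat x e) S p \<longleftrightarrow> sat (case_nat x e) S q) \<longrightarrow>
    (\<exists>X \<in> sets. \<forall>x. x \<in> X \<longleftrightarrow> sat (case_nat x e) S p))"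
  by (simp add: comp_inst_def sat_liftS)

lemmas form_defs = zero_def one_def add_def mul_def pow_def fls_def eq_def lt_def mem_def neg_def
  con_def dis_def imp_def iff_def all_def ex_def allS_def exS_def

lemma sat_AllsI: "(\<And>e. sat e S p) \<Longrightarrow> sat e S ((All ^^ n) p)"
  by (induction n arbitrary: e) auto

lemma sat_AllSsI:
  "(\<And>S. range S \<subseteq> sets \<Longrightarrow> sat e S p) \<Longrightarrow> range S \<subseteq> sets \<Longrightarrow> sat e S ((AllS ^^ m) p)"
proof (induction m arbitrary: S)
  case (Suc m)
  have "range (case_nat X S) \<subseteq> sets" if "X \<in> sets" for X
    using Suc.prems(2) that by (auto simp: image_subset_iff split: nat.splits)
  then show ?case using Suc by auto
qed simp

lemma nat_model_closures:
  assumes "\<And>e S. sat (e :: nat \<Rightarrow> nat) S p" and "q \<in> closures p"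
  shows "sat (e :: nat \<Rightarrow> nat) S q"
proof -
  obtain n m where q: "q = (All ^^ n) ((AllS ^^ m) p)" using assms(2) by (auto simp: closures_def)
  show ?thesis unfolding q by (intro sat_AllsI sat_AllSsI assms(1)) (simp add: sets_nat_def)
qed

lemma nat_model: "p \<in> RCA0_star \<Longrightarrow> sat (e :: nat \<Rightarrow> nat) S p"
proof -
  assume "p \<in> RCA0_star"
  then consider "p \<in> basic_axioms" | q where "p \<in> closures (ind_inst q)"
    | q r where "p \<in> closures (comp_inst q r)"
    by (auto simp: RCA0_star_def)
  then show ?thesis
  proof cases
    case 1
    then show ?thesis
      by (auto simp: basic_axioms_def sentence_def form_defs expo_nat_def)
  next
    case 2
    have ind: "sat e S (ind_inst q)" for e :: "nat \<Rightarrow> nat" and S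
    proof (unfold sat_ind_inst_iff, intro impI allI)
      fix x
      assume *: "sat (case_nat 0 e) S q \<and>
        (\<forall>x. sat (case_nat x e) S q \<longrightarrow> sat (case_nat (x + 1) e) S q)"
      show "sat (case_nat x e) S q" using * by (induction x) simp_all
    qed
    show ?thesis using nat_model_closures[OF ind 2] .
  next
    case 3
    have comp: "sat e S (comp_inst q r)" for e :: "nat \<Rightarrow> nat" and S
      unfolding sat_comp_inst_iff sets_nat_def
      by (auto intro!: exI[of _ "{x. sat (case_nat x e) S q}"])
    show ?thesis using nat_model_closures[OF comp 3] .
  qed
qed

lemma consistent_RCA0_star: "consistent RCA0_star"
proof (unfold consistent_def, rule notI)
  assume "RCA0_star \<turnstile> Fls"
  then have "sat (\<lambda>_. 0 :: nat) (\<lambda>_. {}) Fls"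
    by (rule soundness) (auto simp: sets_nat_def nat_model)
  then show False by simp
qed

lemma bounded_Alls: "bounded_fm n m p \<Longrightarrow> bounded_fm 0 m ((All ^^ n) p)"
proof -
  assume "bounded_fm n m p"
  then have "bounded_fm (n - j) m ((All ^^ j) p)" if "j \<le> n" for j
    using that by (induction j) (auto simp: Suc_diff_Suc)
  from this[of n] show ?thesis by simp
qed

lemma bounded_AllSs: "bounded_fm n m p \<Longrightarrow> bounded_fm n 0 ((AllS ^^ m) p)"
proof -
  assume "bounded_fm n m p"
  then have "bounded_fm n (m - j) ((AllS ^^ j) p)" if "j \<le> m" for j
    using that by (induction j) (auto simp: Suc_diff_Suc)
  from this[of m] show ?thesis by simp
qed

lemma bounded_RCA0_star: "p \<in> RCA0_star \<Longrightarrow> bounded_fm 0 0 p"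
  by (auto simp: RCA0_star_def basic_axioms_def sentence_def form_defs closures_def
      Neg_def Con_def Dis_def Iff_def intro!: bounded_Alls bounded_AllSs)


section \<open>Models of \<open>RCA\<^sup>*\<^sub>0\<close>\<close>

text \<open>The axioms constrain only what formulas can mention. The two equations tie the order and
  truncated subtraction to this part, as \<open>linordered_semidom\<close> demands.\<close>

class rca_model = so_structure +
  assumes model: "p \<in> RCA0_star \<Longrightarrow> (\<And>X. S X \<in> sets) \<Longrightarrow> sat e S p"
    and less_eq_model: "x \<le> y \<longleftrightarrow> x < y \<or> x = y"
    and minus_model: "x - y = (if x < y then 0 else THE z. x = y + z)"

lemma Sigma00_subst: "Sigma00 p \<Longrightarrow> Sigma00 (subst s r p)"
proof (induction arbitrary: s r rule: Sigma00.induct)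
  case (6 p t)
  have "subst_tm (up s) (lift_tm t) = lift_tm (subst_tm s t)" by (simp add: subst_tm_subst_tm)
  then show ?case using "6.IH" Sigma00.intros(6) by simp
next
  case (7 p t)
  have "subst_tm (up s) (lift_tm t) = lift_tm (subst_tm s t)" by (simp add: subst_tm_subst_tm)
  then show ?case using "7.IH" Sigma00.intros(7)[unfolded Ex_def Con_def Neg_def]
    by (simp add: Ex_def Con_def Neg_def)
qed (auto intro: Sigma00.intros)

section \<open>Bounded definability with parameters\<close>

inductive T0 :: "((nat \<Rightarrow> 'a::so_structure) \<Rightarrow> 'a) \<Rightarrow> bool" where
  T0_var: "T0 (\<lambda>e. e i)"
| T0_const: "T0 (\<lambda>e. c)"
| T0_add: "T0 t \<Longrightarrow> T0 u \<Longrightarrow> T0 (\<lambda>e. t e + u e)"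
| T0_mult: "T0 t \<Longrightarrow> T0 u \<Longrightarrow> T0 (\<lambda>e. t e * u e)"
| T0_expo: "T0 t \<Longrightarrow> T0 u \<Longrightarrow> T0 (\<lambda>e. expo (t e) (u e))"

text \<open>Bounded formulas as predicates on environments, with elements and sets of the model as
  parameters. No de Bruijn formula has to be written down to see that a concrete predicate is
  definable.\<close>

inductive S0 :: "((nat \<Rightarrow> 'a::so_structure) \<Rightarrow> bool) \<Rightarrow> bool" where
  S0_False: "S0 (\<lambda>e. False)"
| S0_eq: "T0 t \<Longrightarrow> T0 u \<Longrightarrow> S0 (\<lambda>e. t e = u e)"
| S0_less: "T0 t \<Longrightarrow> T0 u \<Longrightarrow> S0 (\<lambda>e. t e < u e)"
| S0_mem: "T0 t \<Longrightarrow> X \<in> sets \<Longrightarrow> S0 (\<lambda>e. t e \<in> X)"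
| S0_imp: "S0 P \<Longrightarrow> S0 Q \<Longrightarrow> S0 (\<lambda>e. P e \<longrightarrow> Q e)"
| S0_all_env: "T0 t \<Longrightarrow> S0 P \<Longrightarrow> S0 (\<lambda>e. \<forall>x. x < t e \<longrightarrow> P (case_nat x e))"

text \<open>Even positions hold the arguments, odd positions the parameters.\<close>

definition mix :: "(nat \<Rightarrow> 'a) \<Rightarrow> (nat \<Rightarrow> 'a) \<Rightarrow> nat \<Rightarrow> 'a" where
  "mix e c i = (if even i then e (i div 2) else c (i div 2))"

text \<open>When parameters are merged by \<open>mix c d\<close>, the left parameter
  \<open>j\<close> moves from index \<open>2 * j + 1\<close> to \<open>4 * j + 1\<close> and the
  right one to \<open>4 * j + 3\<close>.\<close>

definition into_left :: "nat \<Rightarrow> tm" where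
  "into_left i = Var (if even i then i else 4 * (i div 2) + 1)"
definition into_right :: "nat \<Rightarrow> tm" where
  "into_right i = Var (if even i then i else 4 * (i div 2) + 3)"

text \<open>Brings a bound variable to the front: argument 0 stays at index 0, argument
  \<open>j + 1\<close> moves from \<open>2 * j + 2\<close> to \<open>2 * j + 1\<close>, and
  parameter \<open>j\<close> from \<open>2 * j + 1\<close> to \<open>2 * j + 2\<close>.\<close>

definition pull :: "nat \<Rightarrow> tm" where
  "pull i = Var (if i = 0 then 0 else if even i then i - 1 else i + 1)"

lemma mix_double [simp]: "mix e c (2 * i) = e i" "mix e c (Suc (2 * i)) = c i"
  by (simp_all add: mix_def)

lemma eval_into_left: "(\<lambda>i. eval (mix e (mix c d)) (into_left i)) = mix e c"
proof
  fix i
  consider j where "i = 2 * j" | j where "i = Suc (2 * j)" by (metis evenE oddE Suc_eq_plus1)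
  then show "eval (mix e (mix c d)) (into_left i) = mix e c i"
  proof cases
    case 2
    then have "eval (mix e (mix c d)) (into_left i) = mix e (mix c d) (Suc (2 * (2 * j)))"
      by (simp add: into_left_def)
    then show ?thesis unfolding mix_double using 2 by simp
  qed (simp add: into_left_def)
qed

lemma eval_into_right: "(\<lambda>i. eval (mix e (mix d c)) (into_right i)) = mix e c"
proof
  fix i
  consider j where "i = 2 * j" | j where "i = Suc (2 * j)" by (metis evenE oddE Suc_eq_plus1)
  then show "eval (mix e (mix d c)) (into_right i) = mix e c i"
  proof cases
    case 2
    then have "eval (mix e (mix d c)) (into_right i) = mix e (mix d c) (Suc (2 * Suc (2 * j)))"
      by (simp add: into_right_def numeral_3_eq_3)
    then show ?thesis unfolding mix_double using 2 by simp
  qed (simp add: into_right_def)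
qed

lemma eval_pull: "(\<lambda>i. eval (case_nat x (mix e c)) (pull i)) = mix (case_nat x e) c"
proof
  fix i
  consider "i = 0" | j where "i = 2 * Suc j" | j where "i = Suc (2 * j)"
    by (metis evenE oddE Suc_eq_plus1 not0_implies_Suc mult_0_right)
  then show "eval (case_nat x (mix e c)) (pull i) = mix (case_nat x e) c i"
  proof cases
    case 1
    then show ?thesis by (simp add: pull_def mix_def)
  next
    case 2
    have "eval (case_nat x (mix e c)) (pull i) = case_nat x (mix e c) (Suc (2 * j))"
      by (simp add: pull_def 2)
    then show ?thesis unfolding 2 mix_double by simp
  next
    case 3
    have "eval (case_nat x (mix e c)) (pull i) = case_nat x (mix e c) (Suc (Suc (2 * j)))"
      by (simp add: pull_def 3)
    then show ?thesis unfolding 3 mix_double by simp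
  qed
qed

lemma range_mix: "range S \<subseteq> A \<Longrightarrow> range S' \<subseteq> A \<Longrightarrow> range (mix S S') \<subseteq> A"
  by (auto simp: mix_def image_subset_iff)

definition T0_rep :: "((nat \<Rightarrow> 'a::so_structure) \<Rightarrow> 'a) \<Rightarrow> (nat \<Rightarrow> 'a) \<Rightarrow> bool" where
  "T0_rep t c \<longleftrightarrow> (\<exists>u. \<forall>e. t e = eval (mix e c) u)"

definition S0_rep :: "((nat \<Rightarrow> 'a::so_structure) \<Rightarrow> bool) \<Rightarrow> (nat \<Rightarrow> 'a) \<Rightarrow> (nat \<Rightarrow> 'a set) \<Rightarrow> bool" where
  "S0_rep P c S \<longleftrightarrow> (\<exists>p. Sigma00 p \<and> (\<forall>e. P e \<longleftrightarrow> sat (mix e c) S p))"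

lemma T0_rep_mix: "T0_rep t c \<Longrightarrow> T0_rep t (mix c d)" "T0_rep t c \<Longrightarrow> T0_rep t (mix d c)"
proof -
  assume "T0_rep t c"
  then obtain u where u: "\<And>e. t e = eval (mix e c) u" by (auto simp: T0_rep_def)
  have "t e = eval (mix e (mix c d)) (subst_tm into_left u)"
      "t e = eval (mix e (mix d c)) (subst_tm into_right u)" for e
    by (simp_all add: u eval_subst_tm eval_into_left eval_into_right)
  then show "T0_rep t (mix c d)" "T0_rep t (mix d c)" unfolding T0_rep_def by blast+
qed

lemma S0_rep_mix:
  assumes "S0_rep P c S"
  shows "S0_rep P (mix c d) (mix S S')" "S0_rep P (mix d c) (mix S' S)"
proof -
  obtain p where p: "Sigma00 p" "\<And>e. P e \<longleftrightarrow> sat (mix e c) S p" using assms by (auto simp: S0_rep_def)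
  have "P e \<longleftrightarrow> sat (mix e (mix c d)) (mix S S') (subst into_left (\<lambda>X. 2 * X) p)"
      "P e \<longleftrightarrow> sat (mix e (mix d c)) (mix S' S) (subst into_right (\<lambda>X. Suc (2 * X)) p)" for e
    by (simp_all add: p(2) sat_subst eval_into_left eval_into_right)
  then show "S0_rep P (mix c d) (mix S S')" "S0_rep P (mix d c) (mix S' S)"
    unfolding S0_rep_def using Sigma00_subst[OF p(1)] by blast+
qed

text \<open>A connective needs both its parts over the same parameters; merging the two assignments
  provides them.\<close>

lemma S0_rep_common:
  assumes "\<exists>c S. range S \<subseteq> sets \<and> S0_rep P c S" and "\<exists>c S. range S \<subseteq> sets \<and> S0_rep Q c S"
  shows "\<exists>c S. range S \<subseteq> sets \<and> S0_rep P c S \<and> S0_rep Q c S"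
proof -
  obtain c S d S' where "range S \<subseteq> sets" "S0_rep P c S" "range S' \<subseteq> sets" "S0_rep Q d S'"
    using assms by blast
  then have "range (mix S S') \<subseteq> sets" "S0_rep P (mix c d) (mix S S')" "S0_rep Q (mix c d) (mix S S')"
    by (simp_all add: S0_rep_mix range_mix)
  then show ?thesis by blast
qed

lemma T0_rep_common:
  assumes "\<exists>c. T0_rep t c" and "\<exists>c. T0_rep u c"
  shows "\<exists>c. T0_rep t c \<and> T0_rep u c"
proof -
  obtain c d where "T0_rep t c" "T0_rep u d" using assms by blast
  then have "T0_rep t (mix c d)" "T0_rep u (mix c d)" by (simp_all add: T0_rep_mix)
  then show ?thesis by blast
qed

lemma T0_rep_exists: "T0 t \<Longrightarrow> \<exists>c. T0_rep t c"
proof (induction rule: T0.induct)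
  case (T0_var i)
  have "\<forall>e. e i = eval (mix e (\<lambda>_. 0)) (Var (2 * i))" by (simp add: mix_def)
  then show ?case unfolding T0_rep_def by blast
next
  case (T0_const c)
  have "\<forall>e. c = eval (mix e (\<lambda>_. c)) (Var 1)" by (simp add: mix_def)
  then show ?case unfolding T0_rep_def by blast
next
  case (T0_add t u)
  then obtain c where "T0_rep t c" "T0_rep u c" using T0_rep_common[of t u] by blast
  then obtain a b where "\<forall>e. t e = eval (mix e c) a" "\<forall>e. u e = eval (mix e c) b"
    unfolding T0_rep_def by blast
  then have "T0_rep (\<lambda>e. t e + u e) c"
    unfolding T0_rep_def by (intro exI[of _ "Add a b"]) simp
  then show ?case by blast
next
  case (T0_mult t u)
  then obtain c where "T0_rep t c" "T0_rep u c" using T0_rep_common[of t u] by blast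
  then obtain a b where "\<forall>e. t e = eval (mix e c) a" "\<forall>e. u e = eval (mix e c) b"
    unfolding T0_rep_def by blast
  then have "T0_rep (\<lambda>e. t e * u e) c"
    unfolding T0_rep_def by (intro exI[of _ "Mul a b"]) simp
  then show ?case by blast
next
  case (T0_expo t u)
  then obtain c where "T0_rep t c" "T0_rep u c" using T0_rep_common[of t u] by blast
  then obtain a b where "\<forall>e. t e = eval (mix e c) a" "\<forall>e. u e = eval (mix e c) b"
    unfolding T0_rep_def by blast
  then have "T0_rep (\<lambda>e. expo (t e) (u e)) c"
    unfolding T0_rep_def by (intro exI[of _ "Pow a b"]) simp
  then show ?case by blast
qed

lemma S0_rep_pull:
  assumes "S0_rep P c S"
  shows "\<exists>p. Sigma00 p \<and> (\<forall>x e. P (case_nat x e) \<longleftrightarrow> sat (case_nat x (mix e c)) S p)"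
proof -
  obtain p where p: "Sigma00 p" "\<forall>e. P e \<longleftrightarrow> sat (mix e c) S p"
    using assms by (auto simp: S0_rep_def)
  have "P (case_nat x e) \<longleftrightarrow> sat (case_nat x (mix e c)) S (subst pull id p)" for x e
    using p(2) by (simp add: sat_subst eval_pull)
  then show ?thesis using Sigma00_subst[OF p(1)] by blast
qed

lemma S0_rep_exists:
  fixes P :: "(nat \<Rightarrow> 'a::so_structure) \<Rightarrow> bool"
  assumes "S0 P"
  shows "\<exists>c S. range S \<subseteq> sets \<and> S0_rep P c S"
proof -
  \<comment> \<open>A dummy value for set variables where there are no set parameters.\<close>
  obtain X where ne: "X \<in> (sets :: 'a set set)" using sets_nonempty by blast
  show ?thesis using assms
  proof (induction rule: S0.induct)
    case S0_False
    have "range (\<lambda>_::nat. X) \<subseteq> sets" using ne by auto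
    moreover have "S0_rep (\<lambda>e. False) c (\<lambda>_::nat. X)" for c
      unfolding S0_rep_def by (intro exI[of _ Fls]) (auto intro: Sigma00.intros)
    ultimately show ?case by blast
  next
    case (S0_eq t u)
    then obtain c a b where "\<forall>e. t e = eval (mix e c) a" "\<forall>e. u e = eval (mix e c) b"
      using T0_rep_common[OF T0_rep_exists T0_rep_exists, of t u] unfolding T0_rep_def by blast
    then have "S0_rep (\<lambda>e. t e = u e) c (\<lambda>_::nat. X)"
      unfolding S0_rep_def by (intro exI[of _ "Eq a b"]) (auto intro: Sigma00.intros)
    moreover have "range (\<lambda>_::nat. X) \<subseteq> sets" using ne by auto
    ultimately show ?case by blast
  next
    case (S0_less t u)
    then obtain c a b where "\<forall>e. t e = eval (mix e c) a" "\<forall>e. u e = eval (mix e c) b"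
      using T0_rep_common[OF T0_rep_exists T0_rep_exists, of t u] unfolding T0_rep_def by blast
    then have "S0_rep (\<lambda>e. t e < u e) c (\<lambda>_::nat. X)"
      unfolding S0_rep_def by (intro exI[of _ "Lt a b"]) (auto intro: Sigma00.intros)
    moreover have "range (\<lambda>_::nat. X) \<subseteq> sets" using ne by auto
    ultimately show ?case by blast
  next
    case (S0_mem t Y)
    then obtain c a where "\<forall>e. t e = eval (mix e c) a"
      using T0_rep_exists[of t] unfolding T0_rep_def by blast
    then have "S0_rep (\<lambda>e. t e \<in> Y) c (\<lambda>_::nat. Y)"
      unfolding S0_rep_def by (intro exI[of _ "Mem a 0"]) (auto intro: Sigma00.intros)
    moreover have "range (\<lambda>_::nat. Y) \<subseteq> sets" using S0_mem by auto
    ultimately show ?case by blast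
  next
    case (S0_imp P Q)
    then obtain c S where "range S \<subseteq> sets" and rep: "S0_rep P c S" "S0_rep Q c S"
      using S0_rep_common[of P Q] by blast
    obtain p q where pq: "Sigma00 p" "Sigma00 q"
        "\<forall>e. P e \<longleftrightarrow> sat (mix e c) S p" "\<forall>e. Q e \<longleftrightarrow> sat (mix e c) S q"
      using rep unfolding S0_rep_def by blast
    then have "S0_rep (\<lambda>e. P e \<longrightarrow> Q e) c S"
      unfolding S0_rep_def by (intro exI[of _ "Imp p q"]) (simp add: Sigma00.intros)
    then show ?case using \<open>range S \<subseteq> sets\<close> by blast
  next
    case (S0_all_env t P)
    then obtain c d S where S: "range S \<subseteq> sets" "S0_rep P c S" "T0_rep t d"
      using T0_rep_exists[of t] by blast
    then have "S0_rep P (mix c d) (mix S S)" "T0_rep t (mix c d)" "range (mix S S) \<subseteq> sets"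
      by (simp_all add: S0_rep_mix T0_rep_mix range_mix)
    then obtain p a where "Sigma00 p" "\<forall>e. t e = eval (mix e (mix c d)) a"
        "\<forall>x e. P (case_nat x e) \<longleftrightarrow> sat (case_nat x (mix e (mix c d))) (mix S S) p"
      using S0_rep_pull[of P "mix c d" "mix S S"] unfolding T0_rep_def by blast
    then have "S0_rep (\<lambda>e. \<forall>x. x < t e \<longrightarrow> P (case_nat x e)) (mix c d) (mix S S)"
      unfolding S0_rep_def
      by (intro exI[of _ "All (Imp (Lt (Var 0) (lift_tm a)) p)"])
        (auto intro: Sigma00.intros simp: eval_subst_tm)
    then show ?case using \<open>range (mix S S) \<subseteq> sets\<close> by blast
  qed
qed

section \<open>Induction and comprehension for bounded predicates\<close>

lemma sat_shift_All: "(\<And>e. sat e S ((All ^^ n) p)) \<Longrightarrow> sat e S p"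
proof -
  assume all: "\<And>e. sat e S ((All ^^ n) p)"
  \<comment> \<open>Starting from the tail of \<open>e\<close> behind its first \<open>j\<close>
    values, each quantifier restores the last value that is missing.\<close>
  have "sat (\<lambda>i. e (i + j)) S ((All ^^ j) p) \<Longrightarrow> sat e S p" for j
  proof (induction j)
    case (Suc j)
    have "case_nat (e j) (\<lambda>i. e (i + Suc j)) = (\<lambda>i. e (i + j))"
      by (auto simp: fun_eq_iff split: nat.split)
    then have "sat (\<lambda>i. e (i + j)) S ((All ^^ j) p)" using Suc.prems by (auto dest: spec[of _ "e j"])
    then show ?case by (rule Suc.IH)
  qed simp
  then show "sat e S p" using all by blast
qed

lemma sat_shift_AllS:
  "(\<And>S. range S \<subseteq> sets \<Longrightarrow> sat e S ((AllS ^^ n) p)) \<Longrightarrow> range S \<subseteq> sets \<Longrightarrow> sat e S p"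
proof -
  assume all: "\<And>S. range S \<subseteq> sets \<Longrightarrow> sat e S ((AllS ^^ n) p)" and S: "range S \<subseteq> sets"
  have "sat e (\<lambda>i. S (i + j)) ((AllS ^^ j) p) \<Longrightarrow> sat e S p" for j
  proof (induction j)
    case (Suc j)
    have "case_nat (S j) (\<lambda>i. S (i + Suc j)) = (\<lambda>i. S (i + j))"
      by (auto simp: fun_eq_iff split: nat.split)
    moreover have "S j \<in> sets" using S by auto
    ultimately have "sat e (\<lambda>i. S (i + j)) ((AllS ^^ j) p)" using Suc.prems by (auto dest: bspec[of _ _ "S j"])
    then show ?case by (rule Suc.IH)
  qed simp
  moreover have "range (\<lambda>i. S (i + n)) \<subseteq> sets" using S by auto
  ultimately show "sat e S p" using all by blast
qed

text \<open>This is how parameters enter the schemes, whose instances in \<open>RCA0_star\<close>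
  are closed sentences.\<close>

lemma model_closures:
  fixes e :: "nat \<Rightarrow> 'a::rca_model"
  assumes "closures p \<subseteq> RCA0_star" and "range S \<subseteq> sets"
  shows "sat e S p"
proof -
  obtain n m where "bounded_fm n m p" using bounded_fm_exists by blast
  then have mem: "(All ^^ n) ((AllS ^^ m) p) \<in> RCA0_star" using assms(1) by (auto simp: closures_def)
  have "sat e S ((AllS ^^ m) p)" if "range S \<subseteq> sets" for e :: "nat \<Rightarrow> 'a" and S
    by (rule sat_shift_All[where n = n], rule model[OF mem]) (use that in auto)
  then show ?thesis using assms(2) by (rule sat_shift_AllS[where n = m])
qed


lemma T0_subst: "T0 t \<Longrightarrow> (\<And>i. T0 (\<lambda>e. f e i)) \<Longrightarrow> T0 (\<lambda>e. t (f e))"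
  by (induction rule: T0.induct) (auto intro: T0.intros)

lemma S0_subst: "S0 P \<Longrightarrow> (\<And>i. T0 (\<lambda>e. f e i)) \<Longrightarrow> S0 (\<lambda>e. P (f e))"
proof (induction arbitrary: f rule: S0.induct)
  case (S0_all_env t P)
  let ?f = "\<lambda>e. case_nat (e 0) (f (\<lambda>i. e (Suc i)))"
  have "T0 (\<lambda>e. ?f e i)" for i
    using T0_subst[OF S0_all_env.prems T0_var] by (cases i) (auto intro: T0_var)
  then have "S0 (\<lambda>e. P (?f e))" by (rule S0_all_env.IH)
  from S0.S0_all_env[OF T0_subst[OF S0_all_env.hyps(1) S0_all_env.prems] this]
  show ?case by simp
next
  case (S0_eq t u)
  then show ?case by (intro S0.S0_eq T0_subst[of t f] T0_subst[of u f]) auto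
next
  case (S0_less t u)
  then show ?case by (intro S0.S0_less T0_subst[of t f] T0_subst[of u f]) auto
next
  case (S0_mem t X)
  then show ?case by (intro S0.S0_mem T0_subst[of t f]) auto
qed (auto intro: S0.intros)

lemma S0_subst1: "S0 (\<lambda>e. Q (e 0)) \<Longrightarrow> T0 t \<Longrightarrow> S0 (\<lambda>e. Q (t e))"
  using S0_subst[of "\<lambda>e. Q (e 0)" "\<lambda>e i. t e"] by simp

lemma S0_subst2: "S0 (\<lambda>e. Q (e 0) (e 1)) \<Longrightarrow> T0 t \<Longrightarrow> T0 u \<Longrightarrow> S0 (\<lambda>e. Q (t e) (u e))"
proof -
  assume *: "S0 (\<lambda>e. Q (e 0) (e 1))" "T0 t" "T0 u"
  then have "T0 (\<lambda>e. if i = 0 then t e else u e)" for i by (cases "i = 0") simp_all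
  from S0_subst[of _ "\<lambda>e i. if i = 0 then t e else u e", OF *(1) this] show ?thesis by simp
qed

lemma S0_not: "S0 P \<Longrightarrow> S0 (\<lambda>e. \<not> P e)"
  using S0_imp[OF _ S0_False, of P] by simp

lemma S0_and: "S0 P \<Longrightarrow> S0 Q \<Longrightarrow> S0 (\<lambda>e. P e \<and> Q e)"
  using S0_not[OF S0_imp[OF _ S0_not], of P Q] by simp

lemma S0_or: "S0 P \<Longrightarrow> S0 Q \<Longrightarrow> S0 (\<lambda>e. P e \<or> Q e)"
  using S0_imp[OF S0_not, of P Q] by (simp add: disj_imp)

lemma S0_iff: "S0 P \<Longrightarrow> S0 Q \<Longrightarrow> S0 (\<lambda>e. P e \<longleftrightarrow> Q e)"
  unfolding iff_conv_conj_imp by (intro S0_and S0_imp)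

lemma S0_const: "S0 (\<lambda>e. b)"
  using S0_False S0_not[OF S0_False] by (cases b) simp_all

lemma S0_all:
  assumes "T0 t" and "S0 (\<lambda>e. P (e 0) (\<lambda>i. e (Suc i)))"
  shows "S0 (\<lambda>e. \<forall>x. x < t e \<longrightarrow> P x e)"
  using S0_all_env[OF assms] by simp

lemma S0_ex:
  assumes "T0 t" and "S0 (\<lambda>e. P (e 0) (\<lambda>i. e (Suc i)))"
  shows "S0 (\<lambda>e. \<exists>x. x < t e \<and> P x e)"
  using S0_not[OF S0_all[OF assms(1) S0_not[OF assms(2)]]] by simp

lemma S0_induct_env:
  fixes P :: "(nat \<Rightarrow> 'a::rca_model) \<Rightarrow> bool"
  assumes "S0 P" and "P (case_nat 0 e)" and "\<And>x. P (case_nat x e) \<Longrightarrow> P (case_nat (x + 1) e)"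
  shows "P (case_nat x e)"
proof -
  obtain c S p where S: "range S \<subseteq> sets" and "Sigma00 p"
      and p: "\<And>x e. P (case_nat x e) \<longleftrightarrow> sat (case_nat x (mix e c)) S p"
    using S0_rep_exists[OF assms(1)] S0_rep_pull by metis
  then have "closures (ind_inst p) \<subseteq> RCA0_star" unfolding RCA0_star_def by blast
  then have "sat (mix e c) S (ind_inst p)" using S by (rule model_closures)
  then show ?thesis using assms(2,3) unfolding sat_ind_inst_iff p by blast
qed

lemma S0_induct:
  fixes x :: "'a::rca_model"
  assumes "S0 (\<lambda>e. P (e 0))" and "P 0" and "\<And>x. P x \<Longrightarrow> P (x + 1)"
  shows "P x"
  using S0_induct_env[OF assms(1), of "\<lambda>_. 0" x] assms(2,3) by simp

lemma Delta_comprehension: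
  fixes P Q :: "'a::rca_model \<Rightarrow> 'a \<Rightarrow> bool"
  assumes "S0 (\<lambda>e. P (e 0) (e 1))" and "S0 (\<lambda>e. Q (e 0) (e 1))"
    and iff: "\<And>x. (\<exists>y. P y x) \<longleftrightarrow> (\<forall>y. Q y x)"
  shows "\<exists>X \<in> sets. \<forall>x. x \<in> X \<longleftrightarrow> (\<exists>y. P y x)"
proof -
  have pull2: "(\<lambda>i. eval (case_nat y (case_nat x (mix e c))) (up pull i)) = case_nat y (mix (case_nat x e) c)"
    for x y e and c :: "nat \<Rightarrow> 'a"
    by (simp add: eval_up eval_pull)
  obtain c S where S: "range S \<subseteq> sets"
      and rep: "S0_rep (\<lambda>e. P (e 0) (e 1)) c S" "S0_rep (\<lambda>e. Q (e 0) (e 1)) c S"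
    using S0_rep_common[OF S0_rep_exists[OF assms(1)] S0_rep_exists[OF assms(2)]] by blast
  obtain p q where pq: "Sigma00 p" "Sigma00 q"
      and p: "\<And>y e. P y (e 0) \<longleftrightarrow> sat (case_nat y (mix e c)) S p"
      and q: "\<And>y e. Q y (e 0) \<longleftrightarrow> sat (case_nat y (mix e c)) S q"
    using S0_rep_pull[OF rep(1)] S0_rep_pull[OF rep(2)] by auto
  \<comment> \<open>\<open>S0_rep_pull\<close> has moved the witness \<open>y\<close> to the front;
    \<open>up pull\<close> does the same for the element \<open>x\<close> behind it.\<close>
  let ?e = "mix (\<lambda>_. 0) c" and ?p = "subst (up pull) id p" and ?q = "subst (up pull) id q"
  have p': "P y x \<longleftrightarrow> sat (case_nat y (case_nat x ?e)) S ?p" for x y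
    using p[of y "case_nat x (\<lambda>_. 0)"] by (simp add: sat_subst pull2)
  have q': "Q y x \<longleftrightarrow> sat (case_nat y (case_nat x ?e)) S ?q" for x y
    using q[of y "case_nat x (\<lambda>_. 0)"] by (simp add: sat_subst pull2)
  have "Sigma01 (Ex ?p)" "Pi01 (All ?q)"
    using pq Sigma00_subst by (auto intro: Sigma01.intros Pi01.intros)
  then have "closures (comp_inst (Ex ?p) (All ?q)) \<subseteq> RCA0_star" unfolding RCA0_star_def by blast
  then have "sat ?e S (comp_inst (Ex ?p) (All ?q))" using S by (rule model_closures)
  then show ?thesis using iff unfolding sat_comp_inst_iff by (simp add: p' q')
qed


section \<open>Arithmetic\<close>

lemma basic:
  fixes x y :: "'a::rca_model"
  shows basic_succ_nonzero: "x + 1 \<noteq> 0"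
    and basic_succ_inject: "x + 1 = y + 1 \<Longrightarrow> x = y"
    and basic_add_zero: "x + 0 = x"
    and basic_add_succ: "x + (y + 1) = (x + y) + 1"
    and basic_mult_zero: "x * 0 = 0"
    and basic_mult_succ: "x * (y + 1) = x * y + x"
    and basic_not_less_zero: "\<not> x < 0"
    and basic_less_succ: "x < y + 1 \<longleftrightarrow> x < y \<or> x = y"
    and expo_zero: "expo x 0 = 1"
    and expo_succ: "expo x (y + 1) = expo x y * x"
proof -
  obtain X where "X \<in> (sets :: 'a set set)" using sets_nonempty by blast
  then have "sat (\<lambda>_. 0 :: 'a) (\<lambda>_. X) p" if "p \<in> basic_axioms" for p
    by (intro model) (use that in \<open>auto simp: RCA0_star_def\<close>)
  then have "\<forall>p \<in> basic_axioms. sat (\<lambda>_. 0 :: 'a) (\<lambda>_. X) p" by blast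
  note * = this[unfolded basic_axioms_def sentence_def form_defs, simplified]
  show "x + 1 \<noteq> 0" by (rule *[THEN conjunct1, THEN spec])
  note * = *[THEN conjunct2]
  show "x + 1 = y + 1 \<Longrightarrow> x = y" by (rule *[THEN conjunct1, THEN spec, THEN spec, THEN mp])
  note * = *[THEN conjunct2]
  show "x + 0 = x" by (rule *[THEN conjunct1, THEN spec])
  note * = *[THEN conjunct2]
  show "x + (y + 1) = (x + y) + 1" by (rule *[THEN conjunct1, THEN spec, THEN spec])
  note * = *[THEN conjunct2]
  show "x * 0 = 0" by (rule *[THEN conjunct1, THEN spec])
  note * = *[THEN conjunct2]
  show "x * (y + 1) = x * y + x" by (rule *[THEN conjunct1, THEN spec, THEN spec])
  note * = *[THEN conjunct2]
  show "\<not> x < 0" by (rule *[THEN conjunct1, THEN spec])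
  note * = *[THEN conjunct2]
  show "x < y + 1 \<longleftrightarrow> x < y \<or> x = y" by (rule *[THEN conjunct1, THEN spec, THEN spec])
  note * = *[THEN conjunct2]
  show "expo x 0 = 1" by (rule *[THEN conjunct1, THEN spec])
  note * = *[THEN conjunct2]
  show "expo x (y + 1) = expo x y * x" by (rule *[THEN spec, THEN spec])
qed

lemmas S0_basic_intros = T0_add T0_mult T0_expo T0_var T0_const
  S0_eq S0_less S0_mem S0_not S0_and S0_or S0_imp S0_iff S0_all S0_ex S0_const

lemma basic_zero_add: "0 + x = (x :: 'a::rca_model)"
proof (rule S0_induct[of "\<lambda>x. 0 + x = x"])
  show "S0 (\<lambda>e. 0 + e 0 = (e 0 :: 'a))" by (intro S0_basic_intros)
qed (metis basic_add_zero, metis basic_add_succ)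

lemma basic_succ_add: "(x + 1) + y = (x + y) + (1 :: 'a::rca_model)"
proof (rule S0_induct[of "\<lambda>y. (x + 1) + y = (x + y) + 1"])
  show "S0 (\<lambda>e. (x + 1) + e 0 = (x + e 0) + 1)" by (intro S0_basic_intros)
qed (metis basic_add_zero, metis basic_add_succ)

lemma basic_add_comm: "x + y = y + (x :: 'a::rca_model)"
proof (rule S0_induct[of "\<lambda>y. x + y = y + x"])
  show "S0 (\<lambda>e. x + e 0 = e 0 + x)" by (intro S0_basic_intros)
qed (metis basic_add_zero basic_zero_add, metis basic_add_succ basic_succ_add)

lemma basic_add_ass: "(x + y) + z = x + (y + (z :: 'a::rca_model))"
proof (rule S0_induct[of "\<lambda>z. (x + y) + z = x + (y + z)"])
  show "S0 (\<lambda>e. (x + y) + e 0 = x + (y + e 0))" by (intro S0_basic_intros)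
qed (metis basic_add_zero, metis basic_add_succ)

lemma basic_add_cancel: "x + z = y + z \<Longrightarrow> x = (y :: 'a::rca_model)"
proof (rule S0_induct[of "\<lambda>z. x + z = y + z \<longrightarrow> x = y" z, THEN mp])
  show "S0 (\<lambda>e. x + e 0 = y + e 0 \<longrightarrow> x = y)" by (intro S0_basic_intros)
qed (metis basic_add_zero, metis basic_add_succ basic_succ_inject, simp)

lemma basic_zero_mult: "0 * x = (0 :: 'a::rca_model)"
proof (rule S0_induct[of "\<lambda>x. 0 * x = 0"])
  show "S0 (\<lambda>e. 0 * e 0 = (0 :: 'a::rca_model))" by (intro S0_basic_intros)
qed (metis basic_mult_zero, metis basic_mult_succ basic_add_zero)

lemma basic_succ_mult: "(x + 1) * y = x * y + (y :: 'a::rca_model)"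
proof (rule S0_induct[of "\<lambda>y. (x + 1) * y = x * y + y"])
  show "S0 (\<lambda>e. (x + 1) * e 0 = x * e 0 + e 0)" by (intro S0_basic_intros)
  show "(x + 1) * 0 = x * 0 + 0" by (metis basic_mult_zero basic_add_zero)
  fix y assume IH: "(x + 1) * y = x * y + y"
  have "(x + 1) * (y + 1) = (x * y + y) + (x + 1)" by (metis basic_mult_succ IH)
  also have "\<dots> = (x * y + x) + (y + 1)" by (metis basic_add_ass basic_add_comm)
  finally show "(x + 1) * (y + 1) = x * (y + 1) + (y + 1)" by (metis basic_mult_succ)
qed

lemma basic_mult_comm: "x * y = y * (x :: 'a::rca_model)"
proof (rule S0_induct[of "\<lambda>y. x * y = y * x"])
  show "S0 (\<lambda>e. x * e 0 = e 0 * x)" by (intro S0_basic_intros)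
qed (metis basic_mult_zero basic_zero_mult, metis basic_mult_succ basic_succ_mult)

lemma basic_distrib: "x * (y + z) = x * y + x * (z :: 'a::rca_model)"
proof (rule S0_induct[of "\<lambda>z. x * (y + z) = x * y + x * z"])
  show "S0 (\<lambda>e. x * (y + e 0) = x * y + x * e 0)" by (intro S0_basic_intros)
qed (metis basic_mult_zero basic_add_zero, metis basic_mult_succ basic_add_succ basic_add_ass)

lemma basic_mult_ass: "(x * y) * z = x * (y * (z :: 'a::rca_model))"
proof (rule S0_induct[of "\<lambda>z. (x * y) * z = x * (y * z)"])
  show "S0 (\<lambda>e. (x * y) * e 0 = x * (y * e 0))" by (intro S0_basic_intros)
qed (metis basic_mult_zero, metis basic_mult_succ basic_distrib)

lemma basic_zero_less_succ: "0 < x + (1 :: 'a::rca_model)"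
proof (rule S0_induct[of "\<lambda>x. 0 < x + 1"])
  show "S0 (\<lambda>e. 0 < e 0 + (1 :: 'a::rca_model))" by (intro S0_basic_intros)
qed (metis basic_less_succ)+

lemma basic_succ_less_succ: "x < y \<Longrightarrow> x + 1 < y + (1 :: 'a::rca_model)"
proof (rule S0_induct[of "\<lambda>y. x < y \<longrightarrow> x + 1 < y + 1" y, THEN mp])
  show "S0 (\<lambda>e. x < e 0 \<longrightarrow> x + 1 < e 0 + 1)" by (intro S0_basic_intros)
qed (metis basic_not_less_zero, metis basic_less_succ, simp)

text \<open>The bound on \<open>z\<close> makes the claim a bounded formula, so that induction on
  \<open>y\<close> applies.\<close>

lemma basic_less_imp: "x < y \<Longrightarrow> \<exists>z. z < y \<and> y = x + (z + (1 :: 'a::rca_model))"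
proof (rule S0_induct[of "\<lambda>y. x < y \<longrightarrow> (\<exists>z. z < y \<and> y = x + (z + 1))" y, THEN mp])
  show "S0 (\<lambda>e. x < e 0 \<longrightarrow> (\<exists>z. z < e 0 \<and> e 0 = x + (z + 1)))" by (intro S0_basic_intros)
  show "0 > x \<longrightarrow> (\<exists>z. z < 0 \<and> 0 = x + (z + 1))" using basic_not_less_zero by blast
  fix y assume IH: "x < y \<longrightarrow> (\<exists>z. z < y \<and> y = x + (z + 1))"
  show "x < y + 1 \<longrightarrow> (\<exists>z. z < y + 1 \<and> y + 1 = x + (z + 1))"
  proof
    assume "x < y + 1"
    then consider "x < y" | "x = y" using basic_less_succ by blast
    then show "\<exists>z. z < y + 1 \<and> y + 1 = x + (z + 1)"
    proof cases
      case 1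
      then obtain z where "z < y" "y = x + (z + 1)" using IH by blast
      then have "z + 1 < y + 1 \<and> y + 1 = x + ((z + 1) + 1)"
        using basic_succ_less_succ basic_add_succ by metis
      then show ?thesis by blast
    next
      case 2
      then have "0 < y + 1 \<and> y + 1 = x + (0 + 1)" using basic_zero_less_succ basic_zero_add by metis
      then show ?thesis by blast
    qed
  qed
qed

lemma basic_less_add_succ: "x < x + (z + (1 :: 'a::rca_model))"
proof (rule S0_induct[of "\<lambda>z. x < x + (z + 1)"])
  show "S0 (\<lambda>e. x < x + (e 0 + 1))" by (intro S0_basic_intros)
qed (metis basic_less_succ basic_zero_add, metis basic_less_succ basic_add_succ)

lemma basic_less_iff: "x < y \<longleftrightarrow> (\<exists>z. y = x + (z + (1 :: 'a::rca_model)))"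
  using basic_less_imp basic_less_add_succ by metis

lemma basic_less_irrefl: "\<not> x < (x :: 'a::rca_model)"
  unfolding basic_less_iff by (metis basic_add_cancel basic_add_comm basic_add_zero basic_succ_nonzero)

lemma basic_less_trans: "x < y \<Longrightarrow> y < z \<Longrightarrow> x < (z :: 'a::rca_model)"
  unfolding basic_less_iff by (metis basic_add_ass basic_add_succ)

lemma basic_zero_or_succ: "x = 0 \<or> (\<exists>y. x = y + (1 :: 'a::rca_model))"
proof -
  have "0 < x \<or> x = 0"
  proof (rule S0_induct[of "\<lambda>x. 0 < x \<or> x = 0"])
    show "S0 (\<lambda>e. 0 < e 0 \<or> e 0 = (0 :: 'a::rca_model))" by (intro S0_basic_intros)
  qed (auto simp: basic_zero_less_succ)
  then show ?thesis using basic_less_iff[of 0 x] basic_zero_add by metis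
qed

lemma basic_less_total: "x < y \<or> x = y \<or> y < (x :: 'a::rca_model)"
proof (rule S0_induct[of "\<lambda>y. x < y \<or> x = y \<or> y < x"])
  show "S0 (\<lambda>e. x < e 0 \<or> x = e 0 \<or> e 0 < x)" by (intro S0_basic_intros)
  show "x < 0 \<or> x = 0 \<or> 0 < x" using basic_zero_or_succ basic_zero_less_succ by metis
  fix y assume "x < y \<or> x = y \<or> y < x"
  then consider "x < y + 1" | "y < x" using basic_less_succ by blast
  then show "x < y + 1 \<or> x = y + 1 \<or> y + 1 < x"
  proof cases
    case 2
    then obtain z where "x = y + (z + 1)" using basic_less_iff by blast
    then have z: "x = (y + 1) + z" by (metis basic_add_ass basic_add_comm)
    then show ?thesis using basic_zero_or_succ[of z] basic_less_iff basic_add_zero by metis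
  qed simp
qed

lemma basic_add_less: "x < y \<Longrightarrow> x + z < y + (z :: 'a::rca_model)"
  unfolding basic_less_iff by (metis basic_add_ass basic_add_comm)

lemma basic_mult_less: "x < y \<Longrightarrow> 0 < z \<Longrightarrow> z * x < z * (y :: 'a::rca_model)"
proof -
  assume "x < y" "0 < z"
  then obtain v w where vw: "y = x + (v + 1)" "z = w + 1" using basic_less_iff basic_zero_add by metis
  have "z * (v + 1) = (z * v + w) + 1" using vw(2) basic_mult_succ basic_add_succ by metis
  then have "z * y = z * x + ((z * v + w) + 1)" using vw(1) basic_distrib by metis
  then show ?thesis using basic_less_iff by blast
qed

lemma basic_minus_eq: "x = y + z \<Longrightarrow> x - y = (z :: 'a::rca_model)"
proof -
  assume x: "x = y + z"
  then have "\<not> x < y" using basic_less_iff basic_less_trans basic_less_irrefl basic_add_less by (metis basic_add_comm basic_not_less_zero basic_zero_add basic_less_total)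
  moreover have "(THE z. x = y + z) = z" 
  proof (rule the_equality, rule x)
    show "w = z" if "x = y + w" for w
      using x that basic_add_cancel[of w y z] basic_add_comm by metis
  qed
  ultimately show ?thesis by (simp add: minus_model)
qed

lemma basic_minus_zero: "x < y \<Longrightarrow> x - y = (0 :: 'a::rca_model)"
  by (simp add: minus_model)

lemma basic_add_le: "x \<le> y \<Longrightarrow> z + x \<le> z + (y :: 'a::rca_model)"
  unfolding less_eq_model by (metis basic_add_less basic_add_comm)

lemma basic_le_iff: "x \<le> y \<longleftrightarrow> (\<exists>z. y = x + (z :: 'a::rca_model))"
  unfolding less_eq_model basic_less_iff by (metis basic_add_zero basic_zero_or_succ)

lemma basic_minus_cases:
  obtains "x < y" "x - y = (0 :: 'a::rca_model)" | z where "x = y + z" "x - y = z"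
proof (cases "x < y")
  case False
  then have "y \<le> x" using basic_less_total unfolding less_eq_model by blast
  then obtain z where "x = y + z" using basic_le_iff by blast
  then show thesis using that(2) basic_minus_eq by metis
qed (use that(1) basic_minus_zero in blast)

text \<open>From here on the simplifier and \<open>algebra_simps\<close> treat a possibly
  nonstandard model as an ordered semiring.\<close>

instance rca_model \<subseteq> linordered_semidom
proof
  fix a b c :: "'a::rca_model"
  show "a + b + c = a + (b + c)" by (rule basic_add_ass)
  show "a + b = b + a" by (rule basic_add_comm)
  show "a + b - a = b" by (rule basic_minus_eq) simp
  show "a - b - c = a - (b + c)"
  proof (cases rule: basic_minus_cases[of a b])
    case 1
    then have "a < b + c" using basic_less_iff basic_add_ass basic_add_comm by metis
    moreover have "0 - c = 0"
      by (cases rule: basic_minus_cases[of 0 c]) (metis basic_add_zero basic_zero_add basic_zero_or_succ basic_add_succ basic_succ_nonzero)+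
    ultimately show ?thesis using 1 basic_minus_zero by simp
  next
    case (2 z)
    show ?thesis
    proof (cases rule: basic_minus_cases[of z c])
      case 1
      then have "a < b + c" using 2(1) basic_add_less basic_add_comm by metis
      then show ?thesis using 1 2 basic_minus_zero by simp
    next
      case (2 w)
      then have "a = (b + c) + w" using \<open>a = b + z\<close> basic_add_ass by metis
      then have "a - (b + c) = w" by (rule basic_minus_eq)
      then show ?thesis using 2 \<open>a - b = z\<close> by simp
    qed
  qed
  show "(a < b) = (a \<le> b \<and> \<not> b \<le> a)"
    unfolding less_eq_model using basic_less_irrefl basic_less_trans by metis
  show "a \<le> a" by (simp add: less_eq_model)
  show "a \<le> b \<Longrightarrow> b \<le> c \<Longrightarrow> a \<le> c" unfolding less_eq_model using basic_less_trans by metis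
  show "a \<le> b \<Longrightarrow> b \<le> a \<Longrightarrow> a = b" unfolding less_eq_model using basic_less_trans basic_less_irrefl by metis
  show "a \<le> b \<Longrightarrow> c + a \<le> c + b" by (rule basic_add_le)
  show "a \<le> b \<or> b \<le> a" unfolding less_eq_model using basic_less_total by metis
  show "0 + a = a" by (rule basic_zero_add)
  show "a * b * c = a * (b * c)" by (rule basic_mult_ass)
  show "a * b = b * a" by (rule basic_mult_comm)
  show "0 * a = 0" by (rule basic_zero_mult)
  show "1 * a = a" using basic_succ_mult[of 0 a] basic_zero_add basic_zero_mult by metis
  show "(a + b) * c = a * c + b * c" using basic_distrib basic_mult_comm by metis
  show "0 \<noteq> (1 :: 'a)" using basic_succ_nonzero[of "0 :: 'a"] basic_zero_add by metis
  show "0 < (1 :: 'a)" using basic_zero_less_succ[of "0 :: 'a"] basic_zero_add by metis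
  show "a < b \<Longrightarrow> 0 < c \<Longrightarrow> c * a < c * b" by (rule basic_mult_less)
  show "a * 0 = 0" by (rule basic_mult_zero)
  show "a * (b - c) = a * b - a * c"
  proof (cases rule: basic_minus_cases[of b c])
    case 1
    have "a * b - a * c = 0"
    proof (cases "a = 0")
      case True
      then show ?thesis using basic_minus_eq[of 0 0 0] by (simp add: basic_zero_mult basic_add_zero)
    next
      case False
      then have "0 < a" using basic_zero_or_succ basic_zero_less_succ by metis
      then show ?thesis using 1 basic_mult_less basic_minus_zero by blast
    qed
    then show ?thesis using 1 by (simp add: basic_mult_zero)
  next
    case (2 z)
    then have "a * b = a * c + a * z" by (simp add: basic_distrib)
    then have "a * b - a * c = a * z" by (rule basic_minus_eq)
    then show ?thesis using 2 by simp
  qed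
  show "a * (b + c) = a * b + a * c" by (rule basic_distrib)
  show "a * b \<noteq> 0" if ne: "a \<noteq> 0" "b \<noteq> 0"
  proof -
    obtain v w where "a = v + 1" "b = w + 1" using ne basic_zero_or_succ by metis
    then have "a * b = (a * w + v) + 1" using basic_mult_succ basic_add_succ by metis
    then show ?thesis using basic_succ_nonzero by simp
  qed
  show "a - b + b = a" if le: "b \<le> a"
  proof -
    obtain z where z: "a = b + z" using le basic_le_iff by blast
    then have "a - b = z" by (rule basic_minus_eq)
    then show ?thesis using z basic_add_comm by simp
  qed
qed


section \<open>The ring of differences\<close>

text \<open>Linear arithmetic is available for ordered rings only, so linear facts about a model are
  proved in its ring of differences.\<close>

definition same_diff :: "'a::linordered_semidom \<times> 'a \<Rightarrow> 'a \<times> 'a \<Rightarrow> bool" where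
  "same_diff p q \<longleftrightarrow> fst p + snd q = fst q + snd p"

lemma same_diff_trans: "same_diff p q \<Longrightarrow> same_diff q r \<Longrightarrow> same_diff p r"
proof -
  assume "same_diff p q" "same_diff q r"
  then have "fst p + snd q + (fst q + snd r) = fst q + snd p + (fst r + snd q)"
    by (simp add: same_diff_def)
  then have "(fst p + snd r) + (fst q + snd q) = (fst r + snd p) + (fst q + snd q)"
    by (simp only: ac_simps)
  then show ?thesis by (simp add: same_diff_def)
qed

lemma same_diff_sym: "same_diff p q \<Longrightarrow> same_diff q p"
  by (simp add: same_diff_def)

quotient_type (overloaded) 'a differ = "'a::linordered_semidom \<times> 'a" / same_diff morphisms differ_rep differ_abs
  by (intro equivpI reflpI sympI transpI) (auto intro: same_diff_trans same_diff_sym, simp add: same_diff_def)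

instantiation differ :: (linordered_semidom) comm_ring_1
begin

lift_definition zero_differ :: "'a differ" is "(0, 0)" .
lift_definition one_differ :: "'a differ" is "(1, 0)" .
lift_definition uminus_differ :: "'a differ \<Rightarrow> 'a differ" is "\<lambda>p. (snd p, fst p)"
  by (simp add: same_diff_def ac_simps)
lift_definition plus_differ :: "'a differ \<Rightarrow> 'a differ \<Rightarrow> 'a differ"
  is "\<lambda>p q. (fst p + fst q, snd p + snd q)"
proof -
  fix p q r s :: "'a \<times> 'a"
  assume "same_diff p q" "same_diff r s"
  then have "(fst p + snd q) + (fst r + snd s) = (fst q + snd p) + (fst s + snd r)"
    by (simp add: same_diff_def)
  then show "same_diff (fst p + fst r, snd p + snd r) (fst q + fst s, snd q + snd s)"
    unfolding same_diff_def fst_conv snd_conv by (simp only: ac_simps)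
qed
lift_definition times_differ :: "'a differ \<Rightarrow> 'a differ \<Rightarrow> 'a differ"
  is "\<lambda>p q. (fst p * fst q + snd p * snd q, fst p * snd q + snd p * fst q)"
proof -
  fix p q r s :: "'a \<times> 'a"
  assume "same_diff p q" "same_diff r s"
  then have 1: "fst p + snd q = fst q + snd p" and 2: "fst r + snd s = fst s + snd r"
    by (simp_all add: same_diff_def)
  \<comment> \<open>The left factor is exchanged first and the right one afterwards; transitivity
    joins the two steps.\<close>
  have "(fst p * fst r + snd p * snd r) + (fst q * snd r + snd q * fst r)
      = (fst p + snd q) * fst r + (fst q + snd p) * snd r" by (simp add: algebra_simps)
  also have "\<dots> = (fst q + snd p) * fst r + (fst p + snd q) * snd r" by (simp only: 1)
  also have "\<dots> = (fst q * fst r + snd q * snd r) + (fst p * snd r + snd p * fst r)"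
    by (simp add: algebra_simps)
  finally have A: "same_diff (fst p * fst r + snd p * snd r, fst p * snd r + snd p * fst r)
      (fst q * fst r + snd q * snd r, fst q * snd r + snd q * fst r)" by (simp add: same_diff_def)
  have "(fst q * fst r + snd q * snd r) + (fst q * snd s + snd q * fst s)
      = fst q * (fst r + snd s) + snd q * (fst s + snd r)" by (simp add: algebra_simps)
  also have "\<dots> = fst q * (fst s + snd r) + snd q * (fst r + snd s)" by (simp only: 2)
  also have "\<dots> = (fst q * fst s + snd q * snd s) + (fst q * snd r + snd q * fst r)"
    by (simp add: algebra_simps)
  finally have B: "same_diff (fst q * fst r + snd q * snd r, fst q * snd r + snd q * fst r)
      (fst q * fst s + snd q * snd s, fst q * snd s + snd q * fst s)" by (simp add: same_diff_def)
  from A B show "same_diff (fst p * fst r + snd p * snd r, fst p * snd r + snd p * fst r)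
      (fst q * fst s + snd q * snd s, fst q * snd s + snd q * fst s)" by (rule same_diff_trans)
qed
definition minus_differ :: "'a differ \<Rightarrow> 'a differ \<Rightarrow> 'a differ" where
  "minus_differ x y = x + - y"

instance
proof
  fix x y z :: "'a differ"
  show "x + y + z = x + (y + z)" by transfer (simp add: same_diff_def ac_simps)
  show "x + y = y + x" by transfer (simp add: same_diff_def ac_simps)
  show "0 + x = x" by transfer (simp add: same_diff_def)
  show "- x + x = 0" by transfer (simp add: same_diff_def ac_simps)
  show "x - y = x + - y" by (rule minus_differ_def)
  show "x * y * z = x * (y * z)" by transfer (simp add: same_diff_def algebra_simps)
  show "x * y = y * x" by transfer (simp add: same_diff_def algebra_simps)
  show "1 * x = x" by transfer (simp add: same_diff_def)
  show "(x + y) * z = x * z + y * z" by transfer (simp add: same_diff_def algebra_simps)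
  show "0 \<noteq> (1 :: 'a differ)" by transfer (simp add: same_diff_def)
qed

end

instantiation differ :: (linordered_semidom) linordered_idom
begin

lift_definition less_eq_differ :: "'a differ \<Rightarrow> 'a differ \<Rightarrow> bool"
  is "\<lambda>p q. fst p + snd q \<le> fst q + snd p"
proof -
  fix p q r s :: "'a \<times> 'a"
  assume "same_diff p q" "same_diff r s"
  then have 1: "fst p + snd q = fst q + snd p" and 2: "fst r + snd s = fst s + snd r"
    by (simp_all add: same_diff_def)
  have "fst p + snd r \<le> fst r + snd p \<longleftrightarrow>
      (fst p + snd r) + (snd q + snd s) \<le> (fst r + snd p) + (snd q + snd s)" by simp
  also have "\<dots> \<longleftrightarrow> (fst p + snd q) + (snd r + snd s) \<le> (fst r + snd s) + (snd p + snd q)"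
    by (simp only: ac_simps)
  also have "\<dots> \<longleftrightarrow> (fst q + snd s) + (snd p + snd r) \<le> (fst s + snd q) + (snd p + snd r)"
    unfolding 1 2 by (simp only: ac_simps)
  finally show "fst p + snd r \<le> fst r + snd p \<longleftrightarrow> fst q + snd s \<le> fst s + snd q" by simp
qed
definition less_differ :: "'a differ \<Rightarrow> 'a differ \<Rightarrow> bool" where
  "less_differ x y \<longleftrightarrow> x \<le> y \<and> \<not> y \<le> x"
definition abs_differ :: "'a differ \<Rightarrow> 'a differ" where
  "abs_differ x = (if x < 0 then - x else x)"
definition sgn_differ :: "'a differ \<Rightarrow> 'a differ" where
  "sgn_differ x = (if x = 0 then 0 else if 0 < x then 1 else - 1)"

lemma less_eq_trans_differ: "x \<le> y \<Longrightarrow> y \<le> z \<Longrightarrow> x \<le> (z :: 'a differ)"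
proof transfer
  fix p q r :: "'a \<times> 'a"
  assume "fst p + snd q \<le> fst q + snd p" "fst q + snd r \<le> fst r + snd q"
  then have "(fst p + snd q) + (fst q + snd r) \<le> (fst q + snd p) + (fst r + snd q)"
    by (rule add_mono)
  then have "(fst p + snd r) + (fst q + snd q) \<le> (fst r + snd p) + (fst q + snd q)"
    by (simp only: ac_simps)
  then show "fst p + snd r \<le> fst r + snd p" by simp
qed

lemma mult_pos_differ: "0 < x \<Longrightarrow> 0 < y \<Longrightarrow> 0 < x * (y :: 'a differ)"
  unfolding less_differ_def
proof transfer
  fix p q :: "'a \<times> 'a"
  assume "fst (0, 0) + snd p \<le> fst p + snd (0, 0) \<and> \<not> fst p + snd (0, 0) \<le> fst (0, 0) + snd p"
    "fst (0, 0) + snd q \<le> fst q + snd (0, 0) \<and> \<not> fst q + snd (0, 0) \<le> fst (0, 0) + snd q"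
  then have lt: "snd p < fst p" "snd q < fst q" by (simp_all add: less_le_not_le)
  have diff: "\<exists>z. v = u + z \<and> 0 < z" if "u < v" for u v :: 'a
  proof -
    have "v = u + (v - u)" using le_add_diff_inverse2[of u v] that by (simp add: add.commute)
    moreover from this have "u + 0 < u + (v - u)" using that by simp
    then have "0 < v - u" by (simp only: add_less_cancel_left)
    ultimately show ?thesis by blast
  qed
  obtain a b where ab: "fst p = snd p + a" "fst q = snd q + b" "0 < a" "0 < b"
    using diff[OF lt(1)] diff[OF lt(2)] by blast
  \<comment> \<open>The two sides differ by \<open>a * b\<close>.\<close>
  have "fst p * snd q + snd p * fst q < fst p * fst q + snd p * snd q"
    using mult_pos_pos[OF ab(3,4)] by (simp add: ab(1,2) algebra_simps)
  then show "fst (0, 0) + snd (fst p * fst q + snd p * snd q, fst p * snd q + snd p * fst q)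
      \<le> fst (fst p * fst q + snd p * snd q, fst p * snd q + snd p * fst q) + snd (0, 0) \<and>
    \<not> fst (fst p * fst q + snd p * snd q, fst p * snd q + snd p * fst q) + snd (0, 0)
      \<le> fst (0, 0) + snd (fst p * fst q + snd p * snd q, fst p * snd q + snd p * fst q)"
    by (simp add: less_le_not_le)
qed

instance
proof
  fix x y z :: "'a differ"
  show "x < y \<longleftrightarrow> x \<le> y \<and> \<not> y \<le> x" by (rule less_differ_def)
  show "x \<le> x" by transfer simp
  show "x \<le> y \<Longrightarrow> y \<le> z \<Longrightarrow> x \<le> z" by (rule less_eq_trans_differ)
  show "x \<le> y \<Longrightarrow> y \<le> x \<Longrightarrow> x = y" by transfer (simp add: same_diff_def)
  show "x \<le> y \<or> y \<le> x" by transfer (simp add: linear)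
  show mono: "x \<le> y \<Longrightarrow> z + x \<le> z + y" for x y z :: "'a differ"
  proof transfer
    fix p q r :: "'a \<times> 'a"
    assume "fst p + snd q \<le> fst q + snd p"
    then have "(fst p + snd q) + (fst r + snd r) \<le> (fst q + snd p) + (fst r + snd r)" by simp
    then show "fst (fst r + fst p, snd r + snd p) + snd (fst r + fst q, snd r + snd q)
        \<le> fst (fst r + fst q, snd r + snd q) + snd (fst r + fst p, snd r + snd p)"
      by (simp add: ac_simps)
  qed
  show "\<bar>x\<bar> = (if x < 0 then - x else x)" by (rule abs_differ_def)
  show "sgn x = (if x = 0 then 0 else if 0 < x then 1 else - 1)" by (rule sgn_differ_def)
  show "z * x < z * y" if "x < y" "0 < z"
  proof -
    have *: "0 < v - u \<longleftrightarrow> u < v" for u v :: "'a differ"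
      using mono[of 0 "v - u" u] mono[of u v "- u"] mono[of "v - u" 0 u] mono[of v u "- u"]
      unfolding less_differ_def by auto
    show ?thesis using mult_pos_differ[OF that(2), of "y - x"] that(1) by (simp add: * right_diff_distrib)
  qed
qed

end

lift_definition differ :: "'a::linordered_semidom \<Rightarrow> 'a differ" is "\<lambda>x. (x, 0)" .

lemma differ_hom:
  "differ (x + y) = differ x + differ y" "differ (x * y) = differ x * differ y"
  "differ 0 = 0" "differ 1 = 1"
  by (transfer; simp add: same_diff_def)+

lemma zero_le_model [simp]: "0 \<le> (x :: 'a::rca_model)"
  by (simp add: basic_le_iff)

lemma differ_nonneg: "0 \<le> differ (x :: 'a::rca_model)"
  using zero_le_model[of x] by transfer simp

lemma less_iff_succ_le: "x < y \<longleftrightarrow> x + 1 \<le> (y :: 'a::rca_model)"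
  unfolding basic_less_iff basic_le_iff by (simp only: ac_simps)

text \<open>The third equation builds in discreteness: linear arithmetic over \<open>differ\<close>
  does not know that nothing lies between x and x + 1.\<close>

lemma differ_order:
  "(x :: 'a::rca_model) = y \<longleftrightarrow> differ x = differ y"
  "(x :: 'a::rca_model) \<le> y \<longleftrightarrow> differ x \<le> differ y"
  "(x :: 'a::rca_model) < y \<longleftrightarrow> differ x + 1 \<le> differ y"
proof -
  show "x = y \<longleftrightarrow> differ x = differ y" by (simp add: differ.abs_eq differ.abs_eq_iff same_diff_def)
  show le: "x \<le> y \<longleftrightarrow> differ x \<le> differ y" for x y :: 'a
    by (simp add: differ.abs_eq less_eq_differ.abs_eq)
  show "x < y \<longleftrightarrow> differ x + 1 \<le> differ y" by (simp only: less_iff_succ_le le differ_hom)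
qed

text \<open>Turns linear facts about a model, negated ones included, into facts for
  \<open>linarith\<close>. Nonnegativity is supplied by \<open>differ_nonneg\<close> where it
  matters.\<close>

lemmas lin = not_less not_le differ_order differ_hom


section \<open>Coding in a model\<close>

lemma S0_le: "T0 t \<Longrightarrow> T0 u \<Longrightarrow> S0 (\<lambda>e. t e \<le> (u e :: 'a::rca_model))"
  unfolding le_less by (intro S0_or S0_less S0_eq)

lemmas S0_intros = S0_le S0_basic_intros

lemma le_add_model: "x \<le> x + y" "x \<le> y + x" for x y :: "'a::rca_model"
  using differ_nonneg[of y] unfolding lin by linarith+

lemma le_mult_model: "0 < b \<Longrightarrow> x \<le> x * b" for x b :: "'a::rca_model"
  using mult_left_mono[of 1 b x] by (simp add: less_iff_succ_le)

lemma pos_model: "x < b \<Longrightarrow> 0 < b" for x b :: "'a::rca_model"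
  by (rule le_less_trans[OF zero_le_model])

definition pairM :: "'a::rca_model \<Rightarrow> 'a \<Rightarrow> 'a" where
  "pairM x y = (x + y) * (x + y) + x"

text \<open>With s = x + y the code lies between s^2 and s^2 + s, hence below (s + 1)^2. So it
  determines s, and then x.\<close>

lemma pairM_inject [simp]: "pairM x y = pairM x' y' \<longleftrightarrow> x = x' \<and> y = y'"
proof
  have less: "pairM x y < pairM x' y'" if "x + y < x' + y'" for x y x' y' :: 'a
  proof -
    have "(x + y + 1) * (x + y + 1) \<le> (x' + y') * (x' + y')"
      using that by (intro mult_mono) (simp_all add: less_iff_succ_le)
    then show ?thesis
      using differ_nonneg[of y] differ_nonneg[of x] differ_nonneg[of x']
      unfolding pairM_def lin by (simp add: algebra_simps)
  qed
  assume eq: "pairM x y = pairM x' y'"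
  then have "x + y = x' + y'" using less by (metis less_irrefl linorder_less_linear)
  then show "x = x' \<and> y = y'" using eq unfolding pairM_def by auto
qed simp

lemma S0_pairM: "T0 t \<Longrightarrow> T0 u \<Longrightarrow> T0 (\<lambda>e. pairM (t e) (u e))"
  unfolding pairM_def by (intro S0_intros)

text \<open>Makes quantification over the components of a coded pair bounded.\<close>

lemma le_pairM: "x \<le> pairM x y" "y \<le> pairM x y"
proof -
  show "x \<le> pairM x y" unfolding pairM_def by (rule le_add_model)
  show "y \<le> pairM x y"
  proof (cases "x + y = 0")
    case True
    then have "y \<le> 0" using le_add_model(2)[of y x] by simp
    then show ?thesis by (rule order_trans) simp
  next
    case False
    then have "x + y \<le> (x + y) * (x + y)" by (intro le_mult_model) (simp add: order_less_le)
    then show ?thesis using le_add_model(2)[of y x] le_add_model(1)[of "(x + y) * (x + y)" x]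
      unfolding pairM_def by (meson order_trans)
  qed
qed

lemma expo_add: "expo b (i + k) = expo b i * expo (b :: 'a::rca_model) k"
proof (rule S0_induct[of "\<lambda>k. expo b (i + k) = expo b i * expo b k"])
  show "S0 (\<lambda>e. expo b (i + e 0) = expo b i * expo b (e 0))" by (intro S0_intros)
  show "expo b (i + 0) = expo b i * expo b 0" by (simp add: expo_zero)
  show "expo b (i + (k + 1)) = expo b i * expo b (k + 1)" if "expo b (i + k) = expo b i * expo b k" for k
    using that by (simp only: expo_succ add.assoc[symmetric] mult.assoc[symmetric])
qed

lemma expo_one: "expo b 1 = (b :: 'a::rca_model)"
  using expo_succ[of b 0] by (simp add: expo_zero)

lemma expo_pos: "0 < b \<Longrightarrow> 0 < expo (b :: 'a::rca_model) i"
proof (rule S0_induct[of "\<lambda>i. 0 < expo b i"])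
  show "S0 (\<lambda>e. 0 < expo b (e 0))" by (intro S0_intros)
qed (simp_all add: expo_zero expo_succ)

definition entryM :: "'a::rca_model \<Rightarrow> 'a \<Rightarrow> 'a \<Rightarrow> 'a \<Rightarrow> bool" where
  "entryM c b i x \<longleftrightarrow> x < b \<and> (\<exists>q r. r < expo b i \<and> c = (q * b + x) * expo b i + r)"

lemma quotient_unique:
  fixes a :: "'a::rca_model"
  assumes "a * B + r = a' * B + r'" and "r < B" and "r' < B"
  shows "a = a'"
proof -
  have less: "a * B + r < a' * B + r'" if "a < a'" "r < B" for a a' r r' :: 'a
  proof -
    have "(a + 1) * B \<le> a' * B" using that by (intro mult_right_mono) (simp_all add: less_iff_succ_le)
    then show ?thesis using that(2) differ_nonneg[of r'] unfolding lin by (simp add: algebra_simps)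
  qed
  show ?thesis using less[of a a' r r'] less[of a' a r' r] assms by (metis less_irrefl linorder_less_linear)
qed

text \<open>Division by b^i removes the lower digits, and a second division by b isolates the
  digit.\<close>

lemma entryM_unique: "entryM c b i x \<Longrightarrow> entryM c b i y \<Longrightarrow> x = y"
proof -
  assume "entryM c b i x" "entryM c b i y"
  then obtain q r q' r' where *: "(q * b + x) * expo b i + r = (q' * b + y) * expo b i + r'"
      "r < expo b i" "r' < expo b i" "x < b" "y < b"
    unfolding entryM_def by metis
  have "q * b + x = q' * b + y" by (rule quotient_unique[OF *(1-3)])
  moreover from this have "q = q'" by (rule quotient_unique) (use * in auto)
  ultimately show ?thesis by simp
qed

text \<open>Quotient and remainder do not exceed \<open>c\<close>, because x < b makes b and its
  powers positive.\<close>

lemma entryM_bounded: "entryM c b i x \<longleftrightarrow> x < b \<and>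
    (\<exists>q. q < c + 1 \<and> (\<exists>r. r < c + 1 \<and> r < expo b i \<and> c = (q * b + x) * expo b i + r))"
proof
  assume "entryM c b i x"
  then obtain q r where *: "x < b" "r < expo b i" "c = (q * b + x) * expo b i + r"
    unfolding entryM_def by metis
  have "q \<le> q * b" "q * b + x \<le> (q * b + x) * expo b i"
    using pos_model[OF *(1)] by (intro le_mult_model expo_pos; assumption)+
  then have "q \<le> c" "r \<le> c" unfolding *(3) using le_add_model by (meson order_trans)+
  then show "x < b \<and> (\<exists>q. q < c + 1 \<and> (\<exists>r. r < c + 1 \<and> r < expo b i \<and> c = (q * b + x) * expo b i + r))"
    using * basic_less_succ by (metis le_less)
qed (auto simp: entryM_def)

lemma S0_entryM: "T0 c \<Longrightarrow> T0 b \<Longrightarrow> T0 i \<Longrightarrow> T0 x \<Longrightarrow> S0 (\<lambda>e. entryM (c e) (b e) (i e) (x e))"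
  unfolding entryM_bounded
  \<comment> \<open>Under the quantifiers for q and r the four terms are read in an environment
    shifted by one and by two places.\<close>
  by (intro S0_intros T0_subst[of c "\<lambda>e i. e (Suc i)"] T0_subst[of b "\<lambda>e i. e (Suc i)"]
      T0_subst[of i "\<lambda>e i. e (Suc i)"] T0_subst[of x "\<lambda>e i. e (Suc i)"]
      T0_subst[of c "\<lambda>e i. e (Suc (Suc i))"] T0_subst[of b "\<lambda>e i. e (Suc (Suc i))"]
      T0_subst[of i "\<lambda>e i. e (Suc (Suc i))"] T0_subst[of x "\<lambda>e i. e (Suc (Suc i))"])

lemma entryM_less: "entryM c b i x \<Longrightarrow> x < b"
  by (simp add: entryM_def)

text \<open>The code is built digit by digit. Its bound b^n keeps the induction statement bounded,
  and the common bound \<open>b\<close> on the entries has to be given in advance.\<close>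

lemma seq_code:
  fixes l b :: "'a::rca_model"
  assumes S0: "S0 (\<lambda>e. Q (e 0) (e 1))"
    and ex: "\<And>i. i < l \<Longrightarrow> \<exists>x. x < b \<and> Q i x"
    and unique: "\<And>i x y. i < l \<Longrightarrow> Q i x \<Longrightarrow> Q i y \<Longrightarrow> x = y"
  shows "\<exists>c. c < expo b l \<and> (\<forall>i. i < l \<longrightarrow> (\<forall>x. entryM c b i x \<longleftrightarrow> Q i x))"
proof -
  let ?P = "\<lambda>n. n \<le> l \<longrightarrow> (\<exists>c. c < expo b n \<and> (\<forall>i. i < n \<longrightarrow> (\<forall>x. x < b \<longrightarrow> Q i x \<longrightarrow> entryM c b i x)))"
  have "?P l"
  proof (rule S0_induct[of ?P])
    show "S0 (\<lambda>e. ?P (e 0))" by (intro S0_intros S0_entryM S0_subst2[OF S0])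
    show "?P 0" by (auto simp: expo_zero basic_not_less_zero intro!: exI[of _ 0])
    show "?P (n + 1)" if IH: "?P n" for n
    proof
      assume "n + 1 \<le> l"
      then have n: "n < l" by (simp add: less_iff_succ_le)
      then obtain c where c: "c < expo b n" "\<And>i x. i < n \<Longrightarrow> x < b \<Longrightarrow> Q i x \<Longrightarrow> entryM c b i x"
        using IH by auto
      obtain y where y: "y < b" "Q n y" using ex[OF n] by blast
      \<comment> \<open>The new digit goes to position \<open>n\<close>, above the digits coded by
        \<open>c\<close>.\<close>
      let ?c = "y * expo b n + c"
      have "(y + 1) * expo b n \<le> b * expo b n"
        using y(1) by (intro mult_right_mono) (simp_all add: less_iff_succ_le)
      then have "?c < expo b (n + 1)"
        using c(1) unfolding expo_succ lin by (simp add: algebra_simps)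
      moreover have "entryM ?c b i x" if i: "i < n + 1" and x: "x < b" "Q i x" for i x
      proof (cases "i = n")
        case True
        then have "x = y" using unique[OF n] x y by blast
        moreover have "?c = (0 * b + y) * expo b n + c" by simp
        ultimately show ?thesis unfolding entryM_def True using y(1) c(1) by blast
      next
        case False
        then have "i < n" using i basic_less_succ by blast
        then obtain k where k: "n = i + (k + 1)" using basic_less_iff by blast
        obtain q r where "r < expo b i" and r: "c = (q * b + x) * expo b i + r"
          using c(2)[OF \<open>i < n\<close> x] unfolding entryM_def by blast
        moreover have "?c = ((y * expo b k + q) * b + x) * expo b i + r"
          unfolding r k expo_add expo_succ by (simp add: algebra_simps expo_one)
        ultimately show ?thesis unfolding entryM_def using x(1) by blast
      qed
      ultimately show "\<exists>c. c < expo b (n + 1) \<and>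
          (\<forall>i. i < n + 1 \<longrightarrow> (\<forall>x. x < b \<longrightarrow> Q i x \<longrightarrow> entryM c b i x))" by blast
    qed
  qed
  then obtain c where c: "c < expo b l" "\<And>i x. i < l \<Longrightarrow> x < b \<Longrightarrow> Q i x \<Longrightarrow> entryM c b i x" by blast
  have "entryM c b i x \<longleftrightarrow> Q i x" if i: "i < l" for i x
  proof -
    obtain y where "y < b" "Q i y" using ex[OF i] by blast
    then have "entryM c b i y" by (rule c(2)[OF i])
    then show ?thesis using unique[OF i] \<open>Q i y\<close> entryM_unique by metis
  qed
  then show ?thesis using c(1) by blast
qed


section \<open>The fast growing functions in a model\<close>

primrec Fg :: "nat \<Rightarrow> 'a::rca_model \<Rightarrow> 'a \<Rightarrow> bool" where
  "Fg 0 x y \<longleftrightarrow> y = x + 1"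
| "Fg (Suc h) x y \<longleftrightarrow> (\<exists>c b. entryM c b 0 x \<and> entryM c b (x + 1) y \<and>
    (\<forall>i. i < x + 1 \<longrightarrow> (\<exists>u v. entryM c b i u \<and> entryM c b (i + 1) v \<and> Fg h u v)))"

definition run :: "('a::rca_model \<Rightarrow> 'a \<Rightarrow> bool) \<Rightarrow> 'a \<Rightarrow> 'a \<Rightarrow> 'a \<Rightarrow> bool" where
  "run G n c b \<longleftrightarrow> (\<forall>i. i < n \<longrightarrow> (\<exists>u v. entryM c b i u \<and> entryM c b (i + 1) v \<and> G u v))"

lemma run_step:
  assumes "run G n c b" and "i < n" and "entryM c b (i + 1) v"
  obtains u where "entryM c b i u" "G u v"
  using assms entryM_unique unfolding run_def by metis

text \<open>What each level of the hierarchy passes on to the next. A level may be partial in a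
  model, so it is given by its graph.\<close>

locale fast =
  fixes G :: "'a::rca_model \<Rightarrow> 'a \<Rightarrow> bool"
  assumes S0_graph: "S0 (\<lambda>e. G (e 0) (e 1))"
    and above: "G x y \<Longrightarrow> x < y"
    and functional: "G x y \<Longrightarrow> G x z \<Longrightarrow> y = z"
    and increasing: "G x y \<Longrightarrow> G x' y' \<Longrightarrow> x < x' \<Longrightarrow> y < y'"
begin

text \<open>Each step adds at least 1. Consequently the last entry of a run bounds all the
  others.\<close>

lemma run_ge:
  assumes "run G n c b" and u: "entryM c b i u" and "entryM c b (i + k) v" "i + k \<le> n"
  shows "u + k \<le> v"
proof -
  let ?P = "\<lambda>k. i + k \<le> n \<longrightarrow> (\<forall>v. v < b \<longrightarrow> entryM c b (i + k) v \<longrightarrow> u + k \<le> v)"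
  have "?P k"
  proof (rule S0_induct[of ?P])
    show "S0 (\<lambda>e. ?P (e 0))" by (intro S0_intros S0_entryM)
    show "?P 0" using entryM_unique[OF u] by auto
    fix k assume IH: "?P k"
    show "?P (k + 1)"
    proof (intro impI allI)
      fix v assume *: "i + (k + 1) \<le> n" "entryM c b (i + (k + 1)) v"
      then have less: "i + k < n" by (simp add: less_iff_succ_le add.assoc)
      then obtain w where w: "entryM c b (i + k) w" "G w v"
        using run_step[OF assms(1)] * by (metis add.assoc)
      then have "u + k \<le> w" using IH less entryM_less by (meson less_imp_le)
      then show "u + (k + 1) \<le> v" using above[OF w(2)] unfolding lin by linarith
    qed
  qed
  then show ?thesis using assms(3,4) entryM_less by blast
qed

text \<open>One induction along two runs, possibly coded in different bases, serves both
  functionality (equal starts) and monotonicity (a smaller start) of the next level.\<close>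

lemma run_compare:
  assumes "run G n c b" and "run G n c' b'" and xx': "entryM c b 0 x" "entryM c' b' 0 x'"
    and "entryM c b n u" and "entryM c' b' n u'"
  shows "x = x' \<Longrightarrow> u = u'" "x < x' \<Longrightarrow> u < u'"
proof -
  let ?P = "\<lambda>k. k \<le> n \<longrightarrow> (\<forall>u. u < b \<longrightarrow> (\<forall>u'. u' < b' \<longrightarrow> entryM c b k u \<longrightarrow> entryM c' b' k u' \<longrightarrow>
    (x = x' \<longrightarrow> u = u') \<and> (x < x' \<longrightarrow> u < u')))"
  have "?P n"
  proof (rule S0_induct[of ?P])
    show "S0 (\<lambda>e. ?P (e 0))" by (intro S0_intros S0_entryM)
    show "?P 0" using entryM_unique[OF xx'(1)] entryM_unique[OF xx'(2)] by blast
    fix k assume IH: "?P k"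
    show "?P (k + 1)"
    proof (intro impI allI)
      fix u u' assume *: "k + 1 \<le> n" "entryM c b (k + 1) u" "entryM c' b' (k + 1) u'"
      then have less: "k < n" by (simp add: less_iff_succ_le)
      obtain v v' where v: "entryM c b k v" "G v u" and v': "entryM c' b' k v'" "G v' u'"
        using run_step[OF assms(1) less *(2)] run_step[OF assms(2) less *(3)] by metis
      have "(x = x' \<longrightarrow> v = v') \<and> (x < x' \<longrightarrow> v < v')"
        using IH less v v' entryM_less by (meson less_imp_le)
      then show "(x = x' \<longrightarrow> u = u') \<and> (x < x' \<longrightarrow> u < u')"
        using v v' functional increasing by blast
    qed
  qed
  then show "x = x' \<Longrightarrow> u = u'" "x < x' \<Longrightarrow> u < u'" using assms(5,6) entryM_less by blast+
qed

definition next_level :: "'a \<Rightarrow> 'a \<Rightarrow> bool" where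
  "next_level x y \<longleftrightarrow> (\<exists>c b. entryM c b 0 x \<and> entryM c b (x + 1) y \<and> run G (x + 1) c b)"

lemma next_above: "next_level x y \<Longrightarrow> x < y"
proof -
  assume "next_level x y"
  then obtain c b where *: "entryM c b 0 x" "entryM c b (x + 1) y" "run G (x + 1) c b"
    unfolding next_level_def by blast
  have "x + (x + 1) \<le> y" using run_ge[OF *(3,1), of "x + 1" y] *(2) by simp
  then show ?thesis using differ_nonneg[of x] unfolding lin by linarith
qed

lemma next_functional: "next_level x y \<Longrightarrow> next_level x z \<Longrightarrow> y = z"
  unfolding next_level_def using run_compare(1) by blast

text \<open>The run from \<open>x'\<close> is longer than that from \<open>x\<close> by at least one
  step. After x + 1 steps it is already beyond \<open>y\<close>, and every further step adds 1;
  hence the gap of 2.\<close>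

lemma next_increasing:
  assumes "next_level x y" and "next_level x' y'" and "x < x'"
  shows "y + (1 + 1) \<le> y'"
proof -
  obtain c b where *: "entryM c b 0 x" "entryM c b (x + 1) y" "run G (x + 1) c b"
    using assms(1) unfolding next_level_def by blast
  obtain c' b' where **: "entryM c' b' 0 x'" "entryM c' b' (x' + 1) y'" "run G (x' + 1) c' b'"
    using assms(2) unfolding next_level_def by blast
  obtain k where k: "x' = x + (k + 1)" using assms(3) basic_less_iff by blast
  have le: "x + 1 \<le> x' + 1" "x + 1 < x' + 1" using assms(3) by simp_all
  then obtain u where u: "entryM c' b' (x + 1) u" using **(3) unfolding run_def by blast
  have "run G (x + 1) c' b'" using **(3) le unfolding run_def by (meson less_le_trans)
  then have "y < u" using run_compare(2)[OF *(3) _ *(1) **(1) *(2) u] assms(3) by blast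
  moreover have "u + (k + 1) \<le> y'"
    using run_ge[OF **(3) u, of "k + 1" y'] **(2) k by (simp add: ac_simps)
  ultimately show ?thesis using differ_nonneg[of k] unfolding lin by linarith
qed

text \<open>Every entry of a run is at most its last entry \<open>y\<close>, so the run can be
  recoded in base y + 1 with a code below (y + 1)^(x + 2). Thus the graph is a bounded relation
  although \<open>Fgraph\<close> quantifies over arbitrary codes.\<close>

lemma next_bounded: "next_level x y \<longleftrightarrow> (\<exists>c. c < expo (y + 1) (x + 1 + 1) \<and>
    entryM c (y + 1) 0 x \<and> entryM c (y + 1) (x + 1) y \<and>
    (\<forall>i. i < x + 1 \<longrightarrow> (\<exists>u. u < y + 1 \<and> (\<exists>v. v < y + 1 \<and>
      entryM c (y + 1) i u \<and> entryM c (y + 1) (i + 1) v \<and> G u v))))"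
proof
  assume "next_level x y"
  then obtain c b where *: "entryM c b 0 x" "entryM c b (x + 1) y" "run G (x + 1) c b"
    unfolding next_level_def by blast
  have le: "u < y + 1" if u: "entryM c b i u" and i: "i < x + 1 + 1" for i u
  proof -
    obtain k where k: "x + 1 = i + k" using i basic_less_succ basic_le_iff le_less by metis
    have "u + k \<le> y" using run_ge[OF *(3) u, of k y] *(2) k by simp
    then show ?thesis using differ_nonneg[of k] unfolding lin by linarith
  qed
  have ex: "\<exists>u. entryM c b i u" if "i < x + 1 + 1" for i
  proof (cases "i = x + 1")
    case False
    then have "i < x + 1" using that basic_less_succ by blast
    then show ?thesis using *(3) unfolding run_def by blast
  qed (use *(2) in blast)
  have "\<exists>d. d < expo (y + 1) (x + 1 + 1) \<and>
      (\<forall>i. i < x + 1 + 1 \<longrightarrow> (\<forall>u. entryM d (y + 1) i u \<longleftrightarrow> entryM c b i u))"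
  proof (rule seq_code)
    show "S0 (\<lambda>e. entryM c b (e 0) (e 1))" by (intro S0_intros S0_entryM)
    show "\<exists>u. u < y + 1 \<and> entryM c b i u" if i: "i < x + 1 + 1" for i
      using ex[OF i] le[OF _ i] by blast
  qed (rule entryM_unique)
  then obtain d where "d < expo (y + 1) (x + 1 + 1)"
      and d: "\<And>i u. i < x + 1 + 1 \<Longrightarrow> entryM d (y + 1) i u \<longleftrightarrow> entryM c b i u"
    by blast
  moreover have "entryM d (y + 1) 0 x" "entryM d (y + 1) (x + 1) y"
    using d *(1,2) by (simp_all add: add_pos_pos less_iff_succ_le le_add_model)
  moreover have "\<exists>u. u < y + 1 \<and> (\<exists>v. v < y + 1 \<and>
      entryM d (y + 1) i u \<and> entryM d (y + 1) (i + 1) v \<and> G u v)" if i: "i < x + 1" for i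
  proof -
    have ii: "i < x + 1 + 1" "i + 1 < x + 1 + 1" using i unfolding lin by linarith+
    obtain u v where "entryM c b i u" "entryM c b (i + 1) v" "G u v"
      using *(3) i unfolding run_def by blast
    then show ?thesis using le d ii by blast
  qed
  ultimately show "\<exists>c. c < expo (y + 1) (x + 1 + 1) \<and>
    entryM c (y + 1) 0 x \<and> entryM c (y + 1) (x + 1) y \<and>
    (\<forall>i. i < x + 1 \<longrightarrow> (\<exists>u. u < y + 1 \<and> (\<exists>v. v < y + 1 \<and>
      entryM c (y + 1) i u \<and> entryM c (y + 1) (i + 1) v \<and> G u v)))" by blast
next
  assume "\<exists>c. c < expo (y + 1) (x + 1 + 1) \<and>
    entryM c (y + 1) 0 x \<and> entryM c (y + 1) (x + 1) y \<and>
    (\<forall>i. i < x + 1 \<longrightarrow> (\<exists>u. u < y + 1 \<and> (\<exists>v. v < y + 1 \<and>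
      entryM c (y + 1) i u \<and> entryM c (y + 1) (i + 1) v \<and> G u v)))"
  then obtain c where "entryM c (y + 1) 0 x" "entryM c (y + 1) (x + 1) y" "run G (x + 1) c (y + 1)"
    unfolding run_def by blast
  then show "next_level x y" unfolding next_level_def by blast
qed

lemma S0_next: "S0 (\<lambda>e. next_level (e 0) (e 1))"
  unfolding next_bounded by (intro S0_intros S0_entryM S0_subst2[OF S0_graph])

lemma fast_next: "fast next_level"
proof
  show "S0 (\<lambda>e. next_level (e 0) (e 1))" by (rule S0_next)
  show "next_level x y \<Longrightarrow> x < y" for x y by (rule next_above)
  show "next_level x y \<Longrightarrow> next_level x z \<Longrightarrow> y = z" for x y z by (rule next_functional)
  show "y < y'" if "next_level x y" "next_level x' y'" "x < x'" for x y x' y'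
    using next_increasing[OF that] unfolding lin by linarith
qed

end

lemma Fg_Suc: "fast (Fg h :: 'a \<Rightarrow> _) \<Longrightarrow> Fg (Suc h) = fast.next_level (Fg h :: 'a::rca_model \<Rightarrow> _)"
  by (intro ext) (simp only: fast.next_level_def run_def Fg.simps)

lemma fast_Fg: "fast (Fg h :: 'a::rca_model \<Rightarrow> _)"
proof (induction h)
  case 0
  show ?case
  proof
    show "S0 (\<lambda>e :: nat \<Rightarrow> 'a. Fg 0 (e 0) (e 1))" unfolding Fg.simps by (intro S0_intros)
  qed (auto simp: less_iff_succ_le)
next
  case (Suc h)
  then show ?case unfolding Fg_Suc[OF Suc] by (rule fast.fast_next)
qed

text \<open>This fails at level 0, where consecutive values differ by 1.\<close>

lemma Fg_Suc_increasing:
  "Fg (Suc h) x y \<Longrightarrow> Fg (Suc h) x' y' \<Longrightarrow> x < x' \<Longrightarrow> y + (1 + 1) \<le> y'"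
  using fast.next_increasing[OF fast_Fg] unfolding Fg_Suc[OF fast_Fg] by blast


section \<open>Definable functions and relations of a model\<close>

text \<open>By \<open>drel_set\<close> and \<open>set_of_drel\<close> these are the relations whose
  coded pairs form a set of the model.\<close>

definition drel :: "('a::rca_model \<Rightarrow> 'a \<Rightarrow> bool) \<Rightarrow> bool" where
  "drel R \<longleftrightarrow> S0 (\<lambda>e. R (e 0) (e 1))"

text \<open>A function enters bounded formulas through its graph only. Its values have to be named
  by bounded quantifiers, which explains the shape of the induction predicates below.\<close>

definition dfun :: "('a::rca_model \<Rightarrow> 'a) \<Rightarrow> bool" where
  "dfun f \<longleftrightarrow> drel (\<lambda>x y. f x = y)"

lemma S0_drel: "drel R \<Longrightarrow> T0 t \<Longrightarrow> T0 u \<Longrightarrow> S0 (\<lambda>e. R (t e) (u e))"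
  unfolding drel_def by (rule S0_subst2)

lemma S0_dfun: "dfun f \<Longrightarrow> T0 t \<Longrightarrow> T0 u \<Longrightarrow> S0 (\<lambda>e. f (t e) = u e)"
  unfolding dfun_def by (rule S0_drel)

lemma S0_subst3:
  assumes "S0 (\<lambda>e. Q (e 0) (e 1) (e 2))" and "T0 t" and "T0 u" and "T0 v"
  shows "S0 (\<lambda>e. Q (t e) (u e) (v e))"
proof -
  have "T0 (\<lambda>e. if i = 0 then t e else if i = 1 then u e else v e)" for i :: nat
    using assms(2-4) by (cases "i = 0"; cases "i = 1") simp_all
  from S0_subst[of _ "\<lambda>e i. if i = 0 then t e else if i = 1 then u e else v e", OF assms(1) this]
  show ?thesis by simp
qed

text \<open>A finite conjunction in the metatheory, where the indices of the relations live.\<close>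

lemma S0_ball_nat: "(\<And>j. j < i \<Longrightarrow> S0 (P j)) \<Longrightarrow> S0 (\<lambda>e. \<forall>j<i. P j e)" for i :: nat
proof (induction i)
  case (Suc i)
  have "(\<forall>j<Suc i. P j e) \<longleftrightarrow> (\<forall>j<i. P j e) \<and> P i e" for e by (auto simp: less_Suc_eq)
  then show ?case using Suc by (simp add: S0_and)
qed (simp add: S0_const)

lemma less_succ_model: "x < y + 1 \<longleftrightarrow> x \<le> (y :: 'a::rca_model)"
  unfolding basic_less_succ le_less ..

lemma S0_bex_nat: "(\<And>j. j < i \<Longrightarrow> S0 (P j)) \<Longrightarrow> S0 (\<lambda>e. \<exists>j<i. P j e)" for i :: nat
  using S0_not[OF S0_ball_nat, of i "\<lambda>j e. \<not> P j e"] by (simp add: S0_not)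

lemma bounded_ex_pair: "(\<exists>x. x < pairM a b + 1 \<and> (\<exists>y. y < pairM a b + 1 \<and> pairM a b = pairM x y \<and> R x y))
  \<longleftrightarrow> R a b"
  using le_pairM[of a b] le_pairM[where x = a and y = b] unfolding less_succ_model pairM_inject by auto

text \<open>Comprehension turns a Delta_1 relation into a set of pairs, and membership in a set is a
  bounded formula again.\<close>

lemma Delta_drel:
  fixes P Q :: "'a::rca_model \<Rightarrow> 'a \<Rightarrow> 'a \<Rightarrow> bool"
  assumes P: "S0 (\<lambda>e. P (e 0) (e 1) (e 2))" and Q: "S0 (\<lambda>e. Q (e 0) (e 1) (e 2))"
    and iff: "\<And>x y. (\<exists>w. P w x y) \<longleftrightarrow> (\<forall>w. Q w x y)"
  shows "drel (\<lambda>x y. \<exists>w. P w x y)"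
proof -
  let ?ex = "\<lambda>P w z. \<exists>x. x < z + 1 \<and> (\<exists>y. y < z + 1 \<and> z = pairM x y \<and> P w x y)"
  have "\<exists>X \<in> sets. \<forall>z. z \<in> X \<longleftrightarrow> (\<exists>w. ?ex P w z)"
  proof (rule Delta_comprehension)
    show "S0 (\<lambda>e. ?ex P (e 0) (e 1))" by (intro S0_intros S0_pairM S0_subst3[OF P])
    show "S0 (\<lambda>e. ?ex Q (e 0) (e 1))" by (intro S0_intros S0_pairM S0_subst3[OF Q])
    show "(\<exists>w. ?ex P w z) \<longleftrightarrow> (\<forall>w. ?ex Q w z)" for z
    proof (cases "\<exists>x y. z = pairM x y")
      case True
      then obtain x y where z: "z = pairM x y" by blast
      show ?thesis unfolding z bounded_ex_pair by (rule iff)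
    next
      case False
      then show ?thesis by simp
    qed
  qed
  then obtain X where "X \<in> sets" and X: "\<And>z. z \<in> X \<longleftrightarrow> (\<exists>w. ?ex P w z)" by blast
  have "S0 (\<lambda>e. pairM (e 0) (e 1) \<in> X)" by (intro S0_intros S0_pairM \<open>X \<in> sets\<close>)
  moreover have "pairM x y \<in> X \<longleftrightarrow> (\<exists>w. P w x y)" for x y unfolding X bounded_ex_pair ..
  ultimately show ?thesis unfolding drel_def by simp
qed

lemma least_number:
  assumes S0: "S0 (\<lambda>e. Q (e 0))" and "Q (x :: 'a::rca_model)"
  shows "\<exists>m. Q m \<and> (\<forall>y. y < m \<longrightarrow> \<not> Q y)"
proof (rule ccontr)
  assume none: "\<not> ?thesis"
  have "\<forall>y. y < x + 1 \<longrightarrow> \<not> Q y"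
  proof (rule S0_induct[of "\<lambda>n. \<forall>y. y < n \<longrightarrow> \<not> Q y"])
    show "S0 (\<lambda>e. \<forall>y. y < e 0 \<longrightarrow> \<not> Q y)" by (intro S0_intros S0_subst1[OF S0])
  qed (use none basic_not_less_zero basic_less_succ in blast)+
  then show False using assms(2) basic_less_succ by blast
qed

text \<open>The order of the values is a decidable relation of the arguments, and a definable order of an
  initial segment has a largest element. This replaces collection.\<close>

lemma running_maximum:
  fixes f :: "'a::rca_model \<Rightarrow> 'a"
  assumes f: "dfun f"
  obtains M where "dfun M" "\<And>m n. m \<le> n \<Longrightarrow> f m \<le> M n" "\<And>n. \<exists>m. m \<le> n \<and> M n = f m"
proof -
  \<comment> \<open>\<open>w\<close> bounds both values. Quantified existentially in
    \<open>?P\<close> or universally in \<open>?Q\<close>, it expresses the same comparison, which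
    is therefore Delta_1.\<close>
  let ?P = "\<lambda>w m n. \<exists>u. u < w + 1 \<and> (\<exists>v. v < w + 1 \<and> f m = u \<and> f n = v \<and> u \<le> v)"
  let ?Q = "\<lambda>w m n. \<forall>u. u < w + 1 \<longrightarrow> (\<forall>v. v < w + 1 \<longrightarrow> f m = u \<longrightarrow> f n = v \<longrightarrow> u \<le> v)"
  have P: "(\<exists>w. ?P w m n) \<longleftrightarrow> f m \<le> f n" for m n
    by (auto simp: less_succ_model intro!: exI[of _ "max (f m) (f n)"])
  have Q: "(\<forall>w. ?Q w m n) \<longleftrightarrow> f m \<le> f n" for m n
    by (auto simp: less_succ_model dest!: spec[of _ "max (f m) (f n)"])
  have "drel (\<lambda>m n. \<exists>w. ?P w m n)"
  proof (rule Delta_drel)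
    show "S0 (\<lambda>e. ?P (e 0) (e 1) (e 2))" by (intro S0_intros S0_dfun[OF f])
    show "S0 (\<lambda>e. ?Q (e 0) (e 1) (e 2))" by (intro S0_intros S0_dfun[OF f])
  qed (simp only: P Q)
  then have le: "drel (\<lambda>m n. f m \<le> f n)" unfolding P .
  \<comment> \<open>The search is among arguments, which are bounded by \<open>n\<close>, since no
    bound on the values is known yet.\<close>
  have ex: "\<exists>m. m < n + 1 \<and> (\<forall>i. i < n + 1 \<longrightarrow> f i \<le> f m)" for n
  proof (rule S0_induct[of "\<lambda>n. \<exists>m. m < n + 1 \<and> (\<forall>i. i < n + 1 \<longrightarrow> f i \<le> f m)"])
    show "S0 (\<lambda>e. \<exists>m. m < e 0 + 1 \<and> (\<forall>i. i < e 0 + 1 \<longrightarrow> f i \<le> f m))"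
      by (intro S0_basic_intros S0_drel[OF le])
    show "\<exists>m. m < 0 + 1 \<and> (\<forall>i. i < 0 + 1 \<longrightarrow> f i \<le> f m)"
      unfolding less_succ_model by (intro exI[of _ 0]) (auto dest: order_antisym)
    show "\<exists>m. m < n + 1 + 1 \<and> (\<forall>i. i < n + 1 + 1 \<longrightarrow> f i \<le> f m)"
      if IH: "\<exists>m. m < n + 1 \<and> (\<forall>i. i < n + 1 \<longrightarrow> f i \<le> f m)" for n
    proof -
      obtain m where m: "m < n + 1" "\<And>i. i < n + 1 \<Longrightarrow> f i \<le> f m" using IH by blast
      show ?thesis
      proof (cases "f m \<le> f (n + 1)")
        case True
        then show ?thesis using m(2)
          by (intro exI[of _ "n + 1"]) (auto simp: basic_less_succ[of _ "n + 1"] intro: order_trans)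
      next
        case False
        then show ?thesis using m
          by (intro exI[of _ m]) (auto simp: basic_less_succ[of _ "n + 1"] intro: less_imp_le)
      qed
    qed
  qed
  then obtain top where top: "\<And>n. top n \<le> n" "\<And>n i. i \<le> n \<Longrightarrow> f i \<le> f (top n)"
    unfolding less_succ_model by metis
  have "f (top n) = y \<longleftrightarrow> (\<exists>m. m < n + 1 \<and> f m = y \<and> (\<forall>i. i < n + 1 \<longrightarrow> f i \<le> f m))" for n y
    unfolding less_succ_model using top by (metis order_antisym)
  then have "dfun (\<lambda>n. f (top n))"
    unfolding dfun_def drel_def by (simp only:) (intro S0_basic_intros S0_drel[OF le] S0_dfun[OF f])
  with top that[of "\<lambda>n. f (top n)"] show thesis by blast
qed

lemma increasing_ge:
  assumes f: "dfun f" and inc: "\<And>n m. n < m \<Longrightarrow> f n < f m"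
  shows "n \<le> (f n :: 'a::rca_model)"
proof -
  \<comment> \<open>A bounded form of the claim: \<open>f n\<close> avoids all numbers below
    \<open>n\<close>.\<close>
  have "\<forall>v. v < n \<longrightarrow> f n \<noteq> v"
  proof (rule S0_induct[of "\<lambda>n. \<forall>v. v < n \<longrightarrow> f n \<noteq> v"])
    show "S0 (\<lambda>e. \<forall>v. v < e 0 \<longrightarrow> f (e 0) \<noteq> v)" by (intro S0_intros S0_dfun[OF f])
    show "\<forall>v. v < 0 \<longrightarrow> f 0 \<noteq> v" by (simp add: basic_not_less_zero)
    fix n assume "\<forall>v. v < n \<longrightarrow> f n \<noteq> v"
    then have "n \<le> f n" using not_less by blast
    then have "n + 1 \<le> f (n + 1)" using inc basic_less_succ less_iff_succ_le le_less_trans by metis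
    then show "\<forall>v. v < n + 1 \<longrightarrow> f (n + 1) \<noteq> v" using not_less by blast
  qed
  then show ?thesis using not_less by blast
qed


section \<open>The principles in a model\<close>

definition weighted :: "('a::rca_model \<Rightarrow> 'a) \<Rightarrow> nat \<Rightarrow> (nat \<Rightarrow> 'a \<Rightarrow> 'a \<Rightarrow> bool) \<Rightarrow> (nat \<Rightarrow> 'a \<Rightarrow> 'a) \<Rightarrow> bool" where
  "weighted F k R g \<longleftrightarrow> (\<forall>i<k. drel (R i) \<and> dfun (g i) \<and>
    (\<forall>x y. R i x y \<longrightarrow> g i x < g i y) \<and> (\<forall>n. g i n < F n))"

definition bounded_growth :: "('a::rca_model \<Rightarrow> 'a) \<Rightarrow> ('a \<Rightarrow> 'a) \<Rightarrow> bool" where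
  "bounded_growth F f \<longleftrightarrow> (\<forall>n. f (n + 1) < F (f n))"

definition closure_thm :: "('a::rca_model \<Rightarrow> 'a) \<Rightarrow> nat \<Rightarrow> bool" where
  "closure_thm F k \<longleftrightarrow> (\<forall>R g f. weighted F k R g \<and> dfun f \<and> bounded_growth F f \<longrightarrow>
    \<not> (\<forall>n m. n < m \<longrightarrow> (\<exists>i<k. R i (f m) (f n))))"

definition tc :: "('a::rca_model \<Rightarrow> 'a \<Rightarrow> bool) \<Rightarrow> 'a \<Rightarrow> 'a \<Rightarrow> bool" where
  "tc R x y \<longleftrightarrow> (\<exists>l c b. entryM c b 0 x \<and> entryM c b (l + 1) y \<and> run R (l + 1) c b)"

definition termination_thm :: "('a::rca_model \<Rightarrow> 'a) \<Rightarrow> nat \<Rightarrow> bool" where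
  "termination_thm F k \<longleftrightarrow> (\<forall>T f R g. drel T \<and> (\<forall>x y z. T y x \<and> T z x \<longrightarrow> y = z) \<and> dfun f \<and>
    (\<forall>x y. T y x \<longrightarrow> (\<exists>n. f n = x \<and> f (n + 1) = y)) \<and> bounded_growth F f \<and> weighted F k R g \<and>
    (\<forall>x y. tc T x y \<longrightarrow> (\<exists>i<k. R i x y)) \<longrightarrow>
    \<not> (\<exists>s. dfun s \<and> (\<forall>n. T (s (n + 1)) (s n))))"

definition large_chain :: "('a::rca_model \<Rightarrow> 'a) \<Rightarrow> ('a \<Rightarrow> 'a \<Rightarrow> bool) \<Rightarrow> 'a \<Rightarrow> 'a \<Rightarrow> 'a \<Rightarrow> bool" where
  "large_chain f C c b l \<longleftrightarrow> (\<forall>p. p < l \<longrightarrow> (\<exists>n. entryM c b p (f n))) \<and>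
    (\<forall>p. p + 1 < l \<longrightarrow> (\<exists>u v. entryM c b p u \<and> entryM c b (p + 1) v \<and> u < v \<and> C u v)) \<and>
    (\<exists>m. entryM c b 0 m \<and> m < l)"

text \<open>The index of the chain is unrestricted because a single element has no colour.
  \<open>not_homogeneous\<close> puts \<open>i < k\<close> into its relations to compensate.\<close>

definition homogeneous_thm :: "('a::rca_model \<Rightarrow> 'a) \<Rightarrow> nat \<Rightarrow> bool" where
  "homogeneous_thm F k \<longleftrightarrow> (\<forall>f C. dfun f \<and> (\<forall>n m. n < m \<longrightarrow> f n < f m) \<and> bounded_growth F f \<and>
    (\<forall>i<k. drel (C i)) \<and> (\<forall>n m. n < m \<longrightarrow> (\<exists>!i. i < k \<and> C i (f n) (f m))) \<longrightarrow>
    (\<exists>i c b l. large_chain f (C i) c b l))"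

text \<open>Control by the successor allows only f(n + 1) <= f(n), and equality is excluded because
  some weight drops. A strict descent cannot last longer than its first value.\<close>

lemma closure_thm_succ: "closure_thm (\<lambda>x. x + 1) k"
  unfolding closure_thm_def
proof (intro allI impI notI, elim conjE)
  fix R g and f :: "'a \<Rightarrow> 'a"
  assume w: "weighted (\<lambda>x. x + 1) k R g" and f: "dfun f" and growth: "bounded_growth (\<lambda>x. x + 1) f"
    and desc: "\<forall>n m. n < m \<longrightarrow> (\<exists>i<k. R i (f m) (f n))"
  have less: "f (n + 1) < f n" for n
  proof -
    obtain i where "i < k" "R i (f (n + 1)) (f n)" using desc basic_less_succ by blast
    then have "g i (f (n + 1)) < g i (f n)" using w unfolding weighted_def by blast
    then have "f (n + 1) \<noteq> f n" by auto
    then show ?thesis using growth basic_less_succ unfolding bounded_growth_def by metis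
  qed
  let ?P = "\<lambda>n. \<exists>v. v < f 0 + 1 \<and> f n = v \<and> v + n \<le> f 0"
  have "?P (f 0 + 1)"
  proof (rule S0_induct[of ?P])
    show "S0 (\<lambda>e. ?P (e 0))" by (intro S0_intros S0_dfun[OF f])
    show "?P 0" by (simp add: less_succ_model)
    fix n assume "?P n"
    then have "f n + n \<le> f 0" by blast
    then have "f (n + 1) + (n + 1) \<le> f 0" using less[of n] unfolding lin by linarith
    then show "?P (n + 1)" using le_add_model(1) less_succ_model order_trans by metis
  qed
  then have "f (f 0 + 1) + (f 0 + 1) \<le> f 0" by blast
  then show False using differ_nonneg[of "f (f 0 + 1)"] unfolding lin by linarith
qed

locale growth =
  fixes F :: "'a::rca_model \<Rightarrow> 'a"
  assumes F: "dfun F" and above: "x < F x" and mono: "x < y \<Longrightarrow> F x < F y"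
begin

lemma mono_le: "x \<le> y \<Longrightarrow> F x \<le> F y"
  using mono le_less by metis

lemma closure_imp_termination:
  assumes "closure_thm F k"
  shows "termination_thm F k"
  unfolding termination_thm_def
proof (intro allI impI notI, elim conjE exE)
  fix T f R g s
  assume w: "weighted F k R g" and growth: "bounded_growth F f"
    and T: "\<forall>x y. T y x \<longrightarrow> (\<exists>n. f n = x \<and> f (n + 1) = y)"
    and sub: "\<forall>x y. tc T x y \<longrightarrow> (\<exists>i<k. R i x y)"
    and s: "dfun s" and desc: "\<forall>n. T (s (n + 1)) (s n)"
  \<comment> \<open>The maximum of \<open>s\<close> up to \<open>m\<close> bounds the entries of the
    path coded below.\<close>
  obtain M where M: "\<And>m n. m \<le> n \<Longrightarrow> s m \<le> M n" using running_maximum[OF s] by metis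
  have "tc T (s m) (s n)" if nm: "n < m" for n m
  proof -
    obtain l where l: "m = n + (l + 1)" using nm basic_less_iff by blast
    \<comment> \<open>The path from \<open>s m\<close> to \<open>s n\<close> lists \<open>s\<close>
      backwards; \<open>i + j = m\<close> expresses the reversal without subtraction.\<close>
    let ?Q = "\<lambda>i x. \<exists>j. j < m + 1 \<and> i + j = m \<and> s j = x"
    have "\<exists>c. c < expo (M m + 1) (l + 1 + 1) \<and>
      (\<forall>i. i < l + 1 + 1 \<longrightarrow> (\<forall>x. entryM c (M m + 1) i x \<longleftrightarrow> ?Q i x))"
    proof (rule seq_code)
      show "S0 (\<lambda>e. ?Q (e 0) (e 1))" by (intro S0_intros S0_dfun[OF s])
      show "\<exists>x. x < M m + 1 \<and> ?Q i x" if "i < l + 1 + 1" for i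
      proof -
        have "i \<le> m" using that differ_nonneg[of n] unfolding l lin by linarith
        then obtain j where "m = i + j" using basic_le_iff by blast
        then have "i + j = m" "j \<le> m" using le_add_model by auto
        then show ?thesis using M less_succ_model by metis
      qed
      show "x = y" if xy: "?Q i x" "?Q i y" for i x y
      proof -
        obtain j j' where "i + j = m" "s j = x" "i + j' = m" "s j' = y" using xy by blast
        then show ?thesis using add_left_cancel[of i j j'] by simp
      qed
    qed
    then obtain c where c: "\<And>i x. i < l + 1 + 1 \<Longrightarrow> entryM c (M m + 1) i x \<longleftrightarrow> ?Q i x" by blast
    have ent: "entryM c (M m + 1) i (s j)" if "i < l + 1 + 1" "i + j = m" for i j
      using c[OF that(1)] that(2) le_add_model(2)[of j i] less_succ_model by metis
    have "entryM c (M m + 1) 0 (s m)" by (rule ent) (simp_all add: less_succ_model)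
    moreover have "entryM c (M m + 1) (l + 1) (s n)"
      by (rule ent) (simp_all add: less_succ_model l add.commute)
    moreover have "run T (l + 1) c (M m + 1)"
      unfolding run_def
    proof (intro allI impI)
      fix i assume i: "i < l + 1"
      then have "i + 1 \<le> m" using differ_nonneg[of n] unfolding l lin by linarith
      then obtain j where "m = i + 1 + j" using basic_le_iff by blast
      then have j: "i + (j + 1) = m" "(i + 1) + j = m" by (simp_all add: ac_simps)
      have "entryM c (M m + 1) i (s (j + 1))" using i j(1) by (intro ent) (auto simp: basic_less_succ)
      moreover have "entryM c (M m + 1) (i + 1) (s j)" using i j(2) by (intro ent) auto
      ultimately show "\<exists>u v. entryM c (M m + 1) i u \<and> entryM c (M m + 1) (i + 1) v \<and> T u v"
        using desc by blast
    qed
    ultimately show ?thesis unfolding tc_def by blast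
  qed
  then have "\<forall>n m. n < m \<longrightarrow> (\<exists>i<k. R i (s m) (s n))" using sub by blast
  \<comment> \<open>Two consecutive values of \<open>s\<close> are consecutive values of
    \<open>f\<close>, so the control is inherited.\<close>
  moreover have "bounded_growth F s"
    using desc T growth unfolding bounded_growth_def by metis
  ultimately show False using assms w s unfolding closure_thm_def by blast
qed

end


section \<open>Weights obtained from the absence of large chains\<close>

context growth
begin

lemma closure_imp_homogeneous:
  assumes closure: "closure_thm F k"
  shows "homogeneous_thm F k"
  unfolding homogeneous_thm_def
proof (intro allI impI, elim conjE, rule ccontr)
  fix f C
  assume f: "dfun f" and inc: "\<forall>n m. n < m \<longrightarrow> f n < f m" and growth: "bounded_growth F f"
    and C: "\<forall>i<k. drel (C i)" and colour: "\<forall>n m. n < m \<longrightarrow> (\<exists>!i. i < k \<and> C i (f n) (f m))"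
    and none: "\<not> (\<exists>i c b l. large_chain f (C i) c b l)"
  have ge: "n \<le> f n" for n using increasing_ge[OF f] inc by blast
  \<comment> \<open>An increasing function takes the value \<open>x\<close> at most at arguments up
    to \<open>x\<close>, so its range is a bounded predicate.\<close>
  define rng where "rng x \<longleftrightarrow> (\<exists>n. n < x + 1 \<and> f n = x)" for x
  have rng: "rng (f n)" for n unfolding rng_def less_succ_model using ge by blast
  have rngD: "\<exists>n. x = f n" if "rng x" for x using that unfolding rng_def by blast
  have S0_rng: "S0 (\<lambda>e. rng (t e))" if t: "T0 t" for t
  proof (rule S0_subst1[OF _ t])
    show "S0 (\<lambda>e. rng (e 0))" unfolding rng_def by (intro S0_intros S0_dfun[OF f])
  qed
  \<comment> \<open>The larger element is placed below the smaller one, so that the increasing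
    \<open>f\<close> is decreasing for the relations.\<close>
  define R where "R i y x \<longleftrightarrow> x < y \<and> C i x y \<and> rng x \<and> rng y" for i x y
  have R: "drel (R i)" if "i < k" for i
  proof -
    have Ci: "drel (C i)" using C that by blast
    show ?thesis unfolding drel_def R_def by (intro S0_intros S0_drel[OF Ci] S0_rng)
  qed
  \<comment> \<open>A chain of l + 1 elements from \<open>y\<close> up to \<open>x\<close>; its
    elements are at most \<open>x\<close>, whence the base x + 1.\<close>
  define chain where "chain i x y l c \<longleftrightarrow> entryM c (x + 1) 0 y \<and> entryM c (x + 1) l x \<and>
    (\<forall>p. p < l \<longrightarrow> (\<exists>u. u < x + 1 \<and> (\<exists>w. w < x + 1 \<and>
      entryM c (x + 1) p u \<and> entryM c (x + 1) (p + 1) w \<and> R i w u)))" for i x y l c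
  \<comment> \<open>\<open>v\<close> is the least element of such a chain minus the number of its
    elements. All quantifiers are bounded in terms of \<open>x\<close>.\<close>
  define B where "B i x v \<longleftrightarrow> (\<exists>y. y < x + 1 \<and> (\<exists>l. l < x + 1 \<and> v + l + 1 = y \<and>
    (\<exists>c. c < expo (x + 1) (l + 1) \<and> chain i x y l c)))" for i x v
  \<comment> \<open>Otherwise the chain would be 1-large. So the difference described by
    \<open>B\<close> is never negative.\<close>
  have short: "l + 1 \<le> y" if x: "rng x" and ch: "chain i x y l c" for i x y l c
  proof (rule ccontr)
    assume "\<not> l + 1 \<le> y"
    have "large_chain f (C i) c (x + 1) (l + 1)"
      unfolding large_chain_def
    proof (intro conjI allI impI)
      fix p
      show "\<exists>n. entryM c (x + 1) p (f n)" if "p < l + 1"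
      proof (cases "p = l")
        case True
        then show ?thesis using ch rngD[OF x] unfolding chain_def by blast
      next
        case False
        then have "p < l" using that basic_less_succ by blast
        then obtain u where "entryM c (x + 1) p u" "rng u" using ch unfolding chain_def R_def by blast
        then show ?thesis using rngD by blast
      qed
      show "\<exists>u v. entryM c (x + 1) p u \<and> entryM c (x + 1) (p + 1) v \<and> u < v \<and> C i u v" if "p + 1 < l + 1"
      proof -
        have "p < l" using that by simp
        then show ?thesis using ch unfolding chain_def R_def by blast
      qed
    next
      show "\<exists>m. entryM c (x + 1) 0 m \<and> m < l + 1"
        using ch \<open>\<not> l + 1 \<le> y\<close> unfolding chain_def not_le by blast
    qed
    then show False using none by blast
  qed
  have BI: "B i x v" if x: "rng x" and ch: "chain i x y l c" and c: "c < expo (x + 1) (l + 1)"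
    and v: "v + l + 1 = y" for i x y l c v
  proof -
    have y: "y < x + 1" using ch entryM_less unfolding chain_def by blast
    have "l + 1 \<le> y" by (rule short[OF x ch])
    then have "l < x + 1" using y unfolding lin by linarith
    then show ?thesis unfolding B_def using y v c ch by blast
  qed
  \<comment> \<open>The one-element chain is a candidate. That x > 0 follows from
    \<open>short\<close>, since {0} would be 1-large.\<close>
  have start: "\<exists>v. B i x v" if x: "rng x" for i x
  proof -
    have "\<exists>c. c < expo (x + 1) (0 + 1) \<and> (\<forall>p. p < 0 + 1 \<longrightarrow> (\<forall>z. entryM c (x + 1) p z \<longleftrightarrow> z = x))"
    proof (rule seq_code)
      show "S0 (\<lambda>e. e 1 = x)" by (intro S0_intros)
    qed (auto simp: less_succ_model)
    then obtain c where c: "c < expo (x + 1) (0 + 1)" "entryM c (x + 1) 0 x"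
      by (metis add_0 zero_less_one)
    then have ch: "chain i x x 0 c" unfolding chain_def by (simp add: basic_not_less_zero)
    have "0 + 1 \<le> x" by (rule short[OF x ch])
    then obtain v where "x = 0 + 1 + v" using basic_le_iff by blast
    then have "v + 0 + 1 = x" by (simp add: add.commute)
    then show ?thesis using BI[OF x ch c(1)] by blast
  qed
  \<comment> \<open>Appending \<open>y\<close> keeps the least element and adds one element, so the
    difference drops by 1.\<close>
  have extend: "\<exists>v'. v' < v \<and> B i y v'" if Ryx: "R i y x" and "B i x v" for i x y v
  proof -
    obtain z l c where ch: "chain i x z l c" and v: "v + l + 1 = z"
      using \<open>B i x v\<close> unfolding B_def by blast
    have xy: "x < y" and rng: "rng y" using Ryx unfolding R_def by blast+
    let ?Q = "\<lambda>p u. (p < l + 1 \<and> entryM c (x + 1) p u) \<or> (p = l + 1 \<and> u = y)"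
    have ex: "\<exists>u. u < y + 1 \<and> ?Q p u" if p: "p < l + 1 + 1" for p
    proof -
      consider "p < l" | "p = l" | "p = l + 1" using p unfolding basic_less_succ by blast
      then obtain u where u: "?Q p u"
      proof cases
        case 1
        then obtain u where "entryM c (x + 1) p u" using ch unfolding chain_def by blast
        moreover have "p < l + 1" using 1 by (simp add: basic_less_succ)
        ultimately show thesis using that by blast
      next
        case 2
        then have "p < l + 1" "entryM c (x + 1) p x"
          using ch unfolding chain_def by (simp_all add: basic_less_succ)
        then show thesis using that by blast
      next
        case 3
        then show thesis using that[of y] by blast
      qed
      moreover have "u < y + 1"
      proof (cases "u = y")
        case False
        then have "u < x + 1" using u entryM_less by blast
        then show ?thesis using xy unfolding lin by linarith
      qed (simp add: basic_less_succ)
      ultimately show ?thesis by blast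
    qed
    have "\<exists>d. d < expo (y + 1) (l + 1 + 1) \<and>
      (\<forall>p. p < l + 1 + 1 \<longrightarrow> (\<forall>u. entryM d (y + 1) p u \<longleftrightarrow> ?Q p u))"
    proof (rule seq_code)
      show "S0 (\<lambda>e. ?Q (e 0) (e 1))" by (intro S0_intros S0_entryM)
      show "\<exists>u. u < y + 1 \<and> ?Q p u" if "p < l + 1 + 1" for p using that by (rule ex)
      show "u = u'" if "?Q p u" "?Q p u'" for p u u' using that entryM_unique by blast
    qed
    then obtain d where d: "d < expo (y + 1) (l + 1 + 1)"
        "\<And>p u. p < l + 1 + 1 \<Longrightarrow> entryM d (y + 1) p u \<longleftrightarrow> ?Q p u" by blast
    have "0 < l + 1 + 1" "0 < l + 1" "l + 1 < l + 1 + 1"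
      using differ_nonneg[of l] unfolding lin by linarith+
    then have ends: "entryM d (y + 1) 0 z" "entryM d (y + 1) (l + 1) y"
      using ch d(2)[of 0 z] d(2)[of "l + 1" y] unfolding chain_def by simp_all
    have "\<exists>u. u < y + 1 \<and> (\<exists>w. w < y + 1 \<and> entryM d (y + 1) p u \<and> entryM d (y + 1) (p + 1) w \<and> R i w u)"
      if p: "p < l + 1" for p
    proof -
      have pp: "p < l + 1 + 1" "p + 1 < l + 1 + 1" using p unfolding lin by linarith+
      have "\<exists>u w. ?Q p u \<and> ?Q (p + 1) w \<and> R i w u"
      proof (cases "p = l")
        case True
        then have "?Q p x" "?Q (p + 1) y" using ch p unfolding chain_def by simp_all
        then show ?thesis using Ryx by blast
      next
        case False
        then have "p < l" using p basic_less_succ by blast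
        then obtain u w where "entryM c (x + 1) p u" "entryM c (x + 1) (p + 1) w" "R i w u"
          using ch unfolding chain_def by blast
        moreover from \<open>p < l\<close> have "p + 1 < l + 1" by simp
        ultimately show ?thesis using p by blast
      qed
      then obtain u w where "entryM d (y + 1) p u" "entryM d (y + 1) (p + 1) w" "R i w u"
        using d(2)[OF pp(1)] d(2)[OF pp(2)] by blast
      then show ?thesis using entryM_less by blast
    qed
    then have ch': "chain i y z (l + 1) d" unfolding chain_def using ends by blast
    have "l + 1 + 1 \<le> z" by (rule short[OF rng ch'])
    then obtain v' where v': "z = l + 1 + 1 + v'" using basic_le_iff by blast
    then have "v' + (l + 1) + 1 = z" by (simp add: ac_simps)
    then have "B i y v'" by (rule BI[OF rng ch' d(1)])
    moreover have "v' < v" using v v' unfolding lin by linarith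
    ultimately show ?thesis by blast
  qed
  have B: "drel (B i)" if i: "i < k" for i
    unfolding drel_def B_def chain_def
    by (intro S0_intros S0_entryM S0_drel[OF R[OF i]])
  \<comment> \<open>Outside the range the weight is 0 by default, which does no harm because
    \<open>R i\<close> relates elements of the range only.\<close>
  define G where "G i x v \<longleftrightarrow> (rng x \<and> B i x v \<and> (\<forall>u. u < v \<longrightarrow> \<not> B i x u)) \<or> (\<not> rng x \<and> v = 0)" for i x v
  have G_ex: "\<exists>v. G i x v" if i: "i < k" for i x
  proof (cases "rng x")
    case True
    then obtain v where "B i x v" using start by blast
    moreover have "S0 (\<lambda>e. B i x (e 0))" by (intro S0_intros S0_drel[OF B[OF i]])
    ultimately show ?thesis using least_number[of "B i x" v] True unfolding G_def by blast
  qed (auto simp: G_def)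
  have G_unique: "v = v'" if "G i x v" "G i x v'" for i x v v'
    using that unfolding G_def by (metis linorder_less_linear)
  define g where "g i x = (SOME v. G i x v)" for i x
  have g: "g i x = v \<longleftrightarrow> G i x v" if "i < k" for i x v
    using G_ex[OF that, of x] G_unique unfolding g_def by (metis someI)
  have "weighted F k R g"
    unfolding weighted_def
  proof (intro allI impI conjI)
    fix i assume i: "i < k"
    show "drel (R i)" by (rule R[OF i])
    show "dfun (g i)" unfolding dfun_def drel_def g[OF i] G_def
      by (intro S0_intros S0_rng S0_drel[OF B[OF i]])
    show "g i y < g i x" if "R i y x" for x y
    proof -
      have rng: "rng x" "rng y" using that unfolding R_def by blast+
      have Gx: "G i x (g i x)" and Gy: "G i y (g i y)" using g[OF i] by blast+
      have "B i x (g i x)" using Gx rng(1) unfolding G_def by blast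
      then obtain v where "v < g i x" "B i y v" using extend[OF \<open>R i y x\<close>] by blast
      moreover have "\<not> v < g i y" using Gy rng(2) \<open>B i y v\<close> unfolding G_def by blast
      ultimately show ?thesis by (meson le_less_trans not_less)
    qed
    show "g i n < F n" for n
    proof -
      have "G i n (g i n)" using g[OF i] by blast
      then have "g i n \<le> n"
        unfolding G_def B_def
      proof (elim disjE conjE exE)
        fix y l c
        assume "y < n + 1" "g i n + l + 1 = y"
        then show "g i n \<le> n" using differ_nonneg[of l] unfolding lin by linarith
      qed simp
      then show ?thesis using above le_less_trans by blast
    qed
  qed
  moreover have "\<exists>i<k. R i (f m) (f n)" if nm: "n < m" for n m
  proof -
    obtain i where "i < k" "C i (f n) (f m)" using colour nm by blast
    moreover have "f n < f m" using inc nm by blast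
    ultimately show ?thesis using rng unfolding R_def by blast
  qed
  ultimately show False using closure f growth unfolding closure_thm_def by blast
qed

end

text \<open>Padding the running maximum of the sequence makes it increasing without giving up control.
  The subsequence of its records would not do, because its enumeration need not be total.\<close>

locale padded = growth F for F :: "'a::rca_model \<Rightarrow> 'a" +
  fixes k :: nat and R :: "nat \<Rightarrow> 'a \<Rightarrow> 'a \<Rightarrow> bool" and g :: "nat \<Rightarrow> 'a \<Rightarrow> 'a" and f M :: "'a \<Rightarrow> 'a"
  assumes mono2: "x < y \<Longrightarrow> F x + (1 + 1) \<le> F y"
    and weights: "weighted F k R g" and f: "dfun f" and f_growth: "bounded_growth F f"
    and desc: "n < m \<Longrightarrow> \<exists>i<k. R i (f m) (f n)"
    and M: "dfun M" and f_le_M: "m \<le> n \<Longrightarrow> f m \<le> M n" and M_attained: "\<exists>m. m \<le> n \<and> M n = f m"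
begin

definition pad :: "'a \<Rightarrow> 'a" where "pad n = F (M n) + n"

lemma dfun_pad: "dfun pad"
proof -
  have "pad n = y \<longleftrightarrow> (\<exists>u. u < y + 1 \<and> (\<exists>v. v < y + 1 \<and> M n = u \<and> F u = v \<and> v + n = y))" for n y
    unfolding pad_def less_succ_model
    using le_add_model(1)[of "F (M n)" n] above[of "M n"] by (auto intro: order_trans less_imp_le)
  then show ?thesis unfolding dfun_def drel_def
    by (simp only:) (intro S0_intros S0_dfun[OF M] S0_dfun[OF F])
qed

lemma M_mono: "n \<le> m \<Longrightarrow> M n \<le> M m"
  using M_attained f_le_M order_trans by metis

lemma pad_increasing: "n < m \<Longrightarrow> pad n < pad m"
  unfolding pad_def using mono_le[OF M_mono] by (intro add_le_less_mono) (auto intro: less_imp_le)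

lemma pad_inject: "pad n = pad m \<longleftrightarrow> n = m"
  using pad_increasing by (metis less_irrefl linorder_less_linear)

lemma le_pad: "n \<le> pad n" "f n \<le> pad n" "F (f n) \<le> pad n"
proof -
  show "n \<le> pad n" unfolding pad_def by (rule le_add_model)
  show *: "F (f n) \<le> pad n"
    unfolding pad_def using mono_le[OF f_le_M[of n n]] le_add_model(1) order_trans by blast
  show "f n \<le> pad n" using above[of "f n"] * by simp
qed

text \<open>Each unit added to the argument raises the value by at least 1. The last value F(a + d)
  bounds those met in the induction.\<close>

lemma F_add: "F a + d \<le> F (a + d)"
proof -
  let ?P = "\<lambda>n. n \<le> d \<longrightarrow> (\<exists>z. z < F (a + d) + 1 \<and> F (a + n) = z \<and> F a + n \<le> z)"
  have "?P d"
  proof (rule S0_induct[of ?P])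
    show "S0 (\<lambda>e. ?P (e 0))" by (intro S0_intros S0_dfun[OF F])
    show "?P 0" using mono_le[OF le_add_model(1)] by (simp add: less_succ_model)
    fix n assume IH: "?P n"
    show "?P (n + 1)"
    proof
      assume n: "n + 1 \<le> d"
      then have "n \<le> d" by (simp add: less_iff_succ_le[symmetric])
      then have "F a + n \<le> F (a + n)" using IH by blast
      moreover have "F (a + n) < F (a + (n + 1))" by (rule mono) (simp add: basic_less_succ)
      ultimately have "F a + (n + 1) \<le> F (a + (n + 1))" unfolding lin by linarith
      moreover have "F (a + (n + 1)) \<le> F (a + d)" using n by (intro mono_le add_left_mono)
      ultimately show "\<exists>z. z < F (a + d) + 1 \<and> F (a + (n + 1)) = z \<and> F a + (n + 1) \<le> z"
        unfolding less_succ_model by blast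
    qed
  qed
  then show ?thesis by blast
qed

text \<open>A new maximum is f(n + 1) < F(f n) <= F(M n). An old one is at most M n, and F lies
  above the identity.\<close>

lemma M_growth: "M (n + 1) < F (M n)"
proof -
  obtain m where m: "m \<le> n + 1" "M (n + 1) = f m" using M_attained by blast
  show ?thesis
  proof (cases "m = n + 1")
    case True
    have "f (n + 1) < F (f n)" using f_growth unfolding bounded_growth_def by blast
    also have "\<dots> \<le> F (M n)" by (intro mono_le f_le_M) simp
    finally show ?thesis using m True by simp
  next
    case False
    then have "m \<le> n" using m(1) less_succ_model by (metis le_less)
    then show ?thesis using m(2) f_le_M above le_less_trans by metis
  qed
qed

text \<open>F(M(n+1)) + n + 1 lies below F(M(n+1) + 1) + n by the gap of 2: one unit pays for the
  growing summand and one for strictness. Then \<open>F_add\<close> moves n into the argument, which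
  is at most F(M n) + n = pad n by \<open>M_growth\<close>.\<close>

lemma pad_growth: "bounded_growth F pad"
  unfolding bounded_growth_def
proof
  fix n
  have "M (n + 1) + 1 + n \<le> F (M n) + n" using M_growth[of n] by (simp add: less_iff_succ_le)
  then have "F (M (n + 1) + 1 + n) \<le> F (pad n)" unfolding pad_def by (rule mono_le)
  moreover have "F (M (n + 1) + 1) + n \<le> F (M (n + 1) + 1 + n)" by (rule F_add)
  moreover have "F (M (n + 1)) + (1 + 1) \<le> F (M (n + 1) + 1)" by (rule mono2) (simp add: basic_less_succ)
  ultimately show "pad (n + 1) < F (pad n)" unfolding pad_def[of "n + 1"] lin by linarith
qed

lemma weight_props:
  assumes "i < k"
  shows "drel (R i)" "dfun (g i)" "R i x y \<Longrightarrow> g i x < g i y" "g i n < F n"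
  using weights assms unfolding weighted_def by blast+

text \<open>Transports \<open>R i\<close> from the values f n to the values pad n, which determine
  n. As f n <= pad n, all quantifiers are bounded by the two arguments.\<close>

definition lifted :: "nat \<Rightarrow> 'a \<Rightarrow> 'a \<Rightarrow> bool" where
  "lifted i y x \<longleftrightarrow> (\<exists>n. n < x + 1 \<and> (\<exists>m. m < y + 1 \<and> pad n = x \<and> pad m = y \<and> n < m \<and>
    (\<exists>u. u < x + 1 \<and> (\<exists>v. v < y + 1 \<and> f n = u \<and> f m = v \<and> R i v u))))"

lemma lifted_pad: "lifted i (pad m) (pad n) \<longleftrightarrow> n < m \<and> R i (f m) (f n)"
  unfolding lifted_def less_succ_model pad_inject using le_pad by blast

lemma lifted_cases: "lifted i y x \<Longrightarrow> \<exists>n m. x = pad n \<and> y = pad m \<and> n < m \<and> R i (f m) (f n)"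
  unfolding lifted_def by blast

lemma drel_lifted: "i < k \<Longrightarrow> drel (lifted i)"
  unfolding drel_def lifted_def
  by (intro S0_intros S0_dfun[OF dfun_pad] S0_dfun[OF f] S0_drel[OF weight_props(1)])

lemma not_homogeneous: "\<not> homogeneous_thm F k"
proof
  assume hom: "homogeneous_thm F k"
  \<comment> \<open>Taking the least index makes the colour of a pair unique.\<close>
  define C where "C i x y \<longleftrightarrow> i < k \<and> lifted i y x \<and> (\<forall>j<i. \<not> lifted j y x)" for i x y
  have drel_C: "drel (C i)" if "i < k" for i
    unfolding drel_def C_def
    using that by (intro S0_intros S0_ball_nat S0_drel[OF drel_lifted]) auto
  have colouring: "\<exists>!i. i < k \<and> C i (pad n) (pad m)" if nm: "n < m" for n m
  proof -
    obtain j where j: "j < k" "lifted j (pad m) (pad n)" using desc[OF nm] nm lifted_pad by blast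
    define i where "i = (LEAST i. lifted i (pad m) (pad n))"
    have "lifted i (pad m) (pad n)" unfolding i_def using j(2) by (rule LeastI)
    moreover have "i \<le> j" unfolding i_def using j(2) by (rule Least_le)
    moreover have "\<not> lifted i' (pad m) (pad n)" if "i' < i" for i'
      using not_less_Least that unfolding i_def by blast
    ultimately have i: "i < k" "C i (pad n) (pad m)" unfolding C_def using j(1) by auto
    moreover have "i = i'" if "C i (pad n) (pad m)" "C i' (pad n) (pad m)" for i i'
      using that unfolding C_def by (metis linorder_less_linear)
    ultimately show ?thesis using i by blast
  qed
  have "dfun pad \<and> (\<forall>n m. n < m \<longrightarrow> pad n < pad m) \<and> bounded_growth F pad \<and>
    (\<forall>i<k. drel (C i)) \<and> (\<forall>n m. n < m \<longrightarrow> (\<exists>!i. i < k \<and> C i (pad n) (pad m)))"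
    using dfun_pad pad_increasing pad_growth drel_C colouring by simp
  then have "\<exists>i c b l. large_chain pad (C i) c b l"
    by (rule hom[unfolded homogeneous_thm_def, THEN spec, THEN spec, THEN mp])
  then obtain i c b l where ch: "large_chain pad (C i) c b l" by blast
  obtain y where y: "entryM c b 0 y" "y < l" using ch unfolding large_chain_def by blast
  have step: "\<exists>u v. entryM c b p u \<and> entryM c b (p + 1) v \<and> C i u v" if "p + 1 < l" for p
    using ch that unfolding large_chain_def by blast
  obtain n where n: "y = pad n"
    using ch y pos_model[OF y(2)] entryM_unique unfolding large_chain_def by blast
  \<comment> \<open>The first element is positive, so the chain has at least two elements and its
    index is a genuine colour.\<close>
  have "f n < y" using le_pad(3)[of n] above[of "f n"] n by simp
  then have "0 + 1 < l" using y(2) differ_nonneg[of "f n"] unfolding lin by linarith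
  then have i: "i < k" using step unfolding C_def by blast
  \<comment> \<open>The contradiction in preparation: the chain has more than \<open>y\<close>
    elements, so this weight would have to drop \<open>y\<close> times.\<close>
  have "g i (f n) < y" using weight_props(4)[OF i, of "f n"] le_pad(3)[of n] n by simp
  let ?W = "g i (f n)"
  \<comment> \<open>This is \<open>?P'\<close> with all values bounded, using m <= pad m, f m <= pad
    m and the initial weight \<open>?W\<close>.\<close>
  let ?P = "\<lambda>p. p < l \<longrightarrow> (\<exists>z. z < b \<and> (\<exists>m. m < z + 1 \<and> entryM c b p z \<and> pad m = z \<and>
    (\<exists>v. v < z + 1 \<and> f m = v \<and> (\<exists>w. w < ?W + 1 \<and> g i v = w \<and> w + p \<le> ?W))))"
  let ?P' = "\<lambda>p. p < l \<longrightarrow> (\<exists>m. entryM c b p (pad m) \<and> g i (f m) + p \<le> ?W)"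
  have P: "?P p \<longleftrightarrow> ?P' p" for p
  proof
    show "?P' p" if "?P p" using that by blast
    show "?P p" if P': "?P' p"
    proof
      assume "p < l"
      then obtain m where m: "entryM c b p (pad m)" "g i (f m) + p \<le> ?W" using P' by blast
      then have "g i (f m) \<le> ?W" using le_add_model(1) order_trans by blast
      then show "\<exists>z. z < b \<and> (\<exists>m. m < z + 1 \<and> entryM c b p z \<and> pad m = z \<and>
          (\<exists>v. v < z + 1 \<and> f m = v \<and> (\<exists>w. w < ?W + 1 \<and> g i v = w \<and> w + p \<le> ?W)))"
        unfolding less_succ_model using m entryM_less[OF m(1)] le_pad(1,2)[of m]
        by (intro exI[of _ "pad m"] conjI exI[of _ m] exI[of _ "f m"] exI[of _ "g i (f m)"]) auto
    qed
  qed
  have "?P y"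
  proof (rule S0_induct[of ?P])
    show "S0 (\<lambda>e. ?P (e 0))"
      by (intro S0_intros S0_entryM S0_dfun[OF dfun_pad] S0_dfun[OF f] S0_dfun[OF weight_props(2)[OF i]])
    show "?P 0" unfolding P using y n by auto
    show "?P (p + 1)" if "?P p" for p
      using that unfolding P
    proof (intro impI)
      assume IH: "p < l \<longrightarrow> (\<exists>m. entryM c b p (pad m) \<and> g i (f m) + p \<le> ?W)" and p: "p + 1 < l"
      have "p < l" using p unfolding lin by linarith
      then obtain m where m: "entryM c b p (pad m)" "g i (f m) + p \<le> ?W" using IH by blast
      obtain u v where uv: "entryM c b p u" "entryM c b (p + 1) v" "C i u v" using step[OF p] by blast
      then obtain n' m' where *: "u = pad n'" "v = pad m'" "R i (f m') (f n')"
        using lifted_cases unfolding C_def by blast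
      have "pad n' = pad m" using entryM_unique[OF uv(1) m(1)] * by simp
      then have "R i (f m') (f m)" using * pad_inject by simp
      then have "g i (f m') < g i (f m)" by (rule weight_props(3)[OF i])
      then have "g i (f m') + (p + 1) \<le> ?W" using m(2) unfolding lin by linarith
      then show "\<exists>m. entryM c b (p + 1) (pad m) \<and> g i (f m) + (p + 1) \<le> ?W" using uv(2) *(2) by blast
    qed
  qed
  then obtain m where "g i (f m) + y \<le> ?W" unfolding P using y(2) by blast
  then show False using \<open>?W < y\<close> differ_nonneg[of "g i (f m)"] unfolding lin by linarith
qed

text \<open>The default 0 is admissible: \<open>lifted\<close> relates values of \<open>pad\<close>
  only, and every \<open>F x\<close> is positive.\<close>

definition lifted_weight :: "nat \<Rightarrow> 'a \<Rightarrow> 'a" where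
  "lifted_weight i x = (if \<exists>n. pad n = x then g i (f (THE n. pad n = x)) else 0)"

lemma lifted_weight_pad: "lifted_weight i (pad n) = g i (f n)"
  unfolding lifted_weight_def pad_inject by auto

lemma weighted_lifted: "weighted F k lifted lifted_weight"
  unfolding weighted_def
proof (intro allI impI conjI)
  fix i assume i: "i < k"
  show "drel (lifted i)" by (rule drel_lifted[OF i])
  have "lifted_weight i x = w \<longleftrightarrow> (\<exists>n. n < x + 1 \<and> pad n = x \<and> (\<exists>u. u < x + 1 \<and> f n = u \<and> g i u = w)) \<or>
      \<not> (\<exists>n. n < x + 1 \<and> pad n = x) \<and> w = 0" for x w
  proof (cases "\<exists>n. x = pad n")
    case True
    then obtain n where x: "x = pad n" by blast
    show ?thesis unfolding x lifted_weight_pad pad_inject less_succ_model using le_pad by blast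
  next
    case False
    then have "lifted_weight i x = 0" unfolding lifted_weight_def by auto
    then show ?thesis using False by auto
  qed
  then show "dfun (lifted_weight i)" unfolding dfun_def drel_def
    by (simp only:) (intro S0_intros S0_dfun[OF dfun_pad] S0_dfun[OF f] S0_dfun[OF weight_props(2)[OF i]])
  show "lifted_weight i x < lifted_weight i y" if lift: "lifted i x y" for x y
  proof -
    obtain n m where "y = pad n" "x = pad m" "R i (f m) (f n)" using lifted_cases[OF lift] by blast
    then show ?thesis using weight_props(3)[OF i] by (simp add: lifted_weight_pad)
  qed
  show "lifted_weight i x < F x" for x
  proof (cases "\<exists>n. x = pad n")
    case True
    then obtain n where x: "x = pad n" by blast
    have "g i (f n) < pad n" using weight_props(4)[OF i, of "f n"] le_pad(3)[of n] by simp
    then show ?thesis unfolding x lifted_weight_pad using above less_trans by blast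
  next
    case False
    then have "lifted_weight i x = 0" unfolding lifted_weight_def by auto
    then show ?thesis using pos_model[OF above] by simp
  qed
qed

lemma not_termination: "\<not> termination_thm F k"
proof
  assume termi: "termination_thm F k"
  define T where "T y x \<longleftrightarrow> (\<exists>n. n < x + 1 \<and> pad n = x \<and> pad (n + 1) = y)" for x y
  have T: "T y x \<longleftrightarrow> (\<exists>n. pad n = x \<and> pad (n + 1) = y)" for x y
    unfolding T_def less_succ_model using le_pad by blast
  have drel_T: "drel T" unfolding drel_def T_def by (intro S0_intros S0_dfun[OF dfun_pad])
  \<comment> \<open>A path runs backwards in time, from some pad(m + 1) to a pad n with n <= m.
    Hence \<open>desc\<close> applies to its two ends, however long the path is.\<close>
  have sub: "\<exists>i<k. lifted i x y" if tc: "tc T x y" for x y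
  proof -
    obtain l c b where x: "entryM c b 0 x" and y: "entryM c b (l + 1) y" and run: "run T (l + 1) c b"
      using tc unfolding tc_def by blast
    have "0 < l + 1" using differ_nonneg[of l] unfolding lin by linarith
    then have "\<exists>u v. entryM c b 0 u \<and> entryM c b (0 + 1) v \<and> T u v" using run unfolding run_def by blast
    then obtain m where m: "x = pad (m + 1)" "entryM c b (0 + 1) (pad m)"
      unfolding T using entryM_unique[OF x] by metis
    let ?P = "\<lambda>j. j \<le> l \<longrightarrow> (\<exists>z. z < b \<and> entryM c b (j + 1) z \<and> (\<exists>n. n < m + 1 \<and> pad n = z))"
    have "?P l"
    proof (rule S0_induct[of ?P])
      show "S0 (\<lambda>e. ?P (e 0))" by (intro S0_intros S0_entryM S0_dfun[OF dfun_pad])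
      show "?P 0" using m(2) entryM_less basic_less_succ by blast
      show "?P (j + 1)" if IH: "?P j" for j
      proof
        assume j: "j + 1 \<le> l"
        then have "j \<le> l" "j + 1 < l + 1" by (simp_all add: less_iff_succ_le[symmetric] less_succ_model)
        then obtain n where n: "n < m + 1" "entryM c b (j + 1) (pad n)" using IH by blast
        obtain u v where uv: "entryM c b (j + 1) u" "entryM c b (j + 1 + 1) v" "T u v"
          using run \<open>j + 1 < l + 1\<close> unfolding run_def by blast
        obtain n' where n': "pad n' = v" "pad (n' + 1) = u" using uv(3) unfolding T by blast
        then have "n' + 1 = n" using entryM_unique[OF uv(1) n(2)] pad_inject by simp
        then have "n' < m + 1" using n(1) unfolding lin by linarith
        then show "\<exists>z. z < b \<and> entryM c b (j + 1 + 1) z \<and> (\<exists>n. n < m + 1 \<and> pad n = z)"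
          using uv(2) n'(1) entryM_less by blast
      qed
    qed
    then obtain n where n: "n < m + 1" "entryM c b (l + 1) (pad n)" by blast
    then have "y = pad n" using entryM_unique[OF y] by blast
    then show ?thesis using desc[OF n(1)] n(1) m(1) lifted_pad by blast
  qed
  have "y = z" if yz: "T y x" "T z x" for x y z
  proof -
    obtain n n' where "pad n = x" "pad (n + 1) = y" "pad n' = x" "pad (n' + 1) = z"
      using yz unfolding T by blast
    then show ?thesis using pad_inject[of n n'] by simp
  qed
  then have "\<forall>x y z. T y x \<and> T z x \<longrightarrow> y = z" by blast
  moreover have "\<forall>x y. T y x \<longrightarrow> (\<exists>n. pad n = x \<and> pad (n + 1) = y)" unfolding T by blast
  moreover have "\<forall>x y. tc T x y \<longrightarrow> (\<exists>i<k. lifted i x y)" using sub by blast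
  ultimately have "drel T \<and> (\<forall>x y z. T y x \<and> T z x \<longrightarrow> y = z) \<and> dfun pad \<and>
    (\<forall>x y. T y x \<longrightarrow> (\<exists>n. pad n = x \<and> pad (n + 1) = y)) \<and> bounded_growth F pad \<and>
    weighted F k lifted lifted_weight \<and> (\<forall>x y. tc T x y \<longrightarrow> (\<exists>i<k. lifted i x y))"
    by (intro conjI drel_T dfun_pad pad_growth weighted_lifted)
  then have "\<not> (\<exists>s. dfun s \<and> (\<forall>n. T (s (n + 1)) (s n)))"
    by (rule termi[unfolded termination_thm_def, THEN spec, THEN spec, THEN spec, THEN spec, THEN mp])
  moreover have "\<forall>n. T (pad (n + 1)) (pad n)" unfolding T by blast
  ultimately show False using dfun_pad by blast
qed

end

section \<open>Equivalence of the principles in a model\<close>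

context growth
begin

lemma padded_counterexample:
  assumes mono2: "\<And>x y. x < y \<Longrightarrow> F x + (1 + 1) \<le> F y" and "\<not> closure_thm F k"
  obtains R g f M where "padded F k R g f M"
proof -
  obtain R g f where *: "weighted F k R g" "dfun f" "bounded_growth F f"
      "\<forall>n m. n < m \<longrightarrow> (\<exists>i<k. R i (f m) (f n))"
    using assms(2) unfolding closure_thm_def by blast
  obtain M where M: "dfun M" "\<And>m n. m \<le> n \<Longrightarrow> f m \<le> M n" "\<And>n. \<exists>m. m \<le> n \<and> M n = f m"
    using running_maximum[OF *(2)] by blast
  have "padded F k R g f M"
  proof
    show "\<exists>i<k. R i (f m) (f n)" if "n < m" for n m using *(4) that by blast
  qed (fact mono2 *(1-3) M)+
  then show thesis by (rule that)
qed

lemma principles_equivalent: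
  assumes "F = (\<lambda>x. x + 1) \<or> (\<forall>x y. x < y \<longrightarrow> F x + (1 + 1) \<le> F y)"
  shows "homogeneous_thm F k \<longleftrightarrow> closure_thm F k" "termination_thm F k \<longleftrightarrow> closure_thm F k"
proof -
  have "closure_thm F k" if "homogeneous_thm F k \<or> termination_thm F k"
  proof (rule ccontr)
    assume not: "\<not> closure_thm F k"
    then have "\<And>x y. x < y \<Longrightarrow> F x + (1 + 1) \<le> F y" using assms closure_thm_succ by metis
    then obtain R g f M where "padded F k R g f M" using padded_counterexample not by metis
    then interpret padded F k R g f M .
    show False using that not_homogeneous not_termination by blast
  qed
  then show "homogeneous_thm F k \<longleftrightarrow> closure_thm F k" "termination_thm F k \<longleftrightarrow> closure_thm F k"
    using closure_imp_homogeneous closure_imp_termination by blast+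
qed

end


section \<open>Evaluation of the formulas\<close>

text \<open>A variable bound at depth \<open>d\<close> is evaluated by the level function \<open>w\<close> at \<open>d\<close>, whatever the depth
  at which it is used.\<close>

definition level :: "nat \<Rightarrow> trm" where "level j = (\<lambda>d. Var (d - Suc j))"
definition level_set :: "nat \<Rightarrow> sv" where "level_set j = (\<lambda>e. e - Suc j)"

text \<open>Under \<open>d\<close> quantifiers an index \<open>i < d\<close> refers to the
  quantifier of level \<open>d - Suc i\<close>; larger indices are free variables and are read from
  \<open>z\<close>.\<close>

definition env :: "(nat \<Rightarrow> 'b) \<Rightarrow> nat \<Rightarrow> (nat \<Rightarrow> 'b) \<Rightarrow> nat \<Rightarrow> 'b" where
  "env z d w i = (if i < d then w (d - Suc i) else z (i - d))"

definition val :: "(nat \<Rightarrow> 'a) \<Rightarrow> nat \<Rightarrow> (nat \<Rightarrow> 'a::so_structure) \<Rightarrow> trm \<Rightarrow> 'a" where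
  "val zn d w t = eval (env zn d w) (t d)"

definition sval :: "(nat \<Rightarrow> 'a set) \<Rightarrow> nat \<Rightarrow> (nat \<Rightarrow> 'a set) \<Rightarrow> sv \<Rightarrow> 'a set" where
  "sval zs e v X = env zs e v (X e)"

definition holds :: "(nat \<Rightarrow> 'a::so_structure) \<Rightarrow> (nat \<Rightarrow> 'a set) \<Rightarrow>
    nat \<Rightarrow> (nat \<Rightarrow> 'a) \<Rightarrow> nat \<Rightarrow> (nat \<Rightarrow> 'a set) \<Rightarrow> form \<Rightarrow> bool" where
  "holds zn zs d w e v p = sat (env zn d w) (env zs e v) (p d e)"

lemma case_nat_env: "case_nat x (env z d w) = env z (Suc d) (w(d := x))"
  by (auto simp: env_def fun_eq_iff split: nat.split)

lemma holds_simps [simp]: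
  "holds zn zs d w e v (\<^bold>\<bottom>) \<longleftrightarrow> False"
  "holds zn zs d w e v (t \<^bold>= u) \<longleftrightarrow> val zn d w t = val zn d w u"
  "holds zn zs d w e v (t \<^bold>< u) \<longleftrightarrow> val zn d w t < val zn d w u"
  "holds zn zs d w e v (t \<^bold>\<in> X) \<longleftrightarrow> val zn d w t \<in> sval zs e v X"
  "holds zn zs d w e v (\<^bold>\<not> p) \<longleftrightarrow> \<not> holds zn zs d w e v p"
  "holds zn zs d w e v (p \<^bold>\<and> q) \<longleftrightarrow> holds zn zs d w e v p \<and> holds zn zs d w e v q"
  "holds zn zs d w e v (p \<^bold>\<or> q) \<longleftrightarrow> holds zn zs d w e v p \<or> holds zn zs d w e v q"
  "holds zn zs d w e v (p \<^bold>\<longrightarrow> q) \<longleftrightarrow> (holds zn zs d w e v p \<longrightarrow> holds zn zs d w e v q)"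
  "holds zn zs d w e v (p \<^bold>\<longleftrightarrow> q) \<longleftrightarrow> (holds zn zs d w e v p \<longleftrightarrow> holds zn zs d w e v q)"
  "holds zn zs d w e v (all B) \<longleftrightarrow> (\<forall>x. holds zn zs (Suc d) (w(d := x)) e v (B (level d)))"
  "holds zn zs d w e v (ex B) \<longleftrightarrow> (\<exists>x. holds zn zs (Suc d) (w(d := x)) e v (B (level d)))"
  "holds zn zs d w e v (allS C) \<longleftrightarrow> (\<forall>X \<in> sets. holds zn zs d w (Suc e) (v(e := X)) (C (level_set e)))"
  "holds zn zs d w e v (exS C) \<longleftrightarrow> (\<exists>X \<in> sets. holds zn zs d w (Suc e) (v(e := X)) (C (level_set e)))"
  by (simp_all add: holds_def val_def sval_def form_defs case_nat_env level_def level_set_def)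

lemma val_simps [simp]:
  "val zn d w \<^bold>0 = 0"
  "val zn d w \<^bold>1 = 1"
  "val zn d w (t \<^bold>+ u) = val zn d w t + val zn d w u"
  "val zn d w (t \<^bold>\<cdot> u) = val zn d w t * val zn d w u"
  "val zn d w (t \<^bold>^ u) = expo (val zn d w t) (val zn d w u)"
  by (simp_all add: val_def form_defs)

lemma val_pair [simp]: "val zn d w (pair t u) = pairM (val zn d w t) (val zn d w u)"
  by (simp add: pair_def pairM_def)

lemma val_num [simp]: "val zn d w (num n) = (of_nat n :: 'a::rca_model)"
  by (induction n) (simp_all add: add.commute)

lemma val_level [simp]: "j < d \<Longrightarrow> val zn d w (level j) = w j"
  by (simp add: val_def level_def env_def)

lemma sval_level_set [simp]: "j < e \<Longrightarrow> sval zs e v (level_set j) = v j"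
  by (simp add: sval_def level_set_def env_def)

text \<open>Formulas such as \<open>entry\<close> use their arguments under further quantifiers.
  Stability says that these neither move nor capture them, which lets the simplifier evaluate such
  formulas at any depth.\<close>

definition stable :: "'a::so_structure itself \<Rightarrow> nat \<Rightarrow> trm \<Rightarrow> bool" where
  "stable a d t \<longleftrightarrow> (\<forall>d' \<ge> d. \<forall>zn w w' :: nat \<Rightarrow> 'a. (\<forall>j<d. w j = w' j) \<longrightarrow> val zn d' w t = val zn d w' t)"

lemma stable_Suc [simp]: "stable a d t \<Longrightarrow> stable a (Suc d) t"
  unfolding stable_def by (metis Suc_leD le_refl less_SucI)

lemma val_stable [simp]:
  "stable TYPE('a) d t \<Longrightarrow> val zn (Suc d) (w(d := x)) t = val zn d (w :: nat \<Rightarrow> 'a::so_structure) t"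
  unfolding stable_def by simp

lemma stable_level [simp]: "j < d \<Longrightarrow> stable a d (level j)"
  by (simp add: stable_def)

lemma stable_simps [simp]:
  "stable a d \<^bold>0" "stable a d \<^bold>1"
  "stable a d t \<Longrightarrow> stable a d u \<Longrightarrow> stable a d (t \<^bold>+ u)"
  by (auto simp: stable_def) metis

lemma holds_entry [simp]:
  "stable TYPE('a) d c \<Longrightarrow> stable TYPE('a) d b \<Longrightarrow> stable TYPE('a) d i \<Longrightarrow> stable TYPE('a) d x \<Longrightarrow>
    holds zn zs d w e v (entry c b i x) \<longleftrightarrow>
    entryM (val zn d w c) (val zn d w b) (val zn d w i) (val zn d (w :: nat \<Rightarrow> 'a::rca_model) x)"
  by (simp add: entry_def entryM_def)

lemma holds_Fgraph [simp]:
  "stable TYPE('a) d x \<Longrightarrow> stable TYPE('a) d y \<Longrightarrow>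
    holds zn zs d w e v (Fgraph h x y) \<longleftrightarrow> Fg h (val zn d w x) (val zn d (w :: nat \<Rightarrow> 'a::rca_model) y)"
  by (induction h arbitrary: d w x y) simp_all

lemma holds_less_F [simp]:
  "stable TYPE('a) d x \<Longrightarrow> stable TYPE('a) d y \<Longrightarrow>
    holds zn zs d w e v (less_F h x y) \<longleftrightarrow> (\<exists>z. Fg h (val zn d w y) z \<and> val zn d (w :: nat \<Rightarrow> 'a::rca_model) x < z)"
  by (simp add: less_F_def)

lemma holds_Tot: "holds zn zs d (w :: nat \<Rightarrow> 'a) e v (Tot h) \<longleftrightarrow> (\<forall>x :: 'a::rca_model. \<exists>y. Fg h x y)"
  by (simp add: Tot_def)

definition is_rel :: "'a::rca_model set \<Rightarrow> bool" where
  "is_rel X \<longleftrightarrow> (\<forall>z \<in> X. \<exists>x y. z = pairM x y)"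

definition is_fun :: "'a::rca_model set \<Rightarrow> bool" where
  "is_fun X \<longleftrightarrow> is_rel X \<and> (\<forall>x. \<exists>y. pairM x y \<in> X) \<and>
    (\<forall>x y z. pairM x y \<in> X \<and> pairM x z \<in> X \<longrightarrow> y = z)"

lemma holds_Rel [simp]: "holds zn zs d w e v (Rel X) \<longleftrightarrow> is_rel (sval zs e v X)"
  by (auto simp: Rel_def is_rel_def)

lemma holds_Fun [simp]: "holds zn zs d w e v (Fun X) \<longleftrightarrow> is_fun (sval zs e v X)"
  by (simp add: Fun_def is_fun_def app_def)

lemma holds_Conj_lt [simp]: "holds zn zs d w e v (Conj_lt k p) \<longleftrightarrow> (\<forall>i<k. holds zn zs d w e v (p i))"
  by (induction k) (auto simp: less_Suc_eq)

lemma holds_Disj_lt [simp]: "holds zn zs d w e v (Disj_lt k p) \<longleftrightarrow> (\<exists>i<k. holds zn zs d w e v (p i))"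
  by (induction k) (auto simp: less_Suc_eq)

text \<open>A block of set quantifiers occupies consecutive levels starting at
  \<open>e\<close>.\<close>

primrec upds :: "(nat \<Rightarrow> 'b) \<Rightarrow> nat \<Rightarrow> 'b list \<Rightarrow> nat \<Rightarrow> 'b" where
  "upds v e [] = v"
| "upds v e (X # Xs) = upds (v(e := X)) (Suc e) Xs"

lemma upds_below: "j < e \<Longrightarrow> upds v e Xs j = v j"
  by (induction Xs arbitrary: v e) auto

lemma upds_nth: "e \<le> j \<Longrightarrow> j < e + length Xs \<Longrightarrow> upds v e Xs j = Xs ! (j - e)"
proof (induction Xs arbitrary: v e)
  case (Cons X Xs)
  show ?case
  proof (cases "j = e")
    case True
    then show ?thesis by (simp add: upds_below)
  next
    case False
    then have "upds (v(e := X)) (Suc e) Xs j = Xs ! (j - Suc e)"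
      using Cons.prems by (intro Cons.IH) simp_all
    moreover have "j - e = Suc (j - Suc e)" using False Cons.prems by simp
    ultimately show ?thesis by simp
  qed
qed simp

lemma all_lists_Suc: "(\<forall>Xs. length Xs = Suc k \<and> set Xs \<subseteq> A \<longrightarrow> P Xs) \<longleftrightarrow>
  (\<forall>X \<in> A. \<forall>Xs. length Xs = k \<and> set Xs \<subseteq> A \<longrightarrow> P (X # Xs))"
  by (auto simp: length_Suc_conv)

lemma holds_all_sets: "holds zn zs d w e v (all_sets k B) \<longleftrightarrow>
  (\<forall>Xs. length Xs = k \<and> set Xs \<subseteq> sets \<longrightarrow> holds zn zs d w (e + k) (upds v e Xs) (B (map level_set [e..<e + k])))"
proof (induction k arbitrary: e v B)
  case (Suc k)
  have "[e..<e + Suc k] = e # [Suc e..<Suc e + k]" by (simp add: upt_conv_Cons)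
  then show ?case unfolding all_lists_Suc by (simp add: Suc fun_upd_def del: upt_Suc)
qed simp

lemma holds_ex_sets: "holds zn zs d w e v (ex_sets k B) \<longleftrightarrow>
  (\<exists>Xs. length Xs = k \<and> set Xs \<subseteq> sets \<and> holds zn zs d w (e + k) (upds v e Xs) (B (map level_set [e..<e + k])))"
proof (induction k arbitrary: e v B)
  case (Suc k)
  have "[e..<e + Suc k] = e # [Suc e..<Suc e + k]" by (simp add: upt_conv_Cons)
  then show ?case by (force simp: Suc length_Suc_conv fun_upd_def simp del: upt_Suc)
qed simp

definition grows :: "nat \<Rightarrow> 'a::rca_model set \<Rightarrow> bool" where
  "grows h f \<longleftrightarrow> (\<forall>n x y. pairM n x \<in> f \<and> pairM (n + 1) y \<in> f \<longrightarrow> (\<exists>z. Fg h x z \<and> y < z))"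

lemma holds_F_controlled [simp]: "holds zn zs d w e v (F_controlled h f) \<longleftrightarrow> grows h (sval zs e v f)"
  by (simp add: F_controlled_def app_def grows_def)

definition set_weighted :: "nat \<Rightarrow> nat \<Rightarrow> 'a::rca_model set list \<Rightarrow> 'a set list \<Rightarrow> bool" where
  "set_weighted h k Rs gs \<longleftrightarrow> (\<forall>i<k. is_rel (Rs ! i) \<and>
    (is_fun (gs ! i) \<and> (\<forall>x y u v. pairM x y \<in> Rs ! i \<and> pairM x u \<in> gs ! i \<and> pairM y v \<in> gs ! i \<longrightarrow> u < v)) \<and>
    (\<forall>n x. pairM n x \<in> gs ! i \<longrightarrow> (\<exists>z. Fg h n z \<and> x < z)))"

lemma holds_Weighted: "holds zn zs d w e v (Weighted h k Rs gs) \<longleftrightarrow>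
  (\<forall>i<k. is_rel (sval zs e v (Rs ! i)) \<and> (is_fun (sval zs e v (gs ! i)) \<and>
    (\<forall>x y u u'. pairM x y \<in> sval zs e v (Rs ! i) \<and> pairM x u \<in> sval zs e v (gs ! i) \<and>
      pairM y u' \<in> sval zs e v (gs ! i) \<longrightarrow> u < u')) \<and>
    (\<forall>n x. pairM n x \<in> sval zs e v (gs ! i) \<longrightarrow> (\<exists>z. Fg h n z \<and> x < z)))"
  by (simp add: Weighted_def Weight_def F_bounded_def rel_def app_def)

definition set_decreasing :: "nat \<Rightarrow> 'a::rca_model set list \<Rightarrow> 'a set \<Rightarrow> bool" where
  "set_decreasing k Rs f \<longleftrightarrow>
    (\<forall>n m x y. n < m \<and> pairM n x \<in> f \<and> pairM m y \<in> f \<longrightarrow> (\<exists>i<k. pairM y x \<in> Rs ! i))"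

lemma holds_Trans_decreasing: "holds zn zs d w e v (Trans_decreasing k Rs f) \<longleftrightarrow>
  (\<forall>n m x y. n < m \<and> pairM n x \<in> sval zs e v f \<and> pairM m y \<in> sval zs e v f \<longrightarrow>
    (\<exists>i<k. pairM y x \<in> sval zs e v (Rs ! i)))"
  by (simp add: Trans_decreasing_def rel_Union_def rel_def app_def)

lemma holds_HCT:
  fixes w :: "nat \<Rightarrow> 'a::rca_model"
  shows "holds zn zs 0 w 0 v (HCT k h) \<longleftrightarrow>
  (\<forall>Rs. length Rs = k \<and> set Rs \<subseteq> sets \<longrightarrow> (\<forall>gs. length gs = k \<and> set gs \<subseteq> sets \<longrightarrow>
    set_weighted h k Rs gs \<longrightarrow>
    \<not> (\<exists>f \<in> (sets :: 'a::rca_model set set). is_fun f \<and> set_decreasing k Rs f \<and> grows h f)))"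
proof -
  have "holds zn zs 0 w (k + k) (upds (upds v 0 Rs) k gs) (Weighted h k (map level_set [0..<k]) (map level_set [k..<k + k]) \<^bold>\<longrightarrow>
      (\<^bold>\<not> (\<^bold>\<exists>\<^sub>S f. Fun f \<^bold>\<and> Trans_decreasing k (map level_set [0..<k]) f \<^bold>\<and> F_controlled h f))) \<longleftrightarrow>
    (set_weighted h k Rs gs \<longrightarrow>
      \<not> (\<exists>f \<in> sets. is_fun f \<and> set_decreasing k Rs f \<and> grows h f))"
    if "length Rs = k" "length gs = k" for Rs gs :: "'a set list"
    using that by (simp add: holds_Weighted holds_Trans_decreasing set_decreasing_def set_weighted_def
        upds_below upds_nth cong: conj_cong)
  then show ?thesis by (simp add: HCT_def holds_all_sets cong: conj_cong)
qed

definition set_transitions :: "'a::rca_model set \<Rightarrow> 'a set \<Rightarrow> bool" where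
  "set_transitions f R \<longleftrightarrow> (\<forall>x y z. pairM y x \<in> R \<and> pairM z x \<in> R \<longrightarrow> y = z) \<and> is_fun f \<and>
    (\<forall>x y. pairM y x \<in> R \<longrightarrow> (\<exists>n. pairM n x \<in> f \<and> pairM (n + 1) y \<in> f))"

lemma holds_trans_cl [simp]:
  "stable TYPE('a) d x \<Longrightarrow> stable TYPE('a) d y \<Longrightarrow> holds zn zs d w e v (trans_cl x R y) \<longleftrightarrow>
    tc (\<lambda>x y. pairM x y \<in> sval zs e v R) (val zn d w x) (val zn d (w :: nat \<Rightarrow> 'a::rca_model) y)"
  by (simp add: trans_cl_def tc_def run_def rel_def)

text \<open>Stated for its position inside \<open>TT\<close>, under the quantifiers for R and f.
  There the level of R is known and survives the quantifier for \<open>s\<close>.\<close>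

lemma holds_Well_founded: "holds zn zs d w e v (Well_founded R) \<longleftrightarrow> \<not> (\<exists>s \<in> sets. is_fun s \<and>
    (\<forall>n x y. pairM n x \<in> s \<and> pairM (n + 1) y \<in> s \<longrightarrow> pairM y x \<in> sval zs e v R))"
  if "e = Suc (Suc 0)" "R = level_set 0"
  using that by (simp add: Well_founded_def rel_def app_def)

lemma holds_TT:
  fixes w :: "nat \<Rightarrow> 'a::rca_model"
  shows "holds zn zs 0 w 0 v (TT k h) \<longleftrightarrow>
  (\<forall>R \<in> sets. \<forall>f \<in> sets. is_rel R \<and> set_transitions f R \<and> grows h f \<and>
    (\<exists>Rs. length Rs = k \<and> set Rs \<subseteq> sets \<and> (\<exists>gs. length gs = k \<and> set gs \<subseteq> sets \<and>
      set_weighted h k Rs gs \<and> (\<forall>x y. tc (\<lambda>x y. pairM x y \<in> R) x y \<longrightarrow> (\<exists>i<k. pairM x y \<in> Rs ! i)))) \<longrightarrow>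
    \<not> (\<exists>s \<in> (sets :: 'a::rca_model set set). is_fun s \<and>
      (\<forall>n x y. pairM n x \<in> s \<and> pairM (n + 1) y \<in> s \<longrightarrow> pairM y x \<in> R)))"
proof -
  let ?Rs = "map level_set [Suc (Suc 0)..<Suc (Suc k)]"
  let ?gs = "map level_set [Suc (Suc k)..<Suc (Suc (k + k))]"
  have "holds zn zs 0 w (Suc (Suc (k + k))) (upds (upds (v(0 := R, Suc 0 := f)) (Suc (Suc 0)) Rs) (Suc (Suc k)) gs)
      (Weighted h k ?Rs ?gs \<^bold>\<and>
        (\<^bold>\<forall>x. \<^bold>\<forall>y. trans_cl x (level_set 0) y \<^bold>\<longrightarrow> rel_Union k x ?Rs y)) \<longleftrightarrow>
    (set_weighted h k Rs gs \<and> (\<forall>x y. tc (\<lambda>x y. pairM x y \<in> R) x y \<longrightarrow> (\<exists>i<k. pairM x y \<in> Rs ! i)))"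
    if "length Rs = k" "length gs = k" for R f :: "'a set" and Rs gs
    using that by (simp add: holds_Weighted set_weighted_def rel_Union_def rel_def
        upds_below upds_nth del: upt_Suc cong: conj_cong)
  then show ?thesis
    by (simp add: TT_def holds_ex_sets holds_Well_founded set_transitions_def Deterministic_def
        Transition_function_def rel_def app_def del: upt_Suc cong: conj_cong)
qed

definition set_colouring :: "nat \<Rightarrow> 'a::rca_model set \<Rightarrow> 'a set \<Rightarrow> bool" where
  "set_colouring k f P \<longleftrightarrow>
    (\<forall>z. z \<in> P \<longrightarrow> (\<exists>x y i. z = pairM (pairM x y) i \<and> (\<exists>n. pairM n x \<in> f) \<and> (\<exists>n. pairM n y \<in> f) \<and>
      x < y \<and> i < of_nat k)) \<and>
    (\<forall>x y. (\<exists>n. pairM n x \<in> f) \<and> (\<exists>n. pairM n y \<in> f) \<and> x < y \<longrightarrow>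
      (\<exists>i. i < of_nat k \<and> pairM (pairM x y) i \<in> P)) \<and>
    (\<forall>x y i j. pairM (pairM x y) i \<in> P \<and> pairM (pairM x y) j \<in> P \<longrightarrow> i = j)"

lemma holds_WPH:
  fixes w :: "nat \<Rightarrow> 'a::rca_model"
  shows "holds zn zs 0 w 0 v (WPH h k) \<longleftrightarrow>
  (\<forall>f \<in> (sets :: 'a::rca_model set set). \<forall>P \<in> sets. is_fun f \<and>
    (\<forall>m n x y. m < n \<and> pairM m x \<in> f \<and> pairM n y \<in> f \<longrightarrow> x < y) \<and> grows h f \<and> set_colouring k f P \<longrightarrow>
    (\<exists>Y \<in> sets. (\<forall>y. y \<in> Y \<longrightarrow> (\<exists>n. pairM n y \<in> f)) \<and> (\<exists>c b l.
      (\<forall>z. z \<in> Y \<longleftrightarrow> (\<exists>i. i < l \<and> entryM c b i z)) \<and>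
      (\<forall>i. i + 1 < l \<longrightarrow> (\<exists>u v. entryM c b i u \<and> entryM c b (i + 1) v \<and> u < v)) \<and>
      (\<exists>m. entryM c b 0 m \<and> m < l) \<and>
      (\<exists>j. \<forall>i. i + 1 < l \<longrightarrow>
        (\<exists>u v. entryM c b i u \<and> entryM c b (i + 1) v \<and> pairM (pairM u v) j \<in> P)))))"
  by (simp add: WPH_def Increasing_def Colouring_def Enumerates_def One_large_def
      Weakly_homogeneous_def colour_def in_rng_def app_def set_colouring_def)


section \<open>Sets of the model as relations and functions\<close>

abbreviation set_rel :: "'a::rca_model set \<Rightarrow> 'a \<Rightarrow> 'a \<Rightarrow> bool" where
  "set_rel X \<equiv> \<lambda>x y. pairM x y \<in> X"

lemma S0_comprehension:
  assumes "S0 (\<lambda>e. P (e 0))"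
  shows "\<exists>X \<in> sets. \<forall>x :: 'a::rca_model. x \<in> X \<longleftrightarrow> P x"
  using Delta_comprehension[of "\<lambda>_. P" "\<lambda>_. P"] S0_subst1[OF assms T0_var, of 1] by simp

lemma drel_set: "X \<in> sets \<Longrightarrow> drel (set_rel X)"
  unfolding drel_def by (intro S0_intros S0_pairM)

lemma set_of_drel:
  assumes R: "drel R"
  obtains X where "X \<in> sets" "is_rel X" "set_rel X = R"
proof -
  have "\<exists>X \<in> sets. \<forall>z. z \<in> X \<longleftrightarrow> (\<exists>x. x < z + 1 \<and> (\<exists>y. y < z + 1 \<and> z = pairM x y \<and> R x y))"
    by (rule S0_comprehension) (intro S0_intros S0_pairM S0_drel[OF R])
  then obtain X where X: "X \<in> sets"
      "\<And>z. z \<in> X \<longleftrightarrow> (\<exists>x. x < z + 1 \<and> (\<exists>y. y < z + 1 \<and> z = pairM x y \<and> R x y))" by blast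
  have "pairM x y \<in> X \<longleftrightarrow> R x y" for x y
    using X(2)[of "pairM x y"] unfolding bounded_ex_pair .
  then have rel: "set_rel X = R" by (simp add: fun_eq_iff)
  have "is_rel X" unfolding is_rel_def
  proof
    show "\<exists>x y. z = pairM x y" if "z \<in> X" for z using that X(2)[of z] by blast
  qed
  from X(1) this rel show thesis by (rule that)
qed

lemma fun_of_set:
  assumes "f \<in> sets" and "is_fun f"
  obtains \<phi> where "dfun \<phi>" "\<And>x y. pairM x y \<in> f \<longleftrightarrow> \<phi> x = y"
proof -
  have "\<forall>x. \<exists>y. pairM x y \<in> f" using assms(2) unfolding is_fun_def by blast
  then obtain \<phi> where \<phi>: "\<And>x. pairM x (\<phi> x) \<in> f" by metis
  have eq: "pairM x y \<in> f \<longleftrightarrow> \<phi> x = y" for x y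
    using \<phi>[of x] assms(2) unfolding is_fun_def by blast
  have "dfun \<phi>" unfolding dfun_def eq[symmetric] by (rule drel_set[OF assms(1)])
  then show thesis using eq that by blast
qed

lemma set_of_dfun:
  assumes "dfun \<phi>"
  obtains f where "f \<in> sets" "is_fun f" "\<And>x y. pairM x y \<in> f \<longleftrightarrow> \<phi> x = y"
proof -
  obtain f where f: "f \<in> sets" "is_rel f" "set_rel f = (\<lambda>x y. \<phi> x = y)"
    using set_of_drel assms unfolding dfun_def by blast
  have eq: "pairM x y \<in> f \<longleftrightarrow> \<phi> x = y" for x y using fun_cong[OF fun_cong[OF f(3)], of x y] by simp
  have "is_fun f" unfolding is_fun_def eq using f(2) by blast
  then show thesis using f(1) eq that by blast
qed

lemma choose_list:
  assumes "\<And>i. i < k \<Longrightarrow> \<exists>X \<in> A. P i X"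
  shows "\<exists>Xs. length Xs = k \<and> set Xs \<subseteq> A \<and> (\<forall>i<k. P i (Xs ! i))"
proof -
  obtain X where X: "\<And>i. i < k \<Longrightarrow> X i \<in> A \<and> P i (X i)" using assms by metis
  show ?thesis by (rule exI[of _ "map X [0..<k]"]) (use X in auto)
qed

text \<open>Below a standard number even a nonstandard model has standard elements only, so the
  colours in a model correspond to indices of the metatheory.\<close>

lemma less_of_nat_model: "x < of_nat k \<Longrightarrow> \<exists>j<k. x = (of_nat j :: 'a::rca_model)"
proof (induction k)
  case (Suc k)
  then have "x < of_nat k \<or> x = of_nat k" using basic_less_succ[of x "of_nat k"] by (simp add: add.commute)
  then show ?case using Suc.IH less_SucI by blast
qed (simp add: basic_not_less_zero)

section \<open>Translation of the formulas where F_h is total\<close>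

locale total =
  fixes h :: nat and F :: "'a::rca_model \<Rightarrow> 'a"
  assumes F_graph: "Fg h x y \<longleftrightarrow> F x = y"
begin

sublocale growth F
proof
  interpret fast "Fg h :: 'a \<Rightarrow> _" by (rule fast_Fg)
  show "dfun F" using S0_graph unfolding dfun_def drel_def F_graph .
  show "x < F x" for x using above F_graph by blast
  show "F x < F y" if "x < y" for x y using increasing that F_graph by blast
qed

lemma F_cases: "F = (\<lambda>x. x + 1) \<or> (\<forall>x y. x < y \<longrightarrow> F x + (1 + 1) \<le> F y)"
proof (cases h)
  case 0
  then have "F x = x + 1" for x using F_graph[of x "x + 1"] by simp
  then show ?thesis by blast
next
  case (Suc h')
  then show ?thesis using Fg_Suc_increasing[of h'] F_graph by blast
qed

lemma exists_graph: "(\<exists>z. Fg h x z \<and> y < z) \<longleftrightarrow> y < F x"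
  using F_graph by auto

lemma grows_iff: "(\<And>x y. pairM x y \<in> f \<longleftrightarrow> \<phi> x = y) \<Longrightarrow> grows h f \<longleftrightarrow> bounded_growth F \<phi>"
  unfolding grows_def bounded_growth_def exists_graph by auto

lemma set_weighted_iff:
  assumes "\<And>i x y. i < k \<Longrightarrow> pairM x y \<in> gs ! i \<longleftrightarrow> g i x = y"
    and "\<And>i. i < k \<Longrightarrow> is_rel (Rs ! i) \<and> is_fun (gs ! i)"
    and "\<And>i. i < k \<Longrightarrow> drel (set_rel (Rs ! i)) \<and> dfun (g i)"
  shows "set_weighted h k Rs gs \<longleftrightarrow> weighted F k (\<lambda>i. set_rel (Rs ! i)) g"
  unfolding set_weighted_def weighted_def exists_graph using assms by auto

lemma weighted_cong: "weighted F k R g \<Longrightarrow> (\<And>i. i < k \<Longrightarrow> R' i = R i) \<Longrightarrow> weighted F k R' g"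
  unfolding weighted_def by simp

lemma weighted_sets:
  assumes "weighted F k R g"
  obtains Rs gs where "length Rs = k" "set Rs \<subseteq> sets" "length gs = k" "set gs \<subseteq> sets"
    "set_weighted h k Rs gs" "\<And>i. i < k \<Longrightarrow> set_rel (Rs ! i) = R i"
proof -
  have w: "drel (R i)" "dfun (g i)" if "i < k" for i using assms that unfolding weighted_def by blast+
  have rels: "\<exists>X \<in> sets. is_rel X \<and> set_rel X = R i" if "i < k" for i
    using set_of_drel[OF w(1)[OF that]] by blast
  obtain Rs where Rs: "length Rs = k" "set Rs \<subseteq> sets" "\<And>i. i < k \<Longrightarrow> is_rel (Rs ! i) \<and> set_rel (Rs ! i) = R i"
    using choose_list[of k sets "\<lambda>i X. is_rel X \<and> set_rel X = R i", OF rels] by blast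
  have funs: "\<exists>X \<in> sets. is_fun X \<and> (\<forall>x y. pairM x y \<in> X \<longleftrightarrow> g i x = y)" if i: "i < k" for i
  proof -
    obtain X where "X \<in> sets" "is_fun X" "\<And>x y. pairM x y \<in> X \<longleftrightarrow> g i x = y"
      using set_of_dfun[OF w(2)[OF i]] by metis
    then show ?thesis by blast
  qed
  obtain gs where gs: "length gs = k" "set gs \<subseteq> sets"
      "\<And>i. i < k \<Longrightarrow> is_fun (gs ! i) \<and> (\<forall>x y. pairM x y \<in> gs ! i \<longleftrightarrow> g i x = y)"
    using choose_list[of k sets "\<lambda>i X. is_fun X \<and> (\<forall>x y. pairM x y \<in> X \<longleftrightarrow> g i x = y)", OF funs]
    by blast
  have "weighted F k (\<lambda>i. set_rel (Rs ! i)) g" 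
    by (rule weighted_cong[OF assms]) (use Rs(3) in blast)
  then have "set_weighted h k Rs gs"
    using Rs gs w by (subst set_weighted_iff[where g = g]) simp_all
  then show thesis using Rs gs by (intro that[of Rs gs]) blast+
qed

lemma weighted_funs:
  assumes "length Rs = k" "set Rs \<subseteq> sets" "length gs = k" "set gs \<subseteq> sets" "set_weighted h k Rs gs"
  obtains g where "weighted F k (\<lambda>i. set_rel (Rs ! i)) g"
proof -
  have sets: "Rs ! i \<in> sets" "gs ! i \<in> sets" if "i < k" for i using assms that by (auto simp: subset_iff)
  have props: "is_rel (Rs ! i) \<and> is_fun (gs ! i)" if "i < k" for i
    using assms(5) that unfolding set_weighted_def by blast
  have "\<exists>\<phi>. dfun \<phi> \<and> (\<forall>x y. pairM x y \<in> gs ! i \<longleftrightarrow> \<phi> x = y)" if i: "i < k" for i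
    using fun_of_set[of "gs ! i"] sets[OF i] props[OF i] by metis
  then obtain g where g: "\<And>i. i < k \<Longrightarrow> dfun (g i) \<and> (\<forall>x y. pairM x y \<in> gs ! i \<longleftrightarrow> g i x = y)" by metis
  have "drel (set_rel (Rs ! i)) \<and> dfun (g i)" if "i < k" for i
    using drel_set[OF sets(1)[OF that]] g[OF that] by blast
  then have "weighted F k (\<lambda>i. set_rel (Rs ! i)) g"
    using assms(5) set_weighted_iff[of k gs g Rs] g props by blast
  then show thesis by (rule that)
qed

lemma HCT_iff: "holds zn zs 0 (w :: nat \<Rightarrow> 'a) 0 v (HCT k h) \<longleftrightarrow> closure_thm F k"
proof
  assume hct: "holds zn zs 0 w 0 v (HCT k h)"
  show "closure_thm F k"
    unfolding closure_thm_def
  proof (intro allI impI notI, elim conjE)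
    fix R g f
    assume "weighted F k R g" and f: "dfun f" "bounded_growth F f"
      and desc: "\<forall>n m. n < m \<longrightarrow> (\<exists>i<k. R i (f m) (f n))"
    then obtain Rs gs where s: "length Rs = k" "set Rs \<subseteq> sets" "length gs = k" "set gs \<subseteq> sets"
        "set_weighted h k Rs gs" "\<And>i. i < k \<Longrightarrow> set_rel (Rs ! i) = R i" using weighted_sets by metis
    obtain X where X: "X \<in> sets" "is_fun X" "\<And>x y. pairM x y \<in> X \<longleftrightarrow> f x = y"
      using set_of_dfun[OF f(1)] by metis
    have "pairM x y \<in> Rs ! i \<longleftrightarrow> R i x y" if "i < k" for i x y
      using fun_cong[OF fun_cong[OF s(6)[OF that]], of x y] by simp
    then have "set_decreasing k Rs X" unfolding set_decreasing_def X(3) using desc by blast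
    moreover have "grows h X" using grows_iff[OF X(3)] f(2) by blast
    ultimately show False using hct[unfolded holds_HCT] s X by blast
  qed
next
  assume principle: "closure_thm F k"
  show "holds zn zs 0 w 0 v (HCT k h)"
    unfolding holds_HCT
  proof (intro allI impI notI, elim conjE bexE)
    fix Rs gs and X :: "'a set"
    assume s: "length Rs = k" "set Rs \<subseteq> sets" "length gs = k" "set gs \<subseteq> sets" "set_weighted h k Rs gs"
      and X: "X \<in> sets" "is_fun X" "set_decreasing k Rs X" "grows h X"
    obtain g where g: "weighted F k (\<lambda>i. set_rel (Rs ! i)) g" using weighted_funs[OF s] .
    obtain f where f: "dfun f" "\<And>x y. pairM x y \<in> X \<longleftrightarrow> f x = y" using fun_of_set[OF X(1,2)] by metis
    have "bounded_growth F f" using grows_iff[OF f(2)] X(4) by blast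
    moreover have "\<forall>n m. n < m \<longrightarrow> (\<exists>i<k. set_rel (Rs ! i) (f m) (f n))"
      using X(3) unfolding set_decreasing_def f(2) by blast
    ultimately show False using principle g f(1) unfolding closure_thm_def by blast
  qed
qed

lemma TT_iff: "holds zn zs 0 (w :: nat \<Rightarrow> 'a) 0 v (TT k h) \<longleftrightarrow> termination_thm F k"
proof
  assume tt: "holds zn zs 0 w 0 v (TT k h)"
  show "termination_thm F k"
    unfolding termination_thm_def
  proof (intro allI impI notI, elim conjE exE)
    fix T f R g s
    assume T: "drel T" "\<forall>x y z. T y x \<and> T z x \<longrightarrow> y = z"
      and f: "dfun f" "\<forall>x y. T y x \<longrightarrow> (\<exists>n. f n = x \<and> f (n + 1) = y)" "bounded_growth F f"
      and "weighted F k R g" and sub: "\<forall>x y. tc T x y \<longrightarrow> (\<exists>i<k. R i x y)"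
      and s: "dfun s" "\<forall>n. T (s (n + 1)) (s n)"
    obtain Rs gs where w: "length Rs = k" "set Rs \<subseteq> sets" "length gs = k" "set gs \<subseteq> sets"
        "set_weighted h k Rs gs" "\<And>i. i < k \<Longrightarrow> set_rel (Rs ! i) = R i"
      using weighted_sets[OF \<open>weighted F k R g\<close>] by metis
    have Rs: "pairM x y \<in> Rs ! i \<longleftrightarrow> R i x y" if "i < k" for i x y
      using fun_cong[OF fun_cong[OF w(6)[OF that]], of x y] by simp
    obtain X where X: "X \<in> sets" "is_rel X" "set_rel X = T" using set_of_drel[OF T(1)] .
    have XT: "pairM x y \<in> X \<longleftrightarrow> T x y" for x y using fun_cong[OF fun_cong[OF X(3)], of x y] by simp
    obtain Y where Y: "Y \<in> sets" "is_fun Y" "\<And>x y. pairM x y \<in> Y \<longleftrightarrow> f x = y"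
      using set_of_dfun[OF f(1)] by metis
    obtain S where S: "S \<in> sets" "is_fun S" "\<And>x y. pairM x y \<in> S \<longleftrightarrow> s x = y"
      using set_of_dfun[OF s(1)] by metis
    have "set_transitions Y X" unfolding set_transitions_def XT Y(3) using T(2) f(2) Y(2) by blast
    moreover have "grows h Y" using grows_iff[OF Y(3)] f(3) by blast
    moreover have "\<forall>x y. tc (set_rel X) x y \<longrightarrow> (\<exists>i<k. pairM x y \<in> Rs ! i)"
      unfolding X(3) using sub Rs by blast
    moreover have "\<forall>n x y. pairM n x \<in> S \<and> pairM (n + 1) y \<in> S \<longrightarrow> pairM y x \<in> X"
      unfolding S(3) XT using s(2) by blast
    ultimately show False
      using tt[unfolded holds_TT, THEN bspec, OF X(1), THEN bspec, OF Y(1)] X(2) w(1-5) S(1,2) by blast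
  qed
next
  assume principle: "termination_thm F k"
  show "holds zn zs 0 w 0 v (TT k h)"
    unfolding holds_TT
  proof (intro ballI impI notI, elim conjE exE bexE)
    fix X Y S :: "'a set" and Rs gs
    assume X: "X \<in> sets" "is_rel X" and Y: "Y \<in> sets" "set_transitions Y X" "grows h Y"
      and w: "length Rs = k" "set Rs \<subseteq> sets" "length gs = k" "set gs \<subseteq> sets" "set_weighted h k Rs gs"
      and sub: "\<forall>x y. tc (set_rel X) x y \<longrightarrow> (\<exists>i<k. pairM x y \<in> Rs ! i)"
      and S: "S \<in> sets" "is_fun S" "\<forall>n x y. pairM n x \<in> S \<and> pairM (n + 1) y \<in> S \<longrightarrow> pairM y x \<in> X"
    obtain g where g: "weighted F k (\<lambda>i. set_rel (Rs ! i)) g" using weighted_funs[OF w] .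
    have "is_fun Y" using Y(2) unfolding set_transitions_def by blast
    then obtain f where f: "dfun f" "\<And>x y. pairM x y \<in> Y \<longleftrightarrow> f x = y" using fun_of_set[OF Y(1)] by metis
    obtain s where s: "dfun s" "\<And>x y. pairM x y \<in> S \<longleftrightarrow> s x = y" using fun_of_set[OF S(1,2)] by metis
    have "drel (set_rel X) \<and> (\<forall>x y z. set_rel X y x \<and> set_rel X z x \<longrightarrow> y = z) \<and> dfun f \<and>
      (\<forall>x y. set_rel X y x \<longrightarrow> (\<exists>n. f n = x \<and> f (n + 1) = y)) \<and> bounded_growth F f \<and>
      weighted F k (\<lambda>i. set_rel (Rs ! i)) g \<and> (\<forall>x y. tc (set_rel X) x y \<longrightarrow> (\<exists>i<k. set_rel (Rs ! i) x y))"
    proof (intro conjI)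
      show "drel (set_rel X)" by (rule drel_set[OF X(1)])
      show "bounded_growth F f" using grows_iff[OF f(2)] Y(3) by blast
    qed (use Y(2) f g sub in \<open>simp_all add: set_transitions_def\<close>)
    then have "\<not> (\<exists>s. dfun s \<and> (\<forall>n. set_rel X (s (n + 1)) (s n)))"
      by (rule principle[unfolded termination_thm_def, THEN spec, THEN spec, THEN spec, THEN spec, THEN mp])
    then show False using s(1) S(3) unfolding s(2) by blast
  qed
qed

lemma WPH_iff: "holds zn zs 0 (w :: nat \<Rightarrow> 'a) 0 v (WPH h k) \<longleftrightarrow> homogeneous_thm F k"
proof
  assume wph: "holds zn zs 0 w 0 v (WPH h k)"
  show "homogeneous_thm F k"
    unfolding homogeneous_thm_def
  proof (intro allI impI, elim conjE)
    fix f C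
    assume f: "dfun f" and inc: "\<forall>n m. n < m \<longrightarrow> f n < f m" and growth: "bounded_growth F f"
      and C: "\<forall>i<k. drel (C i)" and colour: "\<forall>n m. n < m \<longrightarrow> (\<exists>!i. i < k \<and> C i (f n) (f m))"
    have ge: "n \<le> f n" for n using increasing_ge[OF f] inc by blast
    have inc_iff: "f n < f m \<longleftrightarrow> n < m" for n m using inc by (metis less_asym linorder_less_linear)
    have rng: "(\<exists>n. n < x + 1 \<and> f n = x) \<longleftrightarrow> (\<exists>n. f n = x)" for x
      unfolding less_succ_model using ge by blast
    \<comment> \<open>\<open>p\<close> codes the pair of points, so the set of this binary relation
      consists of triples as \<open>Colouring\<close> demands.\<close>
    let ?Q = "\<lambda>p i. \<exists>x. x < p + 1 \<and> (\<exists>y. y < p + 1 \<and> p = pairM x y \<and> (\<exists>n. n < x + 1 \<and> f n = x) \<and>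
      (\<exists>n. n < y + 1 \<and> f n = y) \<and> x < y \<and> (\<exists>j<k. i = of_nat j \<and> C j x y))"
    have "drel ?Q"
      unfolding drel_def using C
      by (intro S0_intros S0_pairM S0_dfun[OF f] S0_bex_nat S0_drel[of "C _"]) blast
    then obtain P where P: "P \<in> sets" "is_rel P" "set_rel P = ?Q" by (rule set_of_drel)
    have PQ: "pairM p i \<in> P \<longleftrightarrow> ?Q p i" for p i using fun_cong[OF fun_cong[OF P(3)], of p i] by simp
    have P_iff: "pairM (pairM x y) i \<in> P \<longleftrightarrow>
        (\<exists>n. f n = x) \<and> (\<exists>n. f n = y) \<and> x < y \<and> (\<exists>j<k. i = of_nat j \<and> C j x y)" for x y i
      using PQ[of "pairM x y" i] unfolding rng bounded_ex_pair .
    obtain X where X: "X \<in> sets" "is_fun X" "\<And>x y. pairM x y \<in> X \<longleftrightarrow> f x = y"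
      using set_of_dfun[OF f] by metis
    have "set_colouring k X P"
      unfolding set_colouring_def X(3)
    proof (intro conjI allI impI)
      fix z assume "z \<in> P"
      then obtain p i where z: "z = pairM p i" using P(2) unfolding is_rel_def by blast
      then have "?Q p i" using \<open>z \<in> P\<close> PQ by blast
      then obtain x y j where *: "p = pairM x y" "\<exists>n. f n = x" "\<exists>n. f n = y" "x < y" "j < k" "i = of_nat j"
        by blast
      have "i < of_nat k" using *(5,6) by simp
      then show "\<exists>x y i. z = pairM (pairM x y) i \<and> (\<exists>n. f n = x) \<and> (\<exists>n. f n = y) \<and> x < y \<and> i < of_nat k"
        using z * by blast
    next
      fix x y assume "(\<exists>n. f n = x) \<and> (\<exists>n. f n = y) \<and> x < y"
      then obtain n m where nm: "f n = x" "f m = y" "x < y" by blast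
      then obtain j where "j < k" "C j x y" using colour inc_iff[of n m] by metis
      then have "of_nat j < (of_nat k :: 'a)" "pairM (pairM x y) (of_nat j) \<in> P"
        using nm P_iff by auto
      then show "\<exists>i. i < of_nat k \<and> pairM (pairM x y) i \<in> P" by blast
    next
      fix x y i j assume "pairM (pairM x y) i \<in> P \<and> pairM (pairM x y) j \<in> P"
      then obtain n m i' j' where *: "f n = x" "f m = y" "x < y" "i' < k" "i = of_nat i'" "C i' x y"
          "j' < k" "j = of_nat j'" "C j' x y" unfolding P_iff by blast
      then have "n < m" using inc_iff by blast
      then have "i' = j'" using colour * by blast
      then show "i = j" using * by simp
    qed
    moreover have "grows h X" using grows_iff[OF X(3)] growth by blast
    moreover have "\<forall>m n x y. m < n \<and> pairM m x \<in> X \<and> pairM n y \<in> X \<longrightarrow> x < y"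
      unfolding X(3) using inc by blast
    ultimately obtain Y c b l j where Y: "\<forall>y. y \<in> Y \<longrightarrow> (\<exists>n. pairM n y \<in> X)"
        and mem: "\<forall>z. z \<in> Y \<longleftrightarrow> (\<exists>i. i < l \<and> entryM c b i z)"
        and inc_Y: "\<forall>i. i + 1 < l \<longrightarrow> (\<exists>u v. entryM c b i u \<and> entryM c b (i + 1) v \<and> u < v)"
        and large: "\<exists>m. entryM c b 0 m \<and> m < l"
        and hom: "\<forall>i. i + 1 < l \<longrightarrow>
          (\<exists>u v. entryM c b i u \<and> entryM c b (i + 1) v \<and> pairM (pairM u v) j \<in> P)"
      using wph[unfolded holds_WPH, THEN bspec, OF X(1), THEN bspec, OF P(1)] X(2) by blast
    \<comment> \<open>Position 0 has an entry by largeness, and a successor position by the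
      condition that the enumeration increases.\<close>
    have entries: "\<exists>n. entryM c b p (f n)" if p: "p < l" for p
    proof -
      have "\<exists>z. entryM c b p z"
      proof (cases "p = 0")
        case False
        then obtain q where q: "p = q + 1" using basic_zero_or_succ by blast
        then show ?thesis using inc_Y p by blast
      qed (use large in blast)
      then obtain z where z: "entryM c b p z" by blast
      then have "z \<in> Y" using mem p by blast
      then show ?thesis using Y z unfolding X(3) by blast
    qed
    \<comment> \<open>If there is a pair, its colour is the numeral of an index; otherwise any index
      will do.\<close>
    have "\<exists>i. \<forall>p. p + 1 < l \<longrightarrow> (\<exists>u v. entryM c b p u \<and> entryM c b (p + 1) v \<and> u < v \<and> C i u v)"
    proof (cases "0 + 1 < l")
      case True
      then obtain u v where "pairM (pairM u v) j \<in> P" using hom by blast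
      then obtain i where i: "j = of_nat i" unfolding P_iff by blast
      have "u < v \<and> C i u v" if "pairM (pairM u v) j \<in> P" for u v
        using that unfolding P_iff i by auto
      then show ?thesis using hom by meson
    next
      case False
      have "\<not> p + 1 < l" for p
      proof
        assume "p + 1 < l"
        then show False using False differ_nonneg[of p] unfolding lin by linarith
      qed
      then show ?thesis by blast
    qed
    then show "\<exists>i c b l. large_chain f (C i) c b l"
      unfolding large_chain_def using entries large by blast
  qed
next
  assume principle: "homogeneous_thm F k"
  show "holds zn zs 0 w 0 v (WPH h k)"
    unfolding holds_WPH
  proof (intro ballI impI, elim conjE)
    fix X P :: "'a set"
    assume X: "X \<in> sets" "is_fun X" and inc: "\<forall>m n x y. m < n \<and> pairM m x \<in> X \<and> pairM n y \<in> X \<longrightarrow> x < y"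
      and growth: "grows h X" and P: "P \<in> sets" "set_colouring k X P"
    obtain f where f: "dfun f" "\<And>x y. pairM x y \<in> X \<longleftrightarrow> f x = y" using fun_of_set[OF X] by metis
    have unique: "\<forall>x y i j. pairM (pairM x y) i \<in> P \<and> pairM (pairM x y) j \<in> P \<longrightarrow> i = j"
      using P(2) unfolding set_colouring_def by (elim conjE)
    define C where "C i x y \<longleftrightarrow> pairM (pairM x y) (of_nat i) \<in> P" for i x y
    have f_inc: "\<forall>n m. n < m \<longrightarrow> f n < f m" using inc unfolding f(2) by blast
    have "drel (C i)" for i
      unfolding drel_def C_def by (intro S0_intros S0_pairM P(1))
    moreover have "\<exists>!i. i < k \<and> C i (f n) (f m)" if nm: "n < m" for n m
    proof -
      have "f n < f m" using f_inc nm by blast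
      then obtain i' where i': "i' < of_nat k" "pairM (pairM (f n) (f m)) i' \<in> P"
        using P(2) unfolding set_colouring_def f(2) by blast
      then obtain i where "i < k" "i' = of_nat i" using less_of_nat_model by blast
      then have i: "i < k" "C i (f n) (f m)" using i'(2) unfolding C_def by simp_all
      have "j = i" if "C j (f n) (f m)" for j
      proof -
        have "(of_nat j :: 'a) = of_nat i"
          using that i(2) unique unfolding C_def by blast
        then show ?thesis by simp
      qed
      then show ?thesis using i by blast
    qed
    moreover have "bounded_growth F f" using grows_iff[OF f(2)] growth by blast
    ultimately have "dfun f \<and> (\<forall>n m. n < m \<longrightarrow> f n < f m) \<and> bounded_growth F f \<and>
        (\<forall>i<k. drel (C i)) \<and> (\<forall>n m. n < m \<longrightarrow> (\<exists>!i. i < k \<and> C i (f n) (f m)))"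
      using f(1) f_inc by simp
    then have "\<exists>i c b l. large_chain f (C i) c b l"
      by (rule principle[unfolded homogeneous_thm_def, THEN spec, THEN spec, THEN mp])
    then obtain i c b l where ch: "large_chain f (C i) c b l" by blast
    have "\<exists>Y \<in> sets. \<forall>z. z \<in> Y \<longleftrightarrow> (\<exists>p. p < l \<and> entryM c b p z)"
      by (rule S0_comprehension) (intro S0_intros S0_entryM)
    then obtain Y where Y: "Y \<in> sets" "\<forall>z. z \<in> Y \<longleftrightarrow> (\<exists>p. p < l \<and> entryM c b p z)" by blast
    have sub: "\<exists>n. pairM n y \<in> X" if "y \<in> Y" for y
    proof -
      obtain p where p: "p < l" "entryM c b p y" using Y(2) \<open>y \<in> Y\<close> by blast
      then obtain n where "entryM c b p (f n)" using ch unfolding large_chain_def by blast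
      then show ?thesis unfolding f(2) using entryM_unique[OF p(2)] by blast
    qed
    have hom: "\<exists>u v. entryM c b p u \<and> entryM c b (p + 1) v \<and> u < v \<and> pairM (pairM u v) (of_nat i) \<in> P"
      if "p + 1 < l" for p
      using ch that unfolding large_chain_def C_def by blast
    have large: "\<exists>m. entryM c b 0 m \<and> m < l" using ch unfolding large_chain_def by blast
    show "\<exists>Y \<in> sets. (\<forall>y. y \<in> Y \<longrightarrow> (\<exists>n. pairM n y \<in> X)) \<and> (\<exists>c b l.
      (\<forall>z. z \<in> Y \<longleftrightarrow> (\<exists>i. i < l \<and> entryM c b i z)) \<and>
      (\<forall>i. i + 1 < l \<longrightarrow> (\<exists>u v. entryM c b i u \<and> entryM c b (i + 1) v \<and> u < v)) \<and>
      (\<exists>m. entryM c b 0 m \<and> m < l) \<and>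
      (\<exists>j. \<forall>i. i + 1 < l \<longrightarrow>
        (\<exists>u v. entryM c b i u \<and> entryM c b (i + 1) v \<and> pairM (pairM u v) j \<in> P)))"
    proof (rule bexI[OF _ Y(1)], rule conjI)
      show "\<forall>y. y \<in> Y \<longrightarrow> (\<exists>n. pairM n y \<in> X)" using sub by blast
      have inc_Y: "\<forall>p. p + 1 < l \<longrightarrow> (\<exists>u v. entryM c b p u \<and> entryM c b (p + 1) v \<and> u < v)"
        and hom_Y: "\<forall>p. p + 1 < l \<longrightarrow>
          (\<exists>u v. entryM c b p u \<and> entryM c b (p + 1) v \<and> pairM (pairM u v) (of_nat i) \<in> P)"
        using hom by blast+
      show "\<exists>c b l. (\<forall>z. z \<in> Y \<longleftrightarrow> (\<exists>i. i < l \<and> entryM c b i z)) \<and>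
        (\<forall>i. i + 1 < l \<longrightarrow> (\<exists>u v. entryM c b i u \<and> entryM c b (i + 1) v \<and> u < v)) \<and>
        (\<exists>m. entryM c b 0 m \<and> m < l) \<and>
        (\<exists>j. \<forall>i. i + 1 < l \<longrightarrow>
          (\<exists>u v. entryM c b i u \<and> entryM c b (i + 1) v \<and> pairM (pairM u v) j \<in> P))"
        by (rule exI[of _ c], rule exI[of _ b], rule exI[of _ l])
          (intro conjI Y(2) inc_Y large exI[of _ "of_nat i"] hom_Y)
    qed
  qed
qed

lemma principles_hold_iff:
  assumes "A \<in> {WPH h k, HCT k h, TT k h}" and "B \<in> {WPH h k, HCT k h, TT k h}"
  shows "holds zn zs 0 (w :: nat \<Rightarrow> 'a) 0 v (A \<^bold>\<longleftrightarrow> B)"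
  using assms principles_equivalent[OF F_cases, of k] by (auto simp: HCT_iff TT_iff WPH_iff)

end

lemma total_exists:
  assumes "\<forall>x :: 'a::rca_model. \<exists>y. Fg h x y"
  shows "\<exists>F :: 'a \<Rightarrow> 'a. total h F"
proof -
  interpret fast "Fg h :: 'a \<Rightarrow> _" by (rule fast_Fg)
  obtain F :: "'a \<Rightarrow> 'a" where "\<And>x. Fg h x (F x)" using assms by metis
  then have "total h F" by unfold_locales (use functional in blast)
  then show ?thesis by blast
qed


section \<open>The countermodel\<close>

definition separates :: "fm set \<Rightarrow> bool" where
  "separates G \<longleftrightarrow> (\<exists>h k. \<exists>A \<in> {WPH h k, HCT k h, TT k h}. \<exists>B \<in> {WPH h k, HCT k h, TT k h}.
    sentence (Tot h) \<in> G \<and> sentence (A \<^bold>\<longleftrightarrow> B) \<notin> G)"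

text \<open>A type of models cannot depend on the parameters of a theorem. The term model is therefore built
  from a single Henkin theory, which violates the theorem for some parameters if any such theory does.\<close>

definition generic_theory :: "fm set" where
  "generic_theory = (SOME G. Henkin G \<and> RCA0_star \<subseteq> G \<and>
    ((\<exists>G'. Henkin G' \<and> RCA0_star \<subseteq> G' \<and> separates G') \<longrightarrow> separates G))"

lemma generic_theory_props:
  "Henkin generic_theory" "RCA0_star \<subseteq> generic_theory"
  "Henkin G \<Longrightarrow> RCA0_star \<subseteq> G \<Longrightarrow> separates G \<Longrightarrow> separates generic_theory"
proof -
  \<comment> \<open>The axioms alone have a Henkin extension, so the choice succeeds whether or not
    some theory separates the principles.\<close>
  have "extendable RCA0_star"
    unfolding extendable_def using consistent_RCA0_star bounded_RCA0_star by blast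
  then obtain G0 where "Henkin G0" "RCA0_star \<subseteq> G0" using Henkin_extension by blast
  then have "\<exists>G. Henkin G \<and> RCA0_star \<subseteq> G \<and>
      ((\<exists>G'. Henkin G' \<and> RCA0_star \<subseteq> G' \<and> separates G') \<longrightarrow> separates G)" by blast
  from someI_ex[OF this]
  show "Henkin generic_theory" "RCA0_star \<subseteq> generic_theory"
    "Henkin G \<Longrightarrow> RCA0_star \<subseteq> G \<Longrightarrow> separates G \<Longrightarrow> separates generic_theory"
    unfolding generic_theory_def by blast+
qed

lemma Henkin_closed: "G \<turnstile> p \<Longrightarrow> Henkin G \<Longrightarrow> p \<in> G"
  by (simp add: Henkin_def)

lemma generic_refl: "Eq t t \<in> generic_theory"
  by (rule Henkin_closed[OF proves.EqI generic_theory_props(1)])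

lemma generic_subst: "Eq t u \<in> generic_theory \<Longrightarrow> inst t p \<in> generic_theory \<Longrightarrow> inst u p \<in> generic_theory"
  by (rule Henkin_closed[OF proves.EqE generic_theory_props(1)]) (auto intro: proves.Assm)

definition same :: "tm \<Rightarrow> tm \<Rightarrow> bool" where
  "same t u \<longleftrightarrow> Eq t u \<in> generic_theory"

lemma same_refl: "same t t"
  unfolding same_def by (rule generic_refl)

lemma same_sym: "same t u \<Longrightarrow> same u t"
  using generic_subst[of t u "Eq (Var 0) (lift_tm t)"] generic_refl[of t]
  by (simp add: same_def inst_def subst_tm_subst_tm)

lemma same_trans: "same t u \<Longrightarrow> same u v \<Longrightarrow> same t v"
  using generic_subst[of u v "Eq (lift_tm t) (Var 0)"]
  by (simp add: same_def inst_def subst_tm_subst_tm)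

text \<open>The equality rule replaces one term at a time, hence the intermediate term
  \<open>op t' u\<close>.\<close>

lemma same_cong:
  assumes op: "\<And>s a b. subst_tm s (op a b) = op (subst_tm s a) (subst_tm s b)"
    and "same t t'" and "same u u'"
  shows "same (op t u) (op t' u')"
proof -
  have "same (op t u) (op t' u)"
    using generic_subst[of t t' "Eq (lift_tm (op t u)) (op (Var 0) (lift_tm u))"] assms(2) generic_refl
    by (simp add: same_def inst_def op subst_tm_subst_tm)
  moreover have "same (op t' u) (op t' u')"
    using generic_subst[of u u' "Eq (lift_tm (op t' u)) (op (lift_tm t') (Var 0))"] assms(3) generic_refl
    by (simp add: same_def inst_def op subst_tm_subst_tm)
  ultimately show ?thesis by (rule same_trans)
qed

lemma same_Lt:
  assumes "same t t'" and "same u u'"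
  shows "Lt t u \<in> generic_theory \<longleftrightarrow> Lt t' u' \<in> generic_theory"
proof -
  have "Lt t' u' \<in> generic_theory" if "same t t'" "same u u'" "Lt t u \<in> generic_theory" for t t' u u'
  proof -
    have "Lt t' u \<in> generic_theory"
      using generic_subst[of t t' "Lt (Var 0) (lift_tm u)"] that
      by (simp add: same_def inst_def subst_tm_subst_tm)
    then show ?thesis
      using generic_subst[of u u' "Lt (lift_tm t') (Var 0)"] that
      by (simp add: same_def inst_def subst_tm_subst_tm)
  qed
  then show ?thesis using assms same_sym by blast
qed

lemma same_Mem: "same t t' \<Longrightarrow> Mem t X \<in> generic_theory \<longleftrightarrow> Mem t' X \<in> generic_theory"
proof -
  have "Mem t' X \<in> generic_theory" if "same t t'" "Mem t X \<in> generic_theory" for t t'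
    using generic_subst[of t t' "Mem (Var 0) X"] that by (simp add: same_def inst_def)
  then show "same t t' \<Longrightarrow> Mem t X \<in> generic_theory \<longleftrightarrow> Mem t' X \<in> generic_theory"
    using same_sym by blast
qed

\<comment> \<open>The term model of the generic theory\<close>
quotient_type generic_model = tm / same morphisms term_of_class class_of_term
  by (intro equivpI reflpI sympI transpI; (rule same_refl | erule same_sym | erule (1) same_trans))

lift_definition generic_less :: "generic_model \<Rightarrow> generic_model \<Rightarrow> bool"
  is "\<lambda>t u. Lt t u \<in> generic_theory" by (rule same_Lt)

lift_definition generic_mem :: "generic_model \<Rightarrow> nat \<Rightarrow> bool"
  is "\<lambda>t X. Mem t X \<in> generic_theory" by (intro ext same_Mem)

definition extension :: "nat \<Rightarrow> generic_model set" where
  "extension X = {x. generic_mem x X}"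

instantiation generic_model :: so_structure
begin

lift_definition zero_generic_model :: generic_model is Zero .
lift_definition one_generic_model :: generic_model is One .
lift_definition plus_generic_model :: "generic_model \<Rightarrow> generic_model \<Rightarrow> generic_model" is Add
  by (rule same_cong[where op = Add]) simp_all
lift_definition times_generic_model :: "generic_model \<Rightarrow> generic_model \<Rightarrow> generic_model" is Mul
  by (rule same_cong[where op = Mul]) simp_all
lift_definition expo_generic_model :: "generic_model \<Rightarrow> generic_model \<Rightarrow> generic_model" is Pow
  by (rule same_cong[where op = Pow]) simp_all
definition less_generic_model :: "generic_model \<Rightarrow> generic_model \<Rightarrow> bool" where
  "less_generic_model = generic_less"
definition less_eq_generic_model :: "generic_model \<Rightarrow> generic_model \<Rightarrow> bool" where
  "less_eq_generic_model x y \<longleftrightarrow> x < y \<or> x = y"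
definition minus_generic_model :: "generic_model \<Rightarrow> generic_model \<Rightarrow> generic_model" where
  "minus_generic_model x y = (if x < y then 0 else THE z. x = y + z)"
definition sets_generic_model :: "generic_model set set" where
  "sets_generic_model = range extension"

instance by standard (simp add: sets_generic_model_def)

end

lemma eval_class: "eval (\<lambda>i. class_of_term (s i)) t = class_of_term (subst_tm s t)"
  by (induction t) (simp_all add: zero_generic_model.abs_eq one_generic_model.abs_eq
      plus_generic_model.abs_eq times_generic_model.abs_eq expo_generic_model.abs_eq)

lemma ex_class: "\<exists>t. x = class_of_term t"
  by (metis Quotient_abs_rep Quotient_generic_model)

text \<open>Quantifiers range over objects with names, so giving a value to a bound variable extends
  the substitution by a name. Assignments are therefore kept in the form of substitutions throughout
  the induction.\<close>

lemma truth_lemma: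
  "sat (\<lambda>i. class_of_term (s i)) (\<lambda>X. extension (r X)) p \<longleftrightarrow> subst s r p \<in> generic_theory"
proof (induction p arbitrary: s r)
  case Fls
  then show ?case using generic_theory_props(1) by (simp add: Henkin_def)
next
  case (Eq t u)
  then show ?case by (simp add: eval_class generic_model.abs_eq_iff same_def)
next
  case (Lt t u)
  then show ?case by (simp add: eval_class less_generic_model_def generic_less.abs_eq)
next
  case (Mem t X)
  then show ?case by (simp add: eval_class extension_def generic_mem.abs_eq)
next
  case (Imp p q)
  then show ?case using generic_theory_props(1) by (simp add: Henkin_def)
next
  case (All p)
  have env: "case_nat (class_of_term t) (\<lambda>i. class_of_term (s i)) = (\<lambda>i. class_of_term (case_nat t s i))" for t
    by (auto simp: fun_eq_iff split: nat.split)
  have "sat (\<lambda>i. class_of_term (s i)) (\<lambda>X. extension (r X)) (All p) \<longleftrightarrow>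
      (\<forall>t. sat (case_nat (class_of_term t) (\<lambda>i. class_of_term (s i))) (\<lambda>X. extension (r X)) p)"
    using ex_class by (metis sat.simps(6))
  also have "\<dots> \<longleftrightarrow> (\<forall>t. inst t (subst (up s) r p) \<in> generic_theory)"
    by (simp only: env All.IH inst_subst)
  also have "\<dots> \<longleftrightarrow> subst s r (All p) \<in> generic_theory"
    using generic_theory_props(1) by (simp add: Henkin_def)
  finally show ?case .
next
  case (AllS p)
  have env: "case_nat (extension X) (\<lambda>i. extension (r i)) = (\<lambda>i. extension (case_nat X r i))" for X
    by (auto simp: fun_eq_iff split: nat.split)
  have "sat (\<lambda>i. class_of_term (s i)) (\<lambda>X. extension (r X)) (AllS p) \<longleftrightarrow>
      (\<forall>X. sat (\<lambda>i. class_of_term (s i)) (case_nat (extension X) (\<lambda>i. extension (r i))) p)"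
    by (simp add: sets_generic_model_def)
  also have "\<dots> \<longleftrightarrow> (\<forall>X. instS X (subst s (upS r) p) \<in> generic_theory)"
    by (simp only: env AllS.IH instS_subst)
  also have "\<dots> \<longleftrightarrow> subst s r (AllS p) \<in> generic_theory"
    using generic_theory_props(1) by (simp add: Henkin_def)
  finally show ?case .
qed

instance generic_model :: rca_model
proof
  fix p and S :: "nat \<Rightarrow> generic_model set" and e :: "nat \<Rightarrow> generic_model"
  assume p: "p \<in> RCA0_star" and S: "\<And>X. S X \<in> sets"
  \<comment> \<open>An arbitrary assignment is replaced by names for its values; substituting these
    leaves the closed axioms unchanged.\<close>
  have "\<forall>X. \<exists>Y. S X = extension Y" using S unfolding sets_generic_model_def by blast
  then obtain r where r: "\<And>X. S X = extension (r X)" by metis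
  have "\<forall>i. \<exists>t. e i = class_of_term t" using ex_class by blast
  then obtain s where s: "\<And>i. e i = class_of_term (s i)" by metis
  have "e = (\<lambda>i. class_of_term (s i))" "S = (\<lambda>X. extension (r X))" using r s by auto
  moreover have "subst s r p \<in> generic_theory"
    using p generic_theory_props(2) by (auto simp: subst_closed[OF bounded_RCA0_star])
  ultimately show "sat e S p" by (simp only: truth_lemma)
qed (rule less_eq_generic_model_def minus_generic_model_def)+

lemma env_0: "env z 0 w = z"
  by (simp add: env_def fun_eq_iff)

lemma generic_theory_iff: "sentence p \<in> generic_theory \<longleftrightarrow>
  holds (\<lambda>i. class_of_term (Var i)) extension 0 w 0 v p"
  using truth_lemma[of Var id "p 0 0"] by (simp add: holds_def sentence_def env_0)

lemma not_separates_generic: "\<not> separates generic_theory"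
proof
  assume "separates generic_theory"
  then obtain h k A B where AB: "A \<in> {WPH h k, HCT k h, TT k h}" "B \<in> {WPH h k, HCT k h, TT k h}"
      and Tot: "sentence (Tot h) \<in> generic_theory" and not: "sentence (A \<^bold>\<longleftrightarrow> B) \<notin> generic_theory"
    unfolding separates_def by blast
  have "\<forall>x :: generic_model. \<exists>y. Fg h x y"
    using Tot unfolding generic_theory_iff[where w = "\<lambda>_. 0" and v = "\<lambda>_. {}"] holds_Tot .
  then obtain F :: "generic_model \<Rightarrow> generic_model" where "total h F" using total_exists by blast
  then interpret total h F .
  show False
    using not principles_hold_iff[OF AB] unfolding generic_theory_iff[where w = "\<lambda>_. 0" and v = "\<lambda>_. {}"] by blast
qed

theorem theorem7p2:
  fixes h k :: nat
  shows "\<forall>A \<in> {WPH h k, HCT k h, TT k h}. \<forall>B \<in> {WPH h k, HCT k h, TT k h}.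
    RCA0_star \<union> {sentence (Tot h)} \<turnstile> sentence (A \<^bold>\<longleftrightarrow> B)"
proof (intro ballI, rule ccontr)
  fix A B
  assume AB: "A \<in> {WPH h k, HCT k h, TT k h}" "B \<in> {WPH h k, HCT k h, TT k h}"
    and not: "\<not> RCA0_star \<union> {sentence (Tot h)} \<turnstile> sentence (A \<^bold>\<longleftrightarrow> B)"
  let ?\<Gamma> = "insert (Neg (sentence (A \<^bold>\<longleftrightarrow> B))) (insert (sentence (Tot h)) RCA0_star)"
  have con: "consistent ?\<Gamma>" using not proves_iff_inconsistent by simp
  have mono: "consistent \<Delta>" if "\<Delta> \<subseteq> ?\<Gamma>" for \<Delta>
    using con that proves_mono unfolding consistent_def by blast
  have "extendable RCA0_star"
    unfolding extendable_def using consistent_RCA0_star bounded_RCA0_star by blast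
  then have "extendable (insert (sentence (Tot h)) RCA0_star)"
    by (rule extendable_insert) (rule mono, blast)
  then have "extendable ?\<Gamma>" by (rule extendable_insert[OF _ con])
  then obtain G where G: "Henkin G" "?\<Gamma> \<subseteq> G" using Henkin_extension by blast
  have "Imp (sentence (A \<^bold>\<longleftrightarrow> B)) Fls \<in> G" and Tot: "sentence (Tot h) \<in> G" and sub: "RCA0_star \<subseteq> G"
    using G(2) by (simp_all add: Neg_def)
  then have "sentence (A \<^bold>\<longleftrightarrow> B) \<notin> G" using G(1) by (simp add: Henkin_def)
  then have "separates G"
    unfolding separates_def by (intro exI[of _ h] exI[of _ k] bexI[of _ A] bexI[of _ B] conjI Tot AB)
  \<comment> \<open>The failure passes to the generic theory, possibly for other values of h and k;
    this is enough because its term model refutes every such failure.\<close>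
  then have "separates generic_theory" by (rule generic_theory_props(3)[OF G(1) sub])
  then show False using not_separates_generic by contradiction
qed

end
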